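(* Let $F\colon\mathscr{P}_2(\mathbb{R}^d)\to\mathbb{R}$ and let $\lambda\in\mathbb{R}$. If $F$ is twice differentiable on $\mathscr{P}_2(\mathbb{R}^d)$ (i.e. twice differentiable at every $\mu\in\mathscr{P}_2(\mathbb{R}^d)$), then $F$ is $\lambda$-geodesically convex if and only if, for all $\mu\in\mathscr{P}_2(\mathbb{R}^d)$ and all $\zeta\in T_\mu\mathscr{P}_2(\mathbb{R}^d)$, $$\mathrm{Hess}F[\mu](\zeta,\zeta)\ \ge\ \lambda\,\|\zeta\|_{L^2(\mu)}^2 .$$
   Context: $\mathscr{P}_2(\mathbb{R}^d)$ is the set of Borel probability measures on $\mathbb{R}^d$ with finite second moment, endowed with the $2$-Wasserstein distance $W_2(\mu,\nu)=\inf\{(\int|x_1-x_2|^2\,d\gamma)^{1/2}:\gamma\in\Gamma(\mu,\nu)\}$, where $\Gamma(\mu,\nu)$ is the set of $\gamma\in\mathscr{P}_2(\mathbb{R}^d\times\mathbb{R}^d)$ with first marginal $\mu$ and second marginal $\nu$. $\Gamma_o(\mu,\nu)$ is the set of $\gamma\in\Gamma(\mu,\nu)$ with $\int|x_1-x_2|^2\,d\gamma=W_2^2(\mu,\nu)$. $\pi^1,\pi^2$ are the coordinate projections and $_{\#}$ denotes pushforward. $\nabla C_c^\infty(\mathbb{R}^d):=\{\nabla\varphi:\varphi\in C_c^\infty(\mathbb{R}^d)\}$, and $T_\mu\mathscr{P}_2(\mathbb{R}^d)$ is the closure of $\nabla C_c^\infty(\mathbb{R}^d)$ in $L^2(\mu;\mathbb{R}^d)$.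 Differentiability: for a real-valued function $G$ on $\mathscr{P}_2(\mathbb{R}^d)$ (or on a neighbourhood of $\mu$) and $\xi\in L^2(\mu;\mathbb{R}^d)$, write $\xi\in\partial G[\mu]$ if $G(\nu)-G(\mu)=\int\xi(x_1)\cdot(x_2-x_1)\,d\gamma(x_1,x_2)+o(W_2(\mu,\nu))$ for all $\nu$ and all $\gamma\in\Gamma_o(\mu,\nu)$ (for every $\epsilon>0$ there is $\delta>0$ such that the error is at most $\epsilon W_2(\mu,\nu)$ in absolute value for all $\nu$ with $W_2(\mu,\nu)<\delta$ and all $\gamma\in\Gamma_o(\mu,\nu)$). $G$ is differentiable at $\mu$ if $\partial G[\mu]\ne\varnothing$; then $\nabla_wG[\mu]$ is the element of $\partial G[\mu]$ of minimal $L^2(\mu)$-norm, and for $\zeta\in L^2(\mu;\mathbb{R}^d)$ one writes $\zeta\cdot G[\mu]:=\langle\zeta,\nabla_wG[\mu]\rangle_{L^2(\mu)}$. Hessian: let $F$ be differentiable in a neighbourhood of $\mu$ and let $\nu\mapsto\zeta\cdot F[\nu]$ be differentiable at $\mu$ for all $\zeta\in\nabla C_c^\infty(\mathbb{R}^d)$. Define $\overline{\mathrm{Hess}}F[\mu]\colon\nabla C_c^\infty(\mathbb{R}^d)\times\nabla C_c^\infty(\mathbb{R}^d)\to\mathbb{R}$ by $\overline{\mathrm{Hess}}F[\mu](\zeta_1,\zeta_2):=\zeta_1\cdot(\zeta_2\cdot F[\mu])-(\nabla\zeta_2\,\zeta_1)\cdot F[\mu]$, where the first term is $\langle\zeta_1,\nabla_wG[\mu]\rangle_{L^2(\mu)}$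 for $G(\nu)=\zeta_2\cdot F[\nu]$, and $\nabla\zeta_2\,\zeta_1$ is the Jacobian of $\zeta_2$ applied to $\zeta_1$. If $\overline{\mathrm{Hess}}F[\mu]$ exists and there is $C\in\mathbb{R}$ with $\overline{\mathrm{Hess}}F[\mu](\zeta_1,\zeta_2)\le C\|\zeta_1\|_{L^2(\mu)}\|\zeta_2\|_{L^2(\mu)}$ for all $\zeta_1,\zeta_2\in\nabla C_c^\infty(\mathbb{R}^d)$, then $F$ is said to be twice differentiable at $\mu$, and $\mathrm{Hess}F[\mu]$ denotes the unique (continuous bilinear) extension of $\overline{\mathrm{Hess}}F[\mu]$ to $T_\mu\mathscr{P}_2(\mathbb{R}^d)\times T_\mu\mathscr{P}_2(\mathbb{R}^d)$. A curve $[0,1]\ni t\mapsto\mu_t$ is a geodesic between $\mu_1$ and $\mu_2$ if there is $\gamma\in\Gamma_o(\mu_1,\mu_2)$ with $\mu_t=((1-t)\pi^1+t\pi^2)_{\#}\gamma$ for all $t\in[0,1]$. $F$ is $\lambda$-geodesically convex if between every pair $\mu_1,\mu_2\in\mathscr{P}_2(\mathbb{R}^d)$ there exists a geodesic $t\mapsto\mu_t$ such that $F(\mu_t)\le(1-t)F(\mu_1)+tF(\mu_2)-\frac{\lambda}{2}t(1-t)W_2^2(\mu_1,\mu_2)$ for all $t\in[0,1]$. *)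

theory Defs
  imports "HOL-Probability.Probability"
begin

section \<open>The Wasserstein space\<close>

definition P2 :: "'a::euclidean_space measure set" where
  "P2 = {\<mu>. prob_space \<mu> \<and> sets \<mu> = sets borel \<and> integrable \<mu> (\<lambda>x. (norm x)\<^sup>2)}"

definition couplings ::
    "'a::euclidean_space measure \<Rightarrow> 'a measure \<Rightarrow> ('a \<times> 'a) measure set" where
  "couplings \<mu> \<nu> = {\<gamma> \<in> P2. distr \<gamma> borel fst = \<mu> \<and> distr \<gamma> borel snd = \<nu>}"

definition transport_cost :: "('a::euclidean_space \<times> 'a) measure \<Rightarrow> real" where
  "transport_cost \<gamma> = (LINT z|\<gamma>. (norm (fst z - snd z))\<^sup>2)"

definition W2 :: "'a::euclidean_space measure \<Rightarrow> 'a measure \<Rightarrow> real" where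
  "W2 \<mu> \<nu> = (INF \<gamma>\<in>couplings \<mu> \<nu>. sqrt (transport_cost \<gamma>))"

definition optimal_couplings ::
    "'a::euclidean_space measure \<Rightarrow> 'a measure \<Rightarrow> ('a \<times> 'a) measure set" where
  "optimal_couplings \<mu> \<nu> = {\<gamma> \<in> couplings \<mu> \<nu>. transport_cost \<gamma> = (W2 \<mu> \<nu>)\<^sup>2}"


section \<open>Square-integrable vector fields and the tangent space\<close>

text \<open>Elements of \<open>L\<^sup>2(\<mu>; \<real>\<^sup>d)\<close> are represented by functions, not by classes of functions that agree
  \<open>\<mu>\<close>-almost everywhere; \<open>L2_norm \<mu>\<close> is thus a seminorm on \<open>L2 \<mu>\<close>.\<close>

definition L2 :: "'a::euclidean_space measure \<Rightarrow> ('a \<Rightarrow> 'a) set" where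
  "L2 \<mu> = {\<xi> \<in> borel_measurable \<mu>. integrable \<mu> (\<lambda>x. (norm (\<xi> x))\<^sup>2)}"

definition L2_inner :: "'a::euclidean_space measure \<Rightarrow> ('a \<Rightarrow> 'a) \<Rightarrow> ('a \<Rightarrow> 'a) \<Rightarrow> real" where
  "L2_inner \<mu> \<xi> \<zeta> = (LINT x|\<mu>. \<xi> x \<bullet> \<zeta> x)"

definition L2_norm :: "'a::euclidean_space measure \<Rightarrow> ('a \<Rightarrow> 'a) \<Rightarrow> real" where
  "L2_norm \<mu> \<xi> = sqrt (LINT x|\<mu>. (norm (\<xi> x))\<^sup>2)"

primrec Ck_fun :: "nat \<Rightarrow> ('a::euclidean_space \<Rightarrow> real) \<Rightarrow> bool" where
  "Ck_fun 0 f \<longleftrightarrow> continuous_on UNIV f"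
| "Ck_fun (Suc k) f \<longleftrightarrow>
     (\<forall>x. f differentiable (at x)) \<and> (\<forall>v. Ck_fun k (\<lambda>x. frechet_derivative f (at x) v))"

definition test_functions :: "('a::euclidean_space \<Rightarrow> real) set" where
  "test_functions = {\<phi>. (\<forall>k. Ck_fun k \<phi>) \<and> compact (closure {x. \<phi> x \<noteq> 0})}"

definition gradient :: "('a::euclidean_space \<Rightarrow> real) \<Rightarrow> 'a \<Rightarrow> 'a" where
  "gradient \<phi> x = (THE D. GDERIV \<phi> x :> D)"

definition test_gradients :: "('a::euclidean_space \<Rightarrow> 'a) set" where
  "test_gradients = gradient ` test_functions"

definition tangent_space :: "'a::euclidean_space measure \<Rightarrow> ('a \<Rightarrow> 'a) set" where
  "tangent_space \<mu> =
     {\<xi> \<in> L2 \<mu>. \<forall>\<epsilon>>0. \<exists>\<zeta>\<in>test_gradients. L2_norm \<mu> (\<lambda>x. \<xi> x - \<zeta> x) < \<epsilon>}"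


section \<open>First-order differentiability\<close>

text \<open>A function on (a neighbourhood in) \<open>P2\<close> is a total function on measures; only its values on
  that neighbourhood are used below.\<close>

definition wsubdiff ::
    "('a::euclidean_space measure \<Rightarrow> real) \<Rightarrow> 'a measure \<Rightarrow> ('a \<Rightarrow> 'a) set" where
  "wsubdiff G \<mu> = {\<xi> \<in> L2 \<mu>.
     \<forall>\<epsilon>>0. \<exists>\<delta>>0. \<forall>\<nu>\<in>P2. W2 \<mu> \<nu> < \<delta> \<longrightarrow>
       (\<forall>\<gamma>\<in>optimal_couplings \<mu> \<nu>.
          \<bar>G \<nu> - G \<mu> - (LINT z|\<gamma>. \<xi> (fst z) \<bullet> (snd z - fst z))\<bar> \<le> \<epsilon> * W2 \<mu> \<nu>)}"

definition wdifferentiable ::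
    "('a::euclidean_space measure \<Rightarrow> real) \<Rightarrow> 'a measure \<Rightarrow> bool" where
  "wdifferentiable G \<mu> \<longleftrightarrow> wsubdiff G \<mu> \<noteq> {}"

text \<open>The minimiser is unique up to \<open>\<mu>\<close>-null sets; \<^const>\<open>arg_min_on\<close> picks a representative.\<close>

definition wgrad ::
    "('a::euclidean_space measure \<Rightarrow> real) \<Rightarrow> 'a measure \<Rightarrow> 'a \<Rightarrow> 'a" where
  "wgrad G \<mu> = arg_min_on (L2_norm \<mu>) (wsubdiff G \<mu>)"

text \<open>\<open>dir_deriv \<zeta> G \<mu>\<close> is the derivative \<open>\<zeta> \<cdot> G[\<mu>]\<close> of \<open>G\<close> at \<open>\<mu>\<close> along \<open>\<zeta>\<close>.\<close>

definition dir_deriv ::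
    "('a \<Rightarrow> 'a) \<Rightarrow> ('a::euclidean_space measure \<Rightarrow> real) \<Rightarrow> 'a measure \<Rightarrow> real" where
  "dir_deriv \<zeta> G \<mu> = L2_inner \<mu> \<zeta> (wgrad G \<mu>)"


section \<open>The Hessian\<close>

definition pre_hess_exists ::
    "('a::euclidean_space measure \<Rightarrow> real) \<Rightarrow> 'a measure \<Rightarrow> bool" where
  "pre_hess_exists F \<mu> \<longleftrightarrow>
     (\<exists>r>0. \<forall>\<nu>\<in>P2. W2 \<mu> \<nu> < r \<longrightarrow> wdifferentiable F \<nu>) \<and>
     (\<forall>\<zeta>\<in>test_gradients. wdifferentiable (\<lambda>\<nu>. dir_deriv \<zeta> F \<nu>) \<mu>)"

definition pre_hess ::
    "('a::euclidean_space measure \<Rightarrow> real) \<Rightarrow> 'a measure \<Rightarrow> ('a \<Rightarrow> 'a) \<Rightarrow> ('a \<Rightarrow> 'a) \<Rightarrow> real" where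
  "pre_hess F \<mu> \<zeta>\<^sub>1 \<zeta>\<^sub>2 =
     dir_deriv \<zeta>\<^sub>1 (\<lambda>\<nu>. dir_deriv \<zeta>\<^sub>2 F \<nu>) \<mu>
     - dir_deriv (\<lambda>x. frechet_derivative \<zeta>\<^sub>2 (at x) (\<zeta>\<^sub>1 x)) F \<mu>"

definition twice_wdifferentiable ::
    "('a::euclidean_space measure \<Rightarrow> real) \<Rightarrow> 'a measure \<Rightarrow> bool" where
  "twice_wdifferentiable F \<mu> \<longleftrightarrow>
     pre_hess_exists F \<mu> \<and>
     (\<exists>C. \<forall>\<zeta>\<^sub>1\<in>test_gradients. \<forall>\<zeta>\<^sub>2\<in>test_gradients.
        pre_hess F \<mu> \<zeta>\<^sub>1 \<zeta>\<^sub>2 \<le> C * L2_norm \<mu> \<zeta>\<^sub>1 * L2_norm \<mu> \<zeta>\<^sub>2)"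

text \<open>The library's \<^const>\<open>bounded_bilinear\<close> is about whole types; this is the same notion on the
  tangent space with its \<open>L\<^sup>2(\<mu>)\<close> seminorm.  Boundedness makes \<open>B\<close> respect equality
  \<open>\<mu>\<close>-almost everywhere.\<close>

definition tangent_bounded_bilinear ::
    "'a::euclidean_space measure \<Rightarrow> (('a \<Rightarrow> 'a) \<Rightarrow> ('a \<Rightarrow> 'a) \<Rightarrow> real) \<Rightarrow> bool" where
  "tangent_bounded_bilinear \<mu> B \<longleftrightarrow>
     (\<forall>\<xi>\<in>tangent_space \<mu>. \<forall>\<eta>\<in>tangent_space \<mu>. \<forall>\<zeta>\<in>tangent_space \<mu>.
        B (\<lambda>x. \<xi> x + \<eta> x) \<zeta> = B \<xi> \<zeta> + B \<eta> \<zeta> \<and>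
        B \<zeta> (\<lambda>x. \<xi> x + \<eta> x) = B \<zeta> \<xi> + B \<zeta> \<eta>) \<and>
     (\<forall>c. \<forall>\<xi>\<in>tangent_space \<mu>. \<forall>\<zeta>\<in>tangent_space \<mu>.
        B (\<lambda>x. c *\<^sub>R \<xi> x) \<zeta> = c * B \<xi> \<zeta> \<and>
        B \<zeta> (\<lambda>x. c *\<^sub>R \<xi> x) = c * B \<zeta> \<xi>) \<and>
     (\<exists>C. \<forall>\<xi>\<in>tangent_space \<mu>. \<forall>\<zeta>\<in>tangent_space \<mu>.
        \<bar>B \<xi> \<zeta>\<bar> \<le> C * L2_norm \<mu> \<xi> * L2_norm \<mu> \<zeta>)"

text \<open>The extension is unique on the tangent space; \<open>SOME\<close> only fixes the irrelevant values
  elsewhere.\<close>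

definition Hess ::
    "('a::euclidean_space measure \<Rightarrow> real) \<Rightarrow> 'a measure \<Rightarrow> ('a \<Rightarrow> 'a) \<Rightarrow> ('a \<Rightarrow> 'a) \<Rightarrow> real" where
  "Hess F \<mu> = (SOME B. tangent_bounded_bilinear \<mu> B \<and>
     (\<forall>\<zeta>\<^sub>1\<in>test_gradients. \<forall>\<zeta>\<^sub>2\<in>test_gradients. B \<zeta>\<^sub>1 \<zeta>\<^sub>2 = pre_hess F \<mu> \<zeta>\<^sub>1 \<zeta>\<^sub>2))"


section \<open>Geodesic convexity\<close>

text \<open>Curves are total functions of \<open>t\<close>; only \<open>t \<in> [0,1]\<close> matters.\<close>

definition is_geodesic ::
    "'a::euclidean_space measure \<Rightarrow> 'a measure \<Rightarrow> (real \<Rightarrow> 'a measure) \<Rightarrow> bool" where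
  "is_geodesic \<mu>\<^sub>1 \<mu>\<^sub>2 m \<longleftrightarrow>
     (\<exists>\<gamma>\<in>optimal_couplings \<mu>\<^sub>1 \<mu>\<^sub>2. \<forall>t\<in>{0..1}.
        m t = distr \<gamma> borel (\<lambda>z. (1 - t) *\<^sub>R fst z + t *\<^sub>R snd z))"

definition geodesically_convex ::
    "real \<Rightarrow> ('a::euclidean_space measure \<Rightarrow> real) \<Rightarrow> bool" where
  "geodesically_convex l F \<longleftrightarrow>
     (\<forall>\<mu>\<^sub>1\<in>P2. \<forall>\<mu>\<^sub>2\<in>P2. \<exists>m. is_geodesic \<mu>\<^sub>1 \<mu>\<^sub>2 m \<and>
        (\<forall>t\<in>{0..1}. F (m t) \<le> (1 - t) * F \<mu>\<^sub>1 + t * F \<mu>\<^sub>2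
                              - l / 2 * t * (1 - t) * (W2 \<mu>\<^sub>1 \<mu>\<^sub>2)\<^sup>2))"

end

theory Submission
  imports Defs
begin

text \<open>
  The Hessian of \<open>F\<close> is the second derivative of \<open>F\<close> along curves on which mass
  moves without acceleration, and geodesics are such curves.  Two obstacles lie between this
  heuristic and a proof: differentiability is expressed through optimal couplings, not through
  maps, and no bound on the gradients of \<open>F\<close> that is uniform near a measure is given, so that \<open>F\<close>
  cannot simply be differentiated twice along an arbitrary geodesic.

  First-order calculus.  If a measure \<open>\<mu>\<close> is moved by \<open>id + e(a + r)\<close> with \<open>a = \<nabla>\<phi>\<close> a test gradient
  and \<open>r\<close> small in \<open>L\<^sup>2(\<mu>)\<close>, then every optimal coupling displaces mass by \<open>e a + o(e)\<close>, because the
  increment of \<open>\<integral> \<phi>\<close> depends on the marginals only (\<open>optimal_displacement_deviation\<close>).  Hence \<open>F\<close> has the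
  derivative \<open>\<langle>a, \<nabla>F\<rangle>\<close> along such perturbations (\<open>derivative_along_perturbation\<close>).  This uses the existence of
  optimal couplings, which follows from compactness (\<open>couplings_compact\<close>), and the existence of an element
  of minimal norm in the set of gradients, which follows from completeness of \<open>L\<^sup>2\<close>.  The form
  \<^const>\<open>pre_hess\<close> is bilinear and bounded on test gradients, so \<^const>\<open>Hess\<close> is indeed an extension of it
  (\<open>Hess_extends_pre_hess\<close>), and by density the inequality of the theorem is one about test gradients.

  Convexity implies the Hessian bound.  Small displacements along a test gradient \<open>\<zeta>\<close> are the unique
  geodesics between their end points (\<open>small_displacement_optimal_unique\<close>).  Convexity thus gives
  \<open>F((id + s\<zeta>)\<^sub>#\<nu>) \<ge> F(\<nu>) + s \<zeta>\<cdot>F[\<nu>] + (l/2) s\<^sup>2 \<parallel>\<zeta>\<parallel>\<^sup>2\<close>.  Adding the inequalities for a step from \<open>\<mu>\<close> along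
  \<open>\<tau>\<zeta>\<close> and for the step back along \<open>-\<tau>\<zeta>\<close>, which ends at \<open>(id - \<tau>\<^sup>2 \<nabla>\<zeta> \<zeta> + o(\<tau>\<^sup>2))\<^sub>#\<mu>\<close>, yields the lower
  bound on the Hessian (\<open>convex_imp_pre_hess_ge\<close>).

  The Hessian bound implies convexity.  For finitely supported measures, optimally transported atoms do
  not collide at interior times, and near each such time they follow one test gradient that is constant
  near every atom.  Along the geodesic, \<open>F\<close> therefore is twice differentiable with second derivative
  \<open>Hess F(\<zeta>, \<zeta>)\<close> (\<open>convex_along_finite_geodesic\<close>).  General measures are reached by approximation and
  compactness of couplings (\<open>pre_hess_ge_imp_convex\<close>).
\<close>

section \<open>Square-integrable functions\<close>

text \<open>The counterparts of \<^const>\<open>L2\<close> and \<^const>\<open>L2_norm\<close> for functions whose domain and range differ, such as the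
  displacement \<open>x\<^sub>2 - x\<^sub>1\<close> under a coupling or a random variable on an auxiliary probability space.\<close>

definition sqint :: "'c measure \<Rightarrow> ('c \<Rightarrow> 'b::euclidean_space) set" where
  "sqint M = {f \<in> borel_measurable M. integrable M (\<lambda>x. (norm (f x))\<^sup>2)}"

definition rms :: "'c measure \<Rightarrow> ('c \<Rightarrow> 'b::euclidean_space) \<Rightarrow> real" where
  "rms M f = sqrt (LINT x|M. (norm (f x))\<^sup>2)"

lemma L2_eq_sqint: "L2 \<mu> = sqint \<mu>"
  by (simp add: L2_def sqint_def)

lemma L2_norm_eq_rms: "L2_norm \<mu> \<xi> = rms \<mu> \<xi>"
  by (simp add: L2_norm_def rms_def)

lemma sqintD [dest]:
  assumes "f \<in> sqint M"
  shows "f \<in> borel_measurable M" "integrable M (\<lambda>x. (norm (f x))\<^sup>2)"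
  using assms by (auto simp: sqint_def)

lemma rms_nonneg [simp]: "0 \<le> rms M f"
  by (simp add: rms_def)

lemma rms_power2: "(rms M f)\<^sup>2 = (LINT x|M. (norm (f x))\<^sup>2)"
  by (simp add: rms_def)

lemma sqint_bound:
  fixes f :: "'c \<Rightarrow> 'b::euclidean_space" and g :: "'c \<Rightarrow> real"
  assumes "f \<in> borel_measurable M" "integrable M g" "AE x in M. (norm (f x))\<^sup>2 \<le> g x"
  shows "f \<in> sqint M"
  using assms by (auto simp: sqint_def intro!: Bochner_Integration.integrable_bound[OF assms(2)])

lemma norm_add_power2_le: "(norm (a + b))\<^sup>2 \<le> 2 * (norm a)\<^sup>2 + 2 * (norm b)\<^sup>2"
  for a b :: "'b::real_inner"
proof -
  have "(norm (a + b))\<^sup>2 + (norm (a - b))\<^sup>2 = 2 * (norm a)\<^sup>2 + 2 * (norm b)\<^sup>2"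
    by (simp add: power2_norm_eq_inner inner_simps)
  then show ?thesis by (smt (verit) zero_le_power2)
qed

lemma sqint_add:
  assumes "f \<in> sqint M" "g \<in> sqint M"
  shows "(\<lambda>x. f x + g x) \<in> sqint M"
  using assms
  by (intro sqint_bound[where g="\<lambda>x. 2 * (norm (f x))\<^sup>2 + 2 * (norm (g x))\<^sup>2"])
     (auto simp: sqint_def norm_add_power2_le)

lemma sqint_scale:
  assumes "f \<in> sqint M"
  shows "(\<lambda>x. c *\<^sub>R f x) \<in> sqint M"
  using assms by (auto simp: sqint_def power_mult_distrib)

lemma sqint_diff:
  assumes "f \<in> sqint M" "g \<in> sqint M"
  shows "(\<lambda>x. f x - g x) \<in> sqint M"
  using sqint_add[OF assms(1) sqint_scale[OF assms(2), of "-1"]] by simp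

lemma (in finite_measure) sqint_bounded:
  assumes "f \<in> borel_measurable M" "\<And>x. norm (f x) \<le> B"
  shows "f \<in> sqint M"
proof (rule sqint_bound[OF assms(1), where g="\<lambda>_. B\<^sup>2"])
  show "AE x in M. (norm (f x))\<^sup>2 \<le> B\<^sup>2" using assms(2) by (simp add: power_mono)
qed auto

lemma sqint_inner:
  assumes "f \<in> sqint M" "g \<in> sqint M"
  shows "integrable M (\<lambda>x. f x \<bullet> g x)"
proof (rule Bochner_Integration.integrable_bound)
  show "integrable M (\<lambda>x. (norm (f x))\<^sup>2 + (norm (g x))\<^sup>2)" using assms by (auto simp: sqint_def)
  have "\<bar>a \<bullet> b\<bar> \<le> (norm a)\<^sup>2 + (norm b)\<^sup>2" for a b :: 'b
  proof -
    have "\<bar>a \<bullet> b\<bar> \<le> norm a * norm b" by (rule Cauchy_Schwarz_ineq2)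
    moreover have "2 * (norm a * norm b) \<le> (norm a)\<^sup>2 + (norm b)\<^sup>2"
      using sum_squares_bound[of "norm a" "norm b"] by simp
    moreover have "0 \<le> norm a * norm b" by simp
    ultimately show ?thesis by linarith
  qed
  then show "AE x in M. norm (f x \<bullet> g x) \<le> norm ((norm (f x))\<^sup>2 + (norm (g x))\<^sup>2)"
    by (auto simp: )
qed (use assms in \<open>auto simp: sqint_def\<close>)

lemma rms_expand:
  assumes f: "f \<in> sqint M" and g: "g \<in> sqint M"
  shows "(rms M (\<lambda>x. f x + c *\<^sub>R g x))\<^sup>2
    = (rms M f)\<^sup>2 + 2 * c * (LINT x|M. f x \<bullet> g x) + c\<^sup>2 * (rms M g)\<^sup>2"
proof -
  have "(norm (f x + c *\<^sub>R g x))\<^sup>2 = (norm (f x))\<^sup>2 + (2 * c * (f x \<bullet> g x) + c\<^sup>2 * (norm (g x))\<^sup>2)" for x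
    unfolding power2_norm_eq_inner by (simp add: inner_simps inner_commute power2_eq_square)
  then show ?thesis
    using sqint_inner[OF f g] sqintD(2)[OF f] sqintD(2)[OF g] by (simp add: rms_power2)
qed

lemma Cauchy_Schwarz_rms:
  assumes f: "f \<in> sqint M" and g: "g \<in> sqint M"
  shows "\<bar>LINT x|M. f x \<bullet> g x\<bar> \<le> rms M f * rms M g"
proof -
  define b where "b = (LINT x|M. f x \<bullet> g x)"
  have q: "0 \<le> (rms M f)\<^sup>2 + 2 * t * b + t\<^sup>2 * (rms M g)\<^sup>2" for t
    using rms_expand[OF f g, of t] unfolding b_def by (metis zero_le_power2)
  have "b\<^sup>2 \<le> (rms M f)\<^sup>2 * (rms M g)\<^sup>2"
  proof (cases "rms M g = 0")
    case True
    have "b = 0"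
    proof (rule ccontr)
      assume "b \<noteq> 0"
      then show False
        using q[of "- ((rms M f)\<^sup>2 + 1) / (2 * b)"] True by (simp add: field_simps)
    qed
    then show ?thesis by simp
  next
    case False
    then have p: "(rms M g)\<^sup>2 > 0" by simp
    have "2 * (- b / c) * b + (- b / c)\<^sup>2 * c = - (b\<^sup>2 / c)" if "c > 0" for c
      using that by (simp add: power2_eq_square field_simps)
    from this[OF p] have "0 \<le> (rms M f)\<^sup>2 - b\<^sup>2 / (rms M g)\<^sup>2"
      using q[of "- b / (rms M g)\<^sup>2"] by linarith
    then show ?thesis using p by (simp add: field_simps)
  qed
  then have "\<bar>b\<bar>\<^sup>2 \<le> (rms M f * rms M g)\<^sup>2" by (simp add: power_mult_distrib)
  then show ?thesis unfolding b_def by (rule power2_le_imp_le) simp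
qed

lemma rms_add_le:
  assumes f: "f \<in> sqint M" and g: "g \<in> sqint M"
  shows "rms M (\<lambda>x. f x + g x) \<le> rms M f + rms M g"
proof (rule power2_le_imp_le)
  have "(LINT x|M. f x \<bullet> g x) \<le> rms M f * rms M g"
    using Cauchy_Schwarz_rms[OF f g] by linarith
  then show "(rms M (\<lambda>x. f x + g x))\<^sup>2 \<le> (rms M f + rms M g)\<^sup>2"
    using rms_expand[OF f g, of 1] by (simp add: power2_sum)
qed simp

lemma rms_scale: "rms M (\<lambda>x. c *\<^sub>R f x) = \<bar>c\<bar> * rms M f"
  by (simp add: rms_def power_mult_distrib real_sqrt_mult)

lemma rms_minus_commute: "rms M (\<lambda>x. f x - g x) = rms M (\<lambda>x. g x - f x)"
  by (simp add: rms_def norm_minus_commute)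

lemma rms_triangle:
  assumes "f \<in> sqint M" "g \<in> sqint M" "h \<in> sqint M"
  shows "rms M (\<lambda>x. f x - h x) \<le> rms M (\<lambda>x. f x - g x) + rms M (\<lambda>x. g x - h x)"
  using rms_add_le[OF sqint_diff[OF assms(1,2)] sqint_diff[OF assms(2,3)]] by simp

lemma rms_diff_ge:
  assumes "f \<in> sqint M" "g \<in> sqint M"
  shows "\<bar>rms M f - rms M g\<bar> \<le> rms M (\<lambda>x. f x - g x)"
  using rms_add_le[OF sqint_diff[OF assms] assms(2)]
    rms_add_le[OF sqint_diff[OF assms(2,1)] assms(1)] rms_minus_commute[of M f g]
  by simp

lemma (in prob_space) integral_norm_le_rms:
  assumes f: "f \<in> sqint M"
  shows "integrable M (\<lambda>x. norm (f x))" "(LINT x|M. norm (f x)) \<le> rms M f"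
proof -
  have n: "(\<lambda>x. norm (f x)) \<in> sqint M" and o: "(\<lambda>_. 1::real) \<in> sqint M"
    using f by (auto simp: sqint_def)
  show "integrable M (\<lambda>x. norm (f x))" using sqint_inner[OF n o] by simp
  have "rms M (\<lambda>x. norm (f x)) = rms M f" "rms M (\<lambda>_. 1::real) = 1"
    by (auto simp: rms_def prob_space)
  then show "(LINT x|M. norm (f x)) \<le> rms M f"
    using Cauchy_Schwarz_rms[OF n o] by simp
qed

lemma Fatou_integral_le:
  fixes f :: "nat \<Rightarrow> 'c \<Rightarrow> real"
  assumes int: "\<And>k. integrable M (f k)" and nn: "\<And>k x. 0 \<le> f k x"
    and g: "g \<in> borel_measurable M"
    and lim: "AE x in M. (\<lambda>k. f k x) \<longlonglongrightarrow> g x"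
    and C: "\<forall>\<^sub>F k in sequentially. (LINT x|M. f k x) \<le> C" "0 \<le> C"
  shows "integrable M g" "(LINT x|M. g x) \<le> C"
proof -
  have gn: "AE x in M. 0 \<le> g x"
    using lim by eventually_elim (rule LIMSEQ_le_const[where a=0], auto simp: nn)
  have "(\<integral>\<^sup>+x. ennreal (g x) \<partial>M) = (\<integral>\<^sup>+x. liminf (\<lambda>k. ennreal (f k x)) \<partial>M)"
    using lim by (intro nn_integral_cong_AE, eventually_elim)
      (metis lim_imp_Liminf sequentially_bot tendsto_ennrealI)
  also have "\<dots> \<le> liminf (\<lambda>k. \<integral>\<^sup>+x. ennreal (f k x) \<partial>M)"
    using int by (intro nn_integral_liminf) auto
  also have "\<dots> \<le> ennreal C"
  proof -
    have "\<forall>\<^sub>F k in sequentially. (\<integral>\<^sup>+x. ennreal (f k x) \<partial>M) \<le> ennreal C"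
      using C(1) by eventually_elim (simp add: nn_integral_eq_integral int nn ennreal_leI)
    then have "liminf (\<lambda>k. \<integral>\<^sup>+x. ennreal (f k x) \<partial>M) \<le> liminf (\<lambda>k. ennreal C)"
      by (rule Liminf_mono)
    then show ?thesis by (simp add: Liminf_const)
  qed
  finally have le: "(\<integral>\<^sup>+x. ennreal (g x) \<partial>M) \<le> ennreal C" .
  show "integrable M g"
    using g gn le by (intro integrableI_nonneg) (auto simp: le_less_trans)
  then have "ennreal (LINT x|M. g x) \<le> ennreal C"
    using le gn by (simp add: nn_integral_eq_integral)
  then show "(LINT x|M. g x) \<le> C" using C(2) by simp
qed

text \<open>Completeness of \<open>L\<^sup>2\<close> in the form of the projection theorem: by the parallelogram law a
  minimising sequence is Cauchy; chosen fast enough it converges almost everywhere.\<close>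

lemma (in prob_space) min_rms_exists:
  fixes S :: "('a \<Rightarrow> 'b::euclidean_space) set"
  assumes ne: "S \<noteq> {}" and sub: "S \<subseteq> sqint M"
    and mid: "\<And>f g. f \<in> S \<Longrightarrow> g \<in> S \<Longrightarrow> (\<lambda>x. (1/2) *\<^sub>R (f x + g x)) \<in> S"
    and closed: "\<And>f. f \<in> sqint M \<Longrightarrow> (\<And>e. e > 0 \<Longrightarrow> \<exists>g\<in>S. rms M (\<lambda>x. f x - g x) < e) \<Longrightarrow> f \<in> S"
  shows "\<exists>f\<in>S. \<forall>g\<in>S. rms M f \<le> rms M g"
proof -
  define m where "m = (INF f\<in>S. (rms M f)\<^sup>2)"
  have bdd: "bdd_below ((\<lambda>f. (rms M f)\<^sup>2) ` S)" by (rule bdd_belowI[of _ 0]) auto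
  have m_le: "m \<le> (rms M f)\<^sup>2" if "f \<in> S" for f
    unfolding m_def using bdd that by (rule cINF_lower)
  have "\<exists>f\<in>S. (rms M f)\<^sup>2 < m + (1/4)^n" for n :: nat
  proof -
    have "m < m + (1/4)^n" by simp
    then show ?thesis
      unfolding m_def using ne bdd cINF_less_iff[of S "\<lambda>f. (rms M f)\<^sup>2"] by blast
  qed
  then obtain f where fS: "\<And>n. f n \<in> S" and fm: "\<And>n. (rms M (f n))\<^sup>2 < m + (1/4)^n" by metis
  have fs: "f n \<in> sqint M" for n using fS sub by blast
  have cau: "(rms M (\<lambda>x. f n x - f k x))\<^sup>2 \<le> 2 * ((1/4)^n + (1/4)^k)" for n k
  proof -
    have "m \<le> (rms M (\<lambda>x. (1/2) *\<^sub>R (f n x + f k x)))\<^sup>2" using fS mid m_le by blast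
    then have 1: "4 * m \<le> (rms M (\<lambda>x. f n x + f k x))\<^sup>2"
      unfolding rms_scale by (simp add: power_mult_distrib power2_eq_square)
    have "(rms M (\<lambda>x. f n x + f k x))\<^sup>2 + (rms M (\<lambda>x. f n x - f k x))\<^sup>2
        = 2 * (rms M (f n))\<^sup>2 + 2 * (rms M (f k))\<^sup>2"
      using rms_expand[OF fs fs, of n 1 k] rms_expand[OF fs fs, of n "-1" k] by simp
    then show ?thesis using 1 fm[of n] fm[of k] by simp
  qed
  define d where "d n x = norm (f (Suc n) x - f n x)" for n x
  have dm[measurable]: "d n \<in> borel_measurable M" for n
    unfolding d_def using fs sqintD(1) by measurable
  have dint: "integrable M (d n)" "(LINT x|M. d n x) \<le> 2 * (1/2)^n" for n
  proof -
    have s: "(\<lambda>x. f (Suc n) x - f n x) \<in> sqint M" using fs sqint_diff by blast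
    show "integrable M (d n)"
      using integral_norm_le_rms(1)[OF s] by (simp add: d_def[abs_def])
    have "(rms M (\<lambda>x. f (Suc n) x - f n x))\<^sup>2 \<le> 2 * ((1/4)^Suc n + (1/4)^n)" by (rule cau)
    also have "\<dots> \<le> (2 * (1/2)^n)\<^sup>2"
      by (simp add: power_mult_distrib power2_eq_square flip: power_mult_distrib)
    finally have "rms M (\<lambda>x. f (Suc n) x - f n x) \<le> 2 * (1/2)^n"
      by (rule power2_le_imp_le) simp
    then show "(LINT x|M. d n x) \<le> 2 * (1/2)^n"
      unfolding d_def using integral_norm_le_rms(2)[OF s] by linarith
  qed
  have "AE x in M. (\<Sum>n. ennreal (d n x)) \<noteq> \<infinity>"
  proof (rule nn_integral_noteq_infinite)
    have "(\<integral>\<^sup>+x. (\<Sum>n. ennreal (d n x)) \<partial>M) = (\<Sum>n. \<integral>\<^sup>+x. ennreal (d n x) \<partial>M)"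
      by (rule nn_integral_suminf) simp
    also have "\<dots> \<le> (\<Sum>n. ennreal (2 * (1/2)^n))"
    proof (intro suminf_le)
      fix n
      have "(\<integral>\<^sup>+x. ennreal (d n x) \<partial>M) = ennreal (LINT x|M. d n x)"
        using dint(1)[of n] by (intro nn_integral_eq_integral) (simp, simp add: d_def)
      also have "\<dots> \<le> ennreal (2 * (1/2)^n)" using dint(2) by (rule ennreal_leI)
      finally show "(\<integral>\<^sup>+x. ennreal (d n x) \<partial>M) \<le> ennreal (2 * (1/2)^n)" .
    qed auto
    also have "\<dots> < \<infinity>"
    proof -
      have "summable (\<lambda>n. 2 * (1/2::real)^n)" by (intro summable_mult summable_geometric) simp
      then have "(\<Sum>n. ennreal (2 * (1/2)^n)) = ennreal (\<Sum>n. 2 * (1/2)^n)"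
        by (intro suminf_ennreal2) auto
      then show ?thesis by simp
    qed
    finally show "(\<integral>\<^sup>+x. (\<Sum>n. ennreal (d n x)) \<partial>M) \<noteq> \<infinity>" by simp
  qed simp
  then have conv: "AE x in M. convergent (\<lambda>n. f n x)"
  proof eventually_elim
    fix x assume "(\<Sum>n. ennreal (d n x)) \<noteq> \<infinity>"
    then have "summable (\<lambda>n. norm (f (Suc n) x - f n x))"
      using summable_suminf_not_top[of "\<lambda>n. d n x"] by (simp add: d_def)
    then have "summable (\<lambda>n. f (Suc n) x - f n x)" by (rule summable_norm_cancel)
    then have "convergent (\<lambda>n. \<Sum>k<n. f (Suc k) x - f k x)"
      by (simp add: summable_iff_convergent)
    then have "convergent (\<lambda>n. f n x - f 0 x)" unfolding sum_lessThan_telescope[of "\<lambda>k. f k x"] .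
    then have "convergent (\<lambda>n. (f n x - f 0 x) + f 0 x)" by (intro convergent_add convergent_const)
    then show "convergent (\<lambda>n. f n x)" by simp
  qed
  define g where "g x = lim (\<lambda>n. f n x)" for x
  have [measurable]: "f n \<in> borel_measurable M" for n using fs by blast
  have gm[measurable]: "g \<in> borel_measurable M"
    unfolding g_def by measurable
  have lim: "AE x in M. (\<lambda>n. f n x) \<longlonglongrightarrow> g x"
    using conv by eventually_elim (simp add: g_def convergent_LIMSEQ_iff)
  have gd: "(\<lambda>x. g x - f n x) \<in> sqint M \<and> (rms M (\<lambda>x. g x - f n x))\<^sup>2 \<le> 4 * (1/4)^n" for n
  proof -
    have i: "integrable M (\<lambda>x. (norm (f k x - f n x))\<^sup>2)" for k
      using sqint_diff[OF fs fs] by (rule sqintD)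
    have l: "AE x in M. (\<lambda>k. (norm (f k x - f n x))\<^sup>2) \<longlonglongrightarrow> (norm (g x - f n x))\<^sup>2"
      using lim by eventually_elim (intro tendsto_intros)
    have e: "\<forall>\<^sub>F k in sequentially. (LINT x|M. (norm (f k x - f n x))\<^sup>2) \<le> 4 * (1/4)^n"
    proof (rule eventually_sequentiallyI)
      fix k assume "n \<le> k"
      then have le: "(1/4::real)^k \<le> (1/4)^n" by (intro power_decreasing) auto
      have *: "x \<le> 4 * b" if "x \<le> 2 * (a + b)" "a \<le> b" for x a b :: real using that by simp
      show "(LINT x|M. (norm (f k x - f n x))\<^sup>2) \<le> 4 * (1/4)^n"
        using cau[of k n] unfolding rms_power2 by (rule *) (rule le)
    qed
    show ?thesis
      using Fatou_integral_le[OF i _ _ l e] by (auto simp: sqint_def rms_power2)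
  qed
  have gs: "g \<in> sqint M" using sqint_add[OF conjunct1[OF gd[of 0]] fs[of 0]] by simp
  have small: "rms M (\<lambda>x. g x - f n x) \<le> 2 * (1/2)^n" for n
  proof (rule power2_le_imp_le)
    show "(rms M (\<lambda>x. g x - f n x))\<^sup>2 \<le> (2 * (1/2)^n)\<^sup>2"
      using gd[of n] by (simp add: power_mult_distrib power2_eq_square flip: power_mult_distrib)
  qed simp
  have to0: "(\<lambda>n. 2 * (1/2::real)^n) \<longlonglongrightarrow> 0"
    by (intro tendsto_mult_right_zero LIMSEQ_power_zero) simp
  have "g \<in> S"
  proof (rule closed[OF gs])
    fix e :: real assume "e > 0"
    then obtain n where "2 * (1/2::real)^n < e"
      using order_tendstoD(2)[OF to0] by (metis eventually_sequentially order_refl)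
    then show "\<exists>h\<in>S. rms M (\<lambda>x. g x - h x) < e"
      using small[of n] fS by (meson le_less_trans)
  qed
  moreover have "rms M g \<le> rms M h" if "h \<in> S" for h
  proof -
    have "(\<lambda>n. rms M g - 2 * (1/2::real)^n) \<longlonglongrightarrow> rms M g - 0"
      by (intro tendsto_diff tendsto_const to0)
    moreover have "(\<lambda>n. sqrt (m + (1/4)^n)) \<longlonglongrightarrow> sqrt (m + 0)"
      by (intro tendsto_intros LIMSEQ_power_zero) simp
    moreover have "rms M g - 2 * (1/2)^n \<le> sqrt (m + (1/4)^n)" for n
      using rms_diff_ge[OF gs fs[of n]] small[of n] real_le_rsqrt[OF less_imp_le[OF fm[of n]]]
      by linarith
    ultimately have "rms M g - 0 \<le> sqrt (m + 0)" by (intro LIMSEQ_le) auto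
    also have "\<dots> \<le> rms M h" using m_le[OF that] by (intro real_le_lsqrt) auto
    finally show ?thesis by simp
  qed
  ultimately show ?thesis by blast
qed

section \<open>Compactness of couplings\<close>

text \<open>Skorokhod's representation theorem and Helly's selection theorem are about measures on the
  real line.  They are transported to a Euclidean space by an injection into the line whose inverse
  is uniformly continuous: it interleaves the binary digits of the coordinates, but writes the
  result in base 8, so that close codes have equal leading digits (there are no carries).\<close>

definition digit_pair :: "real \<Rightarrow> real \<Rightarrow> nat \<Rightarrow> int" where
  "digit_pair s t k = (if k = 0 then int (prod_encode (int_encode \<lfloor>s\<rfloor>, int_encode \<lfloor>t\<rfloor>))
     else \<lfloor>2^k * s\<rfloor> mod 2 + 2 * (\<lfloor>2^k * t\<rfloor> mod 2))"

definition interleave :: "real \<Rightarrow> real \<Rightarrow> real" where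
  "interleave s t = (\<Sum>k. real_of_int (digit_pair s t k) * (1/8)^k)"

lemma digit_pair_bounds: "k > 0 \<Longrightarrow> 0 \<le> digit_pair s t k \<and> digit_pair s t k \<le> 3"
  by (auto simp: digit_pair_def)

lemma summable_octal:
  fixes e :: "nat \<Rightarrow> int"
  assumes "\<And>k. k > 0 \<Longrightarrow> \<bar>e k\<bar> \<le> 3"
  shows "summable (\<lambda>k. real_of_int (e (k + m)) * (1/8)^(k + m))"
proof -
  have "summable (\<lambda>k. real_of_int (e k) * (1/8)^k)"
  proof (rule summable_comparison_test)
    show "\<exists>N. \<forall>n\<ge>N. norm (real_of_int (e n) * (1/8)^n) \<le> 3 * (1/8)^n"
      using assms by (intro exI[of _ 1]) (auto simp: abs_mult of_int_abs[symmetric] simp del: of_int_abs)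
    show "summable (\<lambda>n. 3 * (1/8::real)^n)" by (intro summable_mult summable_geometric) simp
  qed
  then show ?thesis by (rule summable_ignore_initial_segment)
qed

lemma octal_tail_bound:
  fixes e :: "nat \<Rightarrow> int"
  assumes "\<And>k. k > 0 \<Longrightarrow> \<bar>e k\<bar> \<le> 3"
  shows "\<bar>\<Sum>k. real_of_int (e (k + Suc m)) * (1/8)^(k + Suc m)\<bar> \<le> 3/7 * (1/8)^m"
proof -
  have g: "summable (\<lambda>k. 3 * (1/8::real)^Suc m * (1/8)^k)"
    by (intro summable_mult summable_geometric) simp
  have "\<bar>real_of_int (e (k + Suc m)) * (1/8)^(k + Suc m)\<bar> \<le> 3 * (1/8)^Suc m * (1/8)^k" for k
  proof -
    have "\<bar>real_of_int (e (k + Suc m))\<bar> \<le> 3"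
      using assms[of "k + Suc m"] by (metis add_gr_0 of_int_abs of_int_le_numeral_iff zero_less_Suc)
    then show ?thesis by (simp add: abs_mult power_add)
  qed
  then have "norm (\<Sum>k. real_of_int (e (k + Suc m)) * (1/8)^(k + Suc m))
      \<le> (\<Sum>k. 3 * (1/8::real)^Suc m * (1/8)^k)"
    by (intro norm_suminf_le[OF _ g]) auto
  also have "\<dots> = 3 * (1/8::real)^Suc m * (1 / (1 - 1/8))"
    by (subst suminf_mult) (auto simp: suminf_geometric intro: summable_geometric)
  also have "\<dots> = 3/7 * (1/8)^m" by simp
  finally show ?thesis by simp
qed

text \<open>If \<open>m\<close> is the position of the first nonzero digit, that digit contributes at least \<open>8\<^sup>-\<^sup>m\<close> in absolute
  value, and the later ones can cancel at most \<open>3/7\<close> of it.\<close>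

lemma octal_small_imp_zero:
  fixes e :: "nat \<Rightarrow> int"
  assumes e: "\<And>k. k > 0 \<Longrightarrow> \<bar>e k\<bar> \<le> 3"
    and small: "\<bar>\<Sum>k. real_of_int (e k) * (1/8)^k\<bar> < 4/7 * (1/8)^K"
    and "k \<le> K"
  shows "e k = 0"
  using \<open>k \<le> K\<close>
proof (induction k rule: less_induct)
  case (less m)
  show ?case
  proof (rule ccontr)
    assume ne: "e m \<noteq> 0"
    have s: "summable (\<lambda>k. real_of_int (e k) * (1/8)^k)" using summable_octal[of e 0, OF e] by simp
    have z: "(\<Sum>k<m. real_of_int (e k) * (1/8)^k) = 0"
      using less by (intro sum.neutral) auto
    have "(\<Sum>k. real_of_int (e k) * (1/8)^k)
        = (\<Sum>k. real_of_int (e (k + Suc m)) * (1/8)^(k + Suc m)) + real_of_int (e m) * (1/8)^m"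
      using suminf_split_initial_segment[OF s, of "Suc m"] z by simp
    moreover have "\<bar>\<Sum>k. real_of_int (e (k + Suc m)) * (1/8)^(k + Suc m)\<bar> \<le> 3/7 * (1/8)^m"
      by (rule octal_tail_bound[OF e])
    moreover have "\<bar>real_of_int (e m) * (1/8)^m\<bar> \<ge> (1/8)^m"
      using ne by (simp add: abs_mult)
    moreover have "(1/8::real)^K \<le> (1/8)^m" using less.prems by (intro power_decreasing) auto
    ultimately show False using small by argo
  qed
qed

lemma floor_double: "\<lfloor>2 * x\<rfloor> = 2 * \<lfloor>x\<rfloor> + \<lfloor>2 * x\<rfloor> mod 2" for x :: real
proof -
  have "\<lfloor>2 * x\<rfloor> div 2 = \<lfloor>x\<rfloor>"
    using floor_divide_real_eq_div[of 2 "2 * x"] by simp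
  then show ?thesis by (metis div_mult_mod_eq mult.commute)
qed

lemma interleave_close:
  assumes "\<bar>interleave s t - interleave s' t'\<bar> < 4/7 * (1/8)^K"
  shows "\<bar>s - s'\<bar> < (1/2)^K" "\<bar>t - t'\<bar> < (1/2)^K"
proof -
  define e where "e k = digit_pair s t k - digit_pair s' t' k" for k
  have e3: "\<bar>e k\<bar> \<le> 3" if "k > 0" for k
    using digit_pair_bounds[OF that, of s t] digit_pair_bounds[OF that, of s' t'] by (auto simp: e_def)
  have sm: "summable (\<lambda>k. real_of_int (digit_pair s t k) * (1/8)^k)" for s t
    using summable_octal[of "digit_pair s t" 0] digit_pair_bounds[of _ s t] by fastforce
  have "interleave s t - interleave s' t' = (\<Sum>k. real_of_int (e k) * (1/8)^k)"
    unfolding interleave_def using suminf_diff[OF sm sm, of s t s' t']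
    by (simp add: e_def algebra_simps)
  then have e0: "e k = 0" if "k \<le> K" for k
    using octal_small_imp_zero[of e K k, OF e3 _ that] assms by simp
  have "e 0 = 0" using e0 by blast
  then have f0: "\<lfloor>s\<rfloor> = \<lfloor>s'\<rfloor>" "\<lfloor>t\<rfloor> = \<lfloor>t'\<rfloor>"
    by (auto simp: e_def digit_pair_def inj_eq[OF inj_int_encode] int_encode_eq)
  have d: "\<lfloor>2^k * s\<rfloor> mod 2 = \<lfloor>2^k * s'\<rfloor> mod 2 \<and> \<lfloor>2^k * t\<rfloor> mod 2 = \<lfloor>2^k * t'\<rfloor> mod 2"
    if "0 < k" "k \<le> K" for k
    using e0[OF that(2)] that(1) unfolding e_def digit_pair_def by simp presburger
  have "\<lfloor>2^k * s\<rfloor> = \<lfloor>2^k * s'\<rfloor> \<and> \<lfloor>2^k * t\<rfloor> = \<lfloor>2^k * t'\<rfloor>" if "k \<le> K" for k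
    using that
  proof (induction k)
    case (Suc k)
    have "\<lfloor>2^Suc k * x\<rfloor> = 2 * \<lfloor>2^k * x\<rfloor> + \<lfloor>2^Suc k * x\<rfloor> mod 2" for x :: real
      using floor_double[of "2^k * x"] by (simp add: mult.assoc)
    then show ?case using Suc d[of "Suc k"] by (metis Suc_leD zero_less_Suc)
  qed (use f0 in auto)
  then have *: "\<lfloor>2^K * s\<rfloor> = \<lfloor>2^K * s'\<rfloor>" "\<lfloor>2^K * t\<rfloor> = \<lfloor>2^K * t'\<rfloor>" by auto
  have "\<bar>x - y\<bar> < (1/2)^K" if "\<lfloor>2^K * x\<rfloor> = \<lfloor>2^K * y\<rfloor>" for x y :: real
  proof -
    have "\<bar>2^K * x - 2^K * y\<bar> < 1" using that by linarith
    then have "2^K * \<bar>x - y\<bar> < 1" by (simp add: abs_mult flip: right_diff_distrib)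
    then show ?thesis by (simp add: field_simps power_one_over)
  qed
  with * show "\<bar>s - s'\<bar> < (1/2)^K" "\<bar>t - t'\<bar> < (1/2)^K" by auto
qed

lemma interleave_measurable:
  assumes [measurable]: "f \<in> borel_measurable M" "g \<in> borel_measurable M"
  shows "(\<lambda>x. interleave (f x) (g x)) \<in> borel_measurable M"
  unfolding interleave_def digit_pair_def by measurable

lemma interleave_bounded: "\<exists>B. \<forall>s t. \<bar>s\<bar> \<le> R \<longrightarrow> \<bar>t\<bar> \<le> R \<longrightarrow> \<bar>interleave s t\<bar> \<le> B"
proof -
  define I where "I = {-\<lceil>R\<rceil> - 1..\<lceil>R\<rceil> + 1}"
  define N where "N = (\<lambda>(a, b). real (prod_encode (int_encode a, int_encode b)))"
  have "finite (N ` (I \<times> I))" by (auto simp: I_def)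
  then obtain B where B: "\<And>x. x \<in> N ` (I \<times> I) \<Longrightarrow> x \<le> B"
    by (meson bdd_above_finite bdd_above.E)
  have "\<bar>interleave s t\<bar> \<le> B + 1" if "\<bar>s\<bar> \<le> R" "\<bar>t\<bar> \<le> R" for s t
  proof -
    have "\<lfloor>s\<rfloor> \<in> I" "\<lfloor>t\<rfloor> \<in> I" using that by (auto simp: I_def) linarith+
    then have n: "N (\<lfloor>s\<rfloor>, \<lfloor>t\<rfloor>) \<le> B" "0 \<le> N (\<lfloor>s\<rfloor>, \<lfloor>t\<rfloor>)" using B by (auto simp: N_def)
    have d3: "\<bar>digit_pair s t k\<bar> \<le> 3" if "k > 0" for k
      using digit_pair_bounds[OF that, of s t] by auto
    have sm: "summable (\<lambda>k. real_of_int (digit_pair s t k) * (1/8)^k)"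
      using summable_octal[of "digit_pair s t" 0] d3 by simp
    have "interleave s t = (\<Sum>k. real_of_int (digit_pair s t (k + Suc 0)) * (1/8)^(k + Suc 0))
        + N (\<lfloor>s\<rfloor>, \<lfloor>t\<rfloor>)"
      unfolding interleave_def
      by (subst suminf_split_initial_segment[OF sm, of "Suc 0"]) (simp add: digit_pair_def N_def)
    moreover have "\<bar>\<Sum>k. real_of_int (digit_pair s t (k + Suc 0)) * (1/8)^(k + Suc 0)\<bar> \<le> 3/7 * (1/8)^0"
      by (rule octal_tail_bound[OF d3])
    ultimately show ?thesis using n by simp
  qed
  then show ?thesis by blast
qed

text \<open>The coordinates are encoded one after the other: the code of the previous coordinates is a real
  number, which is interleaved with the next coordinate.\<close>

lemma coordinates_encoding:
  fixes B :: "'a::euclidean_space set"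
  assumes "finite B"
  shows "\<exists>\<psi> :: 'a \<Rightarrow> real. \<psi> \<in> borel_measurable borel \<and>
    (\<forall>e>0. \<exists>d>0. \<forall>x y. \<bar>\<psi> x - \<psi> y\<bar> < d \<longrightarrow> (\<forall>b\<in>B. \<bar>x \<bullet> b - y \<bullet> b\<bar> < e)) \<and>
    (\<forall>R. \<exists>C. \<forall>x. norm x \<le> R \<longrightarrow> \<bar>\<psi> x\<bar> \<le> C)"
  using assms
proof (induction B)
  case empty
  show ?case by (intro exI[of _ "\<lambda>_. 0"]) (auto intro: exI[of _ 1])
next
  case (insert b B)
  then obtain \<psi> :: "'a \<Rightarrow> real" where m[measurable]: "\<psi> \<in> borel_measurable borel"
    and u: "\<And>e. e > 0 \<Longrightarrow> \<exists>d>0. \<forall>x y. \<bar>\<psi> x - \<psi> y\<bar> < d \<longrightarrow> (\<forall>b\<in>B. \<bar>x \<bullet> b - y \<bullet> b\<bar> < e)"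
    and bd: "\<And>R. \<exists>C. \<forall>x. norm x \<le> R \<longrightarrow> \<bar>\<psi> x\<bar> \<le> C" by blast
  show ?case
  proof (intro exI[of _ "\<lambda>x. interleave (\<psi> x) (x \<bullet> b)"] conjI allI impI)
    show "(\<lambda>x. interleave (\<psi> x) (x \<bullet> b)) \<in> borel_measurable borel"
      by (intro interleave_measurable) auto
  next
    fix e :: real assume "e > 0"
    obtain d where d: "d > 0" "\<And>x y. \<bar>\<psi> x - \<psi> y\<bar> < d \<Longrightarrow> (\<forall>b\<in>B. \<bar>x \<bullet> b - y \<bullet> b\<bar> < e)"
      using u[OF \<open>e > 0\<close>] by blast
    obtain K where K: "(1/2::real)^K < min d e"
      using real_arch_pow_inv[of "min d e" "1/2"] d(1) \<open>e > 0\<close> by auto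
    show "\<exists>d>0. \<forall>x y. \<bar>interleave (\<psi> x) (x \<bullet> b) - interleave (\<psi> y) (y \<bullet> b)\<bar> < d \<longrightarrow>
        (\<forall>c\<in>insert b B. \<bar>x \<bullet> c - y \<bullet> c\<bar> < e)"
    proof (intro exI[of _ "4/7 * (1/8)^K"] conjI allI impI)
      fix x y assume "\<bar>interleave (\<psi> x) (x \<bullet> b) - interleave (\<psi> y) (y \<bullet> b)\<bar> < 4/7 * (1/8)^K"
      from interleave_close[OF this] K have "\<bar>\<psi> x - \<psi> y\<bar> < d" "\<bar>x \<bullet> b - y \<bullet> b\<bar> < e" by auto
      then show "\<forall>c\<in>insert b B. \<bar>x \<bullet> c - y \<bullet> c\<bar> < e" using d(2) by auto
    qed simp
  next
    fix R
    obtain C where C: "\<And>x. norm x \<le> R \<Longrightarrow> \<bar>\<psi> x\<bar> \<le> C" using bd by blast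
    obtain D where D: "\<And>s t. \<bar>s\<bar> \<le> max C (R * norm b) \<Longrightarrow> \<bar>t\<bar> \<le> max C (R * norm b)
        \<Longrightarrow> \<bar>interleave s t\<bar> \<le> D"
      using interleave_bounded by blast
    have "\<bar>interleave (\<psi> x) (x \<bullet> b)\<bar> \<le> D" if "norm x \<le> R" for x
    proof (rule D)
      show "\<bar>\<psi> x\<bar> \<le> max C (R * norm b)" using C[OF that] by simp
      have "\<bar>x \<bullet> b\<bar> \<le> norm x * norm b" by (rule Cauchy_Schwarz_ineq2)
      also have "\<dots> \<le> R * norm b" using that by (intro mult_right_mono) auto
      finally show "\<bar>x \<bullet> b\<bar> \<le> max C (R * norm b)" by simp
    qed
    then show "\<exists>C. \<forall>x. norm x \<le> R \<longrightarrow> \<bar>interleave (\<psi> x) (x \<bullet> b)\<bar> \<le> C" by blast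
  qed
qed

text \<open>Decoding is uniformly continuous on the set of codes, so it extends continuously to the closure
  \<open>S\<close> of this set; limits of codes, which need not be codes themselves, lie in \<open>S\<close>.\<close>

lemma real_encoding:
  obtains \<psi> :: "'a::euclidean_space \<Rightarrow> real" and g :: "real \<Rightarrow> 'a" and S where
    "\<psi> \<in> borel_measurable borel" "closed S" "continuous_on S g" "\<And>x. \<psi> x \<in> S" "\<And>x. g (\<psi> x) = x"
    "\<And>R. \<exists>C. \<forall>x. norm x \<le> R \<longrightarrow> \<bar>\<psi> x\<bar> \<le> C"
proof -
  obtain \<psi> :: "'a \<Rightarrow> real" where m: "\<psi> \<in> borel_measurable borel"
    and u: "\<And>e. e > 0 \<Longrightarrow> \<exists>d>0. \<forall>x y. \<bar>\<psi> x - \<psi> y\<bar> < d \<longrightarrow> (\<forall>b\<in>Basis. \<bar>x \<bullet> b - y \<bullet> b\<bar> < e)"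
    and bd: "\<And>R. \<exists>C. \<forall>x. norm x \<le> R \<longrightarrow> \<bar>\<psi> x\<bar> \<le> C"
    using coordinates_encoding[OF finite_Basis] by blast
  have u': "\<exists>d>0. \<forall>x y. \<bar>\<psi> x - \<psi> y\<bar> < d \<longrightarrow> norm (x - y) < e" if "e > 0" for e
  proof -
    have "e / DIM('a) > 0" using that by simp
    from u[OF this] obtain d where d: "d > 0"
      "\<And>x y b. \<bar>\<psi> x - \<psi> y\<bar> < d \<Longrightarrow> b \<in> Basis \<Longrightarrow> \<bar>x \<bullet> b - y \<bullet> b\<bar> < e / DIM('a)" by blast
    have "norm (x - y) < e" if "\<bar>\<psi> x - \<psi> y\<bar> < d" for x y
    proof -
      have "norm (x - y) \<le> (\<Sum>b\<in>Basis. \<bar>(x - y) \<bullet> b\<bar>)" by (rule norm_le_l1)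
      also have "\<dots> < (\<Sum>b\<in>(Basis::'a set). e / DIM('a))"
        using d(2)[OF that] by (intro sum_strict_mono) (auto simp: inner_simps)
      also have "\<dots> = e" by simp
      finally show ?thesis .
    qed
    with d(1) show ?thesis by blast
  qed
  have inj: "x = y" if "\<psi> x = \<psi> y" for x y
  proof (rule ccontr)
    assume "x \<noteq> y"
    then have "norm (x - y) > 0" by simp
    from u'[OF this] obtain d where "d > 0"
      "\<And>x' y'. \<bar>\<psi> x' - \<psi> y'\<bar> < d \<Longrightarrow> norm (x' - y') < norm (x - y)" by blast
    from this(2)[of x y] this(1) that show False by simp
  qed
  define h where "h = inv \<psi>"
  have h: "h (\<psi> x) = x" for x using inj by (simp add: h_def inv_f_f inj_def)
  have "uniformly_continuous_on (range \<psi>) h"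
    unfolding uniformly_continuous_on_def dist_norm
  proof (intro allI impI)
    fix e :: real assume "e > 0"
    from u'[OF this] show "\<exists>d>0. \<forall>x\<in>range \<psi>. \<forall>x'\<in>range \<psi>. norm (x' - x) < d \<longrightarrow> norm (h x' - h x) < e"
      by (auto simp: h)
  qed
  then obtain g where g: "uniformly_continuous_on (closure (range \<psi>)) g"
    "\<And>x. x \<in> range \<psi> \<Longrightarrow> h x = g x"
    by (rule uniformly_continuous_on_extension_on_closure) blast
  show ?thesis
  proof (rule that[of \<psi> "closure (range \<psi>)" g])
    show "continuous_on (closure (range \<psi>)) g" using g(1) by (rule uniformly_continuous_imp_continuous)
    show "\<psi> x \<in> closure (range \<psi>)" for x by (meson closure_subset range_eqI subsetD)
    show "g (\<psi> x) = x" for x using g(2)[of "\<psi> x"] h by simp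
  qed (use m bd in auto)
qed

lemma Markov_second_moment:
  fixes M :: "'a::euclidean_space measure"
  assumes "prob_space M" "sets M = sets borel" "integrable M (\<lambda>x. (norm x)\<^sup>2)"
    "(LINT x|M. (norm x)\<^sup>2) \<le> C" "R > 0"
  shows "measure M {x. norm x > R} \<le> C / R\<^sup>2"
proof -
  interpret prob_space M by fact
  have [measurable_cong]: "sets M = sets borel" and sp: "space M = UNIV"
    using assms sets_eq_imp_space_eq[OF assms(2)] by auto
  have "measure M {x. norm x > R} \<le> measure M {x\<in>space M. R\<^sup>2 \<le> (norm x)\<^sup>2}"
    using \<open>R > 0\<close> by (intro finite_measure_mono) (auto simp: sp power_mono)
  also have "\<dots> \<le> (LINT x|M. (norm x)\<^sup>2) / R\<^sup>2"
    using assms by (intro integral_Markov_inequality_measure[where A="{}"]) auto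
  also have "\<dots> \<le> C / R\<^sup>2" using assms by (intro divide_right_mono) auto
  finally show ?thesis .
qed

text \<open>Bounded second moments make the laws of the codes tight.  Helly's theorem yields a weakly convergent
  subsequence, Skorokhod's theorem represents it by random variables that converge pointwise, and
  these are decoded.\<close>

theorem Skorokhod_subsequence:
  fixes \<gamma> :: "nat \<Rightarrow> 'a::euclidean_space measure"
  assumes P: "\<And>n. \<gamma> n \<in> P2" and C: "\<And>n. (LINT x|\<gamma> n. (norm x)\<^sup>2) \<le> C"
  obtains r :: "nat \<Rightarrow> nat" and \<Omega> :: "real measure" and X Y where
    "strict_mono r" "prob_space \<Omega>" "\<And>n. X n \<in> borel_measurable \<Omega>" "Y \<in> borel_measurable \<Omega>"
    "\<And>n. distr \<Omega> borel (X n) = \<gamma> (r n)" "AE \<omega> in \<Omega>. (\<lambda>n. X n \<omega>) \<longlonglongrightarrow> Y \<omega>"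
proof -
  have pr: "prob_space (\<gamma> n)" and se[measurable_cong, simp]: "sets (\<gamma> n) = sets borel" 
    and sp[simp]: "space (\<gamma> n) = UNIV"
    and it: "integrable (\<gamma> n) (\<lambda>x. (norm x)\<^sup>2)" for n
    using P[of n] sets_eq_imp_space_eq[of "\<gamma> n" borel] by (auto simp: P2_def)
  obtain \<psi> :: "'a \<Rightarrow> real" and g S where m[measurable]: "\<psi> \<in> borel_measurable borel"
    and S: "closed S" "continuous_on S g" "\<And>x. \<psi> x \<in> S" and g: "\<And>x. g (\<psi> x) = x"
    and bd: "\<And>R. \<exists>C. \<forall>x. norm x \<le> R \<longrightarrow> \<bar>\<psi> x\<bar> \<le> C" by (rule real_encoding) blast
  define \<theta> where "\<theta> n = distr (\<gamma> n) borel \<psi>" for n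
  have rd: "real_distribution (\<theta> n)" for n
    unfolding real_distribution_def real_distribution_axioms_def \<theta>_def
    by (auto intro!: prob_space.prob_space_distr pr)
  have "tight \<theta>"
    unfolding tight_def
  proof (intro conjI allI impI rd)
    fix e :: real assume e: "e > 0"
    define R where "R = sqrt (\<bar>C\<bar> / e) + 1"
    have R: "R > 0" "R\<^sup>2 > \<bar>C\<bar> / e"
    proof -
      have p: "sqrt (\<bar>C\<bar> / e) \<ge> 0" using e by simp
      then show "R > 0" unfolding R_def by linarith
      have "(sqrt (\<bar>C\<bar> / e))\<^sup>2 < R\<^sup>2" unfolding R_def using p by (intro power_strict_mono) auto
      then show "R\<^sup>2 > \<bar>C\<bar> / e" using e by simp
    qed
    obtain D where D: "\<And>x. norm x \<le> R \<Longrightarrow> \<bar>\<psi> x\<bar> \<le> D" using bd by blast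
    have D0: "D \<ge> 0" using D[of 0] R by auto
    show "\<exists>a b. a < b \<and> (\<forall>n. 1 - e < measure (\<theta> n) {a<..b})"
    proof (rule exI[of _ "-D-1"], rule exI[of _ D], intro conjI allI)
      fix n
      interpret g: prob_space "\<gamma> n" by (rule pr)
      have "measure (\<gamma> n) {x. norm x > R} \<le> C / R\<^sup>2"
        using Markov_second_moment[OF pr se it C R(1)] .
      also have "\<dots> < e"
      proof -
        have "\<bar>C\<bar> < e * R\<^sup>2" using R e by (simp add: field_simps)
        then show ?thesis using R(1) by (simp add: field_simps)
      qed
      finally have "measure (\<gamma> n) {x. norm x > R} < e" .
      moreover have "measure (\<gamma> n) {x. \<not> norm x > R} = 1 - measure (\<gamma> n) {x. norm x > R}"
        using g.prob_compl[of "{x. norm x > R}"] by (simp add: Compl_eq_Diff_UNIV[symmetric] Collect_neg_eq)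
      moreover have "measure (\<gamma> n) {x. \<not> norm x > R} \<le> measure (\<gamma> n) (\<psi> -` {-D-1<..D})"
      proof (intro g.finite_measure_mono subsetI)
        fix x :: 'a assume "x \<in> {x. \<not> norm x > R}"
        then have "\<bar>\<psi> x\<bar> \<le> D" using D by auto
        then show "x \<in> \<psi> -` {-D-1<..D}" by auto
      qed (use measurable_sets[OF m, of "{-D-1<..D}"] in auto)
      ultimately show "1 - e < measure (\<theta> n) {-D-1<..D}"
        by (simp add: \<theta>_def measure_distr)
    qed (use D0 in auto)
  qed
  from tight_imp_convergent_subsubsequence[OF this strict_mono_id] obtain r M where
    r: "strict_mono (r :: nat \<Rightarrow> nat)" and M: "real_distribution M" "weak_conv_m (\<lambda>n. \<theta> (r n)) M"
    by (auto simp: o_def)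
  from Skorohod[OF _ M(1) M(2)] rd obtain \<Omega> :: "real measure" and Z Z' where
    \<Omega>: "prob_space \<Omega>" and Z: "\<And>n. Z n \<in> measurable \<Omega> borel" "\<And>n. distr \<Omega> borel (Z n) = \<theta> (r n)"
    and Z': "Z' \<in> measurable \<Omega> lborel" and lim: "\<And>\<omega>. \<omega> \<in> space \<Omega> \<Longrightarrow> (\<lambda>n. Z n \<omega>) \<longlonglongrightarrow> Z' \<omega>"
    by metis
  note Z(1)[measurable]
  have [measurable]: "Z' \<in> borel_measurable \<Omega>" using Z' by simp
  have [measurable]: "S \<in> sets borel" using S(1) by auto
  define k where "k x = (if x \<in> S then g x else 0)" for x
  have [measurable]: "k \<in> borel_measurable borel"
    unfolding k_def using S by (intro borel_measurable_continuous_on_if) auto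
  have in_S: "AE \<omega> in \<Omega>. Z n \<omega> \<in> S" for n
  proof -
    have "AE x in \<theta> (r n). x \<in> S" unfolding \<theta>_def using S(3) by (subst AE_distr_iff) auto
    then show ?thesis unfolding Z(2)[symmetric] by (subst (asm) AE_distr_iff) auto
  qed
  show ?thesis
  proof (rule that[of r \<Omega> "\<lambda>n \<omega>. k (Z n \<omega>)" "\<lambda>\<omega>. k (Z' \<omega>)"])
    show "distr \<Omega> borel (\<lambda>\<omega>. k (Z n \<omega>)) = \<gamma> (r n)" for n
    proof -
      have "distr \<Omega> borel (\<lambda>\<omega>. k (Z n \<omega>)) = distr (distr \<Omega> borel (Z n)) borel k"
        by (subst distr_distr) (auto simp: o_def)
      also have "\<dots> = distr (\<gamma> (r n)) borel (\<lambda>x. k (\<psi> x))"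
        unfolding Z(2) \<theta>_def by (subst distr_distr) (auto simp: o_def)
      also have "\<dots> = distr (\<gamma> (r n)) borel (\<lambda>x. x)"
        using S(3) g by (simp add: k_def)
      also have "\<dots> = \<gamma> (r n)" by (intro distr_id2) simp
      finally show ?thesis .
    qed
    have "AE \<omega> in \<Omega>. \<forall>n. Z n \<omega> \<in> S" using in_S by (simp add: AE_all_countable)
    then show "AE \<omega> in \<Omega>. (\<lambda>n. k (Z n \<omega>)) \<longlonglongrightarrow> k (Z' \<omega>)"
      using AE_space
    proof eventually_elim
      fix \<omega> assume a: "\<forall>n. Z n \<omega> \<in> S" "\<omega> \<in> space \<Omega>"
      have "Z' \<omega> \<in> S" by (rule closed_sequentially[OF S(1) _ lim[OF a(2)]]) (use a in auto)
      then have "(\<lambda>n. g (Z n \<omega>)) \<longlonglongrightarrow> g (Z' \<omega>)"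
        using continuous_on_tendsto_compose[OF S(2) lim[OF a(2)]] a by auto
      then show "(\<lambda>n. k (Z n \<omega>)) \<longlonglongrightarrow> k (Z' \<omega>)" using a \<open>Z' \<omega> \<in> S\<close> by (simp add: k_def)
    qed
  qed (use r \<Omega> in auto)
qed

section \<open>Couplings and Wasserstein convergence\<close>

lemma borel_measurable_fst_snd [measurable]:
  "fst \<in> borel_measurable (borel :: ('a::euclidean_space \<times> 'b::euclidean_space) measure)"
  "snd \<in> borel_measurable (borel :: ('a::euclidean_space \<times> 'b::euclidean_space) measure)"
  by (auto intro!: borel_measurable_continuous_onI continuous_intros)

lemma P2D:
  assumes "\<mu> \<in> P2"
  shows "prob_space \<mu>" "sets \<mu> = sets borel" "space \<mu> = UNIV" "integrable \<mu> (\<lambda>x. (norm x)\<^sup>2)"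
  using assms sets_eq_imp_space_eq[of \<mu> borel] by (auto simp: P2_def)

lemma P2_measurable_iff: "\<mu> \<in> P2 \<Longrightarrow> measurable \<mu> N = measurable borel N"
  by (rule measurable_cong_sets) (auto dest: P2D)

lemma P2_id_sqint: "\<mu> \<in> P2 \<Longrightarrow> (\<lambda>x. x) \<in> sqint \<mu>"
  by (auto simp: sqint_def P2_measurable_iff dest: P2D)

lemma distr_in_P2:
  fixes X :: "'c \<Rightarrow> 'a::euclidean_space"
  assumes "prob_space \<Omega>" "X \<in> sqint \<Omega>"
  shows "distr \<Omega> borel X \<in> P2"
  using assms by (auto simp: P2_def sqint_def integrable_distr_eq intro!: prob_space.prob_space_distr)

lemma couplingsD:
  assumes "\<gamma> \<in> couplings \<mu> \<nu>"
  shows "\<gamma> \<in> P2" "distr \<gamma> borel fst = \<mu>" "distr \<gamma> borel snd = \<nu>"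
    "fst \<in> sqint \<gamma>" "snd \<in> sqint \<gamma>" "\<mu> \<in> P2" "\<nu> \<in> P2"
proof -
  show P: "\<gamma> \<in> P2" and m: "distr \<gamma> borel fst = \<mu>" "distr \<gamma> borel snd = \<nu>"
    using assms by (auto simp: couplings_def)
  have b: "(norm (fst z))\<^sup>2 \<le> (norm z)\<^sup>2" "(norm (snd z))\<^sup>2 \<le> (norm z)\<^sup>2" for z :: "'a \<times> 'a"
    by (cases z; simp add: norm_Pair)+
  show f: "fst \<in> sqint \<gamma>"
    by (rule sqint_bound[OF _ P2D(4)[OF P]]) (auto simp: P2_measurable_iff[OF P] b)
  show g: "snd \<in> sqint \<gamma>"
    by (rule sqint_bound[OF _ P2D(4)[OF P]]) (auto simp: P2_measurable_iff[OF P] b)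
  show "\<mu> \<in> P2" "\<nu> \<in> P2"
    using distr_in_P2[OF P2D(1)[OF P]] f g m by auto
qed

lemma coupling_marginals:
  fixes f :: "'a::euclidean_space \<Rightarrow> 'b::euclidean_space"
  assumes g: "\<gamma> \<in> couplings \<mu> \<nu>" and f: "f \<in> borel_measurable borel"
  shows "(LINT z|\<gamma>. f (fst z)) = (LINT x|\<mu>. f x)" "(LINT z|\<gamma>. f (snd z)) = (LINT x|\<nu>. f x)"
    "integrable \<gamma> (\<lambda>z. f (fst z)) \<longleftrightarrow> integrable \<mu> f" "integrable \<gamma> (\<lambda>z. f (snd z)) \<longleftrightarrow> integrable \<nu> f"
proof -
  have [measurable]: "fst \<in> borel_measurable \<gamma>" "snd \<in> borel_measurable \<gamma>" using couplingsD[OF g] by auto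
  note f[measurable]
  show "(LINT z|\<gamma>. f (fst z)) = (LINT x|\<mu>. f x)" "integrable \<gamma> (\<lambda>z. f (fst z)) \<longleftrightarrow> integrable \<mu> f"
    unfolding couplingsD(2)[OF g, symmetric] by (simp_all add: integral_distr integrable_distr_eq)
  show "(LINT z|\<gamma>. f (snd z)) = (LINT x|\<nu>. f x)" "integrable \<gamma> (\<lambda>z. f (snd z)) \<longleftrightarrow> integrable \<nu> f"
    unfolding couplingsD(3)[OF g, symmetric] by (simp_all add: integral_distr integrable_distr_eq)
qed

lemma coupling_sqint_fst:
  fixes f :: "'a::euclidean_space \<Rightarrow> 'b::euclidean_space"
  assumes g: "\<gamma> \<in> couplings \<mu> \<nu>" and f: "f \<in> sqint \<mu>"
  shows "(\<lambda>z. f (fst z)) \<in> sqint \<gamma>" "rms \<gamma> (\<lambda>z. f (fst z)) = rms \<mu> f"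
proof -
  have [measurable]: "fst \<in> borel_measurable \<gamma>" using couplingsD[OF g] by auto
  have [measurable]: "f \<in> borel_measurable borel"
    using f P2_measurable_iff[OF couplingsD(6)[OF g]] by (auto simp: sqint_def)
  have "(\<lambda>x. (norm (f x))\<^sup>2) \<in> borel_measurable borel" by simp
  from coupling_marginals(1,3)[OF g this] f
  show "(\<lambda>z. f (fst z)) \<in> sqint \<gamma>" "rms \<gamma> (\<lambda>z. f (fst z)) = rms \<mu> f"
    by (auto simp: sqint_def rms_def)
qed

lemma coupling_cost:
  assumes "\<gamma> \<in> couplings \<mu> \<nu>"
  shows "(\<lambda>z. snd z - fst z) \<in> sqint \<gamma>" "transport_cost \<gamma> = (rms \<gamma> (\<lambda>z. snd z - fst z))\<^sup>2"
  using sqint_diff[OF couplingsD(5,4)[OF assms]]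
  by (auto simp: transport_cost_def rms_power2 norm_minus_commute)

text \<open>Couplings are built as joint laws: this reduces the estimates of Wasserstein distances below to
  computations with square-integrable functions on one probability space.\<close>

lemma coupling_of_random_variables:
  fixes A B :: "'c \<Rightarrow> 'a::euclidean_space"
  assumes "prob_space \<Omega>" "A \<in> sqint \<Omega>" "B \<in> sqint \<Omega>"
  shows "distr \<Omega> borel (\<lambda>\<omega>. (A \<omega>, B \<omega>)) \<in> couplings (distr \<Omega> borel A) (distr \<Omega> borel B)"
    "transport_cost (distr \<Omega> borel (\<lambda>\<omega>. (A \<omega>, B \<omega>))) = (rms \<Omega> (\<lambda>\<omega>. A \<omega> - B \<omega>))\<^sup>2"
proof -
  have [measurable]: "A \<in> borel_measurable \<Omega>" "B \<in> borel_measurable \<Omega>" using assms by auto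
  have [measurable]: "(\<lambda>\<omega>. (A \<omega>, B \<omega>)) \<in> borel_measurable \<Omega>" by (rule borel_measurable_Pair) auto
  have "(\<lambda>\<omega>. (A \<omega>, B \<omega>)) \<in> sqint \<Omega>"
  proof (rule sqint_bound)
    show "integrable \<Omega> (\<lambda>\<omega>. (norm (A \<omega>))\<^sup>2 + (norm (B \<omega>))\<^sup>2)" using assms by (auto simp: sqint_def)
  qed (auto simp: norm_Pair)
  then show "distr \<Omega> borel (\<lambda>\<omega>. (A \<omega>, B \<omega>)) \<in> couplings (distr \<Omega> borel A) (distr \<Omega> borel B)"
    using distr_in_P2[OF assms(1)] by (simp add: couplings_def distr_distr o_def)
  show "transport_cost (distr \<Omega> borel (\<lambda>\<omega>. (A \<omega>, B \<omega>))) = (rms \<Omega> (\<lambda>\<omega>. A \<omega> - B \<omega>))\<^sup>2"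
    by (simp add: transport_cost_def rms_power2 integral_distr)
qed

lemma couplings_nonempty:
  assumes "\<mu> \<in> P2" "\<nu> \<in> P2"
  shows "couplings \<mu> \<nu> \<noteq> {}"
proof -
  interpret \<mu>: prob_space \<mu> by (rule P2D) fact
  interpret \<nu>: prob_space \<nu> by (rule P2D) fact
  interpret pair_prob_space \<mu> \<nu> ..
  have [measurable_cong]: "sets \<mu> = sets borel" "sets \<nu> = sets borel" using assms P2D by auto
  have d: "distr (\<mu> \<Otimes>\<^sub>M \<nu>) borel fst = \<mu>" "distr (\<mu> \<Otimes>\<^sub>M \<nu>) borel snd = \<nu>"
  proof -
    have e: "emeasure (distr (\<mu> \<Otimes>\<^sub>M \<nu>) borel fst) A = emeasure \<mu> A"
      "emeasure (distr (\<mu> \<Otimes>\<^sub>M \<nu>) borel snd) A = emeasure \<nu> A" if "A \<in> sets borel" for A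
    proof -
      have [measurable]: "A \<in> sets \<mu>" "A \<in> sets \<nu>" "A \<in> sets borel" using that assms P2D by auto
      have "fst -` A \<inter> space (\<mu> \<Otimes>\<^sub>M \<nu>) = A \<times> space \<nu>" "snd -` A \<inter> space (\<mu> \<Otimes>\<^sub>M \<nu>) = space \<mu> \<times> A"
        by (auto simp: space_pair_measure P2D(3) assms)
      then show "emeasure (distr (\<mu> \<Otimes>\<^sub>M \<nu>) borel fst) A = emeasure \<mu> A"
        "emeasure (distr (\<mu> \<Otimes>\<^sub>M \<nu>) borel snd) A = emeasure \<nu> A"
        by (simp_all add: emeasure_distr \<nu>.emeasure_pair_measure_Times \<mu>.emeasure_space_1 \<nu>.emeasure_space_1)
    qed
    show "distr (\<mu> \<Otimes>\<^sub>M \<nu>) borel fst = \<mu>" "distr (\<mu> \<Otimes>\<^sub>M \<nu>) borel snd = \<nu>"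
      by (rule measure_eqI; simp add: P2D(2) assms e)+
  qed
  have "fst \<in> sqint (\<mu> \<Otimes>\<^sub>M \<nu>)" "snd \<in> sqint (\<mu> \<Otimes>\<^sub>M \<nu>)"
  proof -
    have "integrable (distr (\<mu> \<Otimes>\<^sub>M \<nu>) borel fst) (\<lambda>x. (norm x)\<^sup>2)"
      "integrable (distr (\<mu> \<Otimes>\<^sub>M \<nu>) borel snd) (\<lambda>x. (norm x)\<^sup>2)"
      unfolding d using P2D(4) assms by auto
    then show "fst \<in> sqint (\<mu> \<Otimes>\<^sub>M \<nu>)" "snd \<in> sqint (\<mu> \<Otimes>\<^sub>M \<nu>)"
      by (auto simp: sqint_def integrable_distr_eq)
  qed
  from coupling_of_random_variables(1)[OF _ this] d show ?thesis by (auto intro: prob_space_axioms)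
qed

lemma transport_cost_nonneg: "0 \<le> transport_cost \<gamma>"
  by (simp add: transport_cost_def)

lemma W2_le:
  assumes "\<gamma> \<in> couplings \<mu> \<nu>"
  shows "W2 \<mu> \<nu> \<le> sqrt (transport_cost \<gamma>)"
  unfolding W2_def by (rule cINF_lower[OF bdd_belowI[of _ 0] assms]) (auto simp: transport_cost_nonneg)

lemma W2_nonneg:
  assumes "\<mu> \<in> P2" "\<nu> \<in> P2"
  shows "0 \<le> W2 \<mu> \<nu>"
  unfolding W2_def using couplings_nonempty[OF assms] transport_cost_nonneg
  by (intro cINF_greatest) auto

lemma W2_le_rms:
  assumes "prob_space \<Omega>" "A \<in> sqint \<Omega>" "B \<in> sqint \<Omega>" "distr \<Omega> borel A = \<mu>" "distr \<Omega> borel B = \<nu>"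
  shows "W2 \<mu> \<nu> \<le> rms \<Omega> (\<lambda>\<omega>. A \<omega> - B \<omega>)"
  using W2_le[OF coupling_of_random_variables(1)[OF assms(1-3)]]
    coupling_of_random_variables(2)[OF assms(1-3)] assms(4,5) by simp

lemma optimal_couplingI:
  assumes g: "\<gamma> \<in> couplings \<mu> \<nu>" and le: "transport_cost \<gamma> \<le> (W2 \<mu> \<nu>)\<^sup>2"
  shows "\<gamma> \<in> optimal_couplings \<mu> \<nu>"
proof -
  have "(W2 \<mu> \<nu>)\<^sup>2 \<le> (sqrt (transport_cost \<gamma>))\<^sup>2"
    using W2_le[OF g] W2_nonneg[OF couplingsD(6,7)[OF g]] by (intro power_mono)
  then show ?thesis using g le transport_cost_nonneg[of \<gamma>] by (simp add: optimal_couplings_def)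
qed

lemma optimal_couplingD:
  assumes "\<gamma> \<in> optimal_couplings \<mu> \<nu>"
  shows "\<gamma> \<in> couplings \<mu> \<nu>" "transport_cost \<gamma> = (W2 \<mu> \<nu>)\<^sup>2"
    "rms \<gamma> (\<lambda>z. snd z - fst z) = W2 \<mu> \<nu>"
proof -
  show g: "\<gamma> \<in> couplings \<mu> \<nu>" and c: "transport_cost \<gamma> = (W2 \<mu> \<nu>)\<^sup>2"
    using assms by (auto simp: optimal_couplings_def)
  show "rms \<gamma> (\<lambda>z. snd z - fst z) = W2 \<mu> \<nu>"
    using c coupling_cost(2)[OF g] W2_nonneg[OF couplingsD(6,7)[OF g]]
    by (simp add: power2_eq_iff_nonneg)
qed

lemma optimal_coupling_cost_le:
  assumes "\<gamma> \<in> optimal_couplings \<mu> \<nu>" "\<gamma>' \<in> couplings \<mu> \<nu>"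
  shows "transport_cost \<gamma> \<le> transport_cost \<gamma>'"
  using W2_le[OF assms(2)] optimal_couplingD(2)[OF assms(1)] transport_cost_nonneg[of \<gamma>']
    W2_nonneg[OF couplingsD(6,7)[OF assms(2)]]
  by (metis power_mono real_sqrt_pow2)

text \<open>Closed sets form an \<open>\<inter>\<close>-stable generator of the Borel sets, and the indicator of a closed set is a
  decreasing limit of continuous functions with values in \<open>[0,1]\<close>.\<close>

lemma measure_eqI_continuous_integrals:
  fixes M N :: "'a::euclidean_space measure"
  assumes "prob_space M" "prob_space N" and M[measurable_cong]: "sets M = sets borel"
    and N[measurable_cong]: "sets N = sets borel"
    and eq: "\<And>h :: 'a \<Rightarrow> real. continuous_on UNIV h \<Longrightarrow> (\<And>x. 0 \<le> h x \<and> h x \<le> 1)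
      \<Longrightarrow> (LINT x|M. h x) = (LINT x|N. h x)"
  shows "M = N"
proof -
  interpret M: prob_space M by fact
  interpret N: prob_space N by fact
  have sp: "space M = UNIV" "space N = UNIV"
    using sets_eq_imp_space_eq[OF M] sets_eq_imp_space_eq[OF N] by auto
  have "measure M C = measure N C" if C: "closed C" for C
  proof (cases "C = {}")
    case False
    define h where "h k x = max 0 (1 - real k * infdist x C)" for k x
    have hc: "continuous_on UNIV (h k)" for k
      unfolding h_def by (intro continuous_intros)
    have hm[measurable]: "h k \<in> borel_measurable borel" for k
      using hc by (rule borel_measurable_continuous_onI)
    have h01: "0 \<le> h k x \<and> h k x \<le> 1" for k x
      by (auto simp: h_def infdist_nonneg)
    have lim: "(\<lambda>k. h k x) \<longlonglongrightarrow> indicator C x" for x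
    proof (cases "x \<in> C")
      case True
      then show ?thesis by (simp add: h_def)
    next
      case x: False
      then have "infdist x C > 0" using C False in_closed_iff_infdist_zero[of C x] infdist_nonneg[of x C]
        by fastforce
      then obtain n where n: "real n * infdist x C > 1" by (meson ex_less_of_nat_mult)
      have "\<forall>\<^sub>F k in sequentially. h k x = 0"
      proof (rule eventually_sequentiallyI)
        fix k assume "n \<le> k"
        then have "real n * infdist x C \<le> real k * infdist x C"
          by (intro mult_right_mono infdist_nonneg) auto
        then show "h k x = 0" using n by (simp add: h_def)
      qed
      then show ?thesis using x by (simp add: tendsto_eventually)
    qed
    have [measurable]: "C \<in> sets borel" using C by auto
    have "(\<lambda>k. LINT x|K. h k x) \<longlonglongrightarrow> measure K C" if K: "prob_space K" "sets K = sets borel" for K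
    proof -
      interpret K: prob_space K by fact
      have [measurable_cong]: "sets K = sets borel" by fact
      have "space K = UNIV" using sets_eq_imp_space_eq[OF K(2)] by simp
      have "(\<lambda>k. LINT x|K. h k x) \<longlonglongrightarrow> (LINT x|K. indicator C x)"
        by (rule integral_dominated_convergence[where w="\<lambda>_. 1"]) (use h01 lim in auto)
      then show ?thesis using \<open>space K = UNIV\<close> by simp
    qed
    from this[OF assms(1) M] this[OF assms(2) N] show ?thesis
      using eq[OF hc h01] LIMSEQ_unique by simp
  qed simp
  then have eqC: "emeasure M C = emeasure N C" if "closed C" for C
    using that by (simp add: M.emeasure_eq_measure N.emeasure_eq_measure)
  show ?thesis
  proof (rule measure_eqI_generator_eq[where E="Collect closed" and \<Omega>=UNIV and A="\<lambda>_. UNIV"])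
    show "Int_stable (Collect closed)" by (auto simp: Int_stable_def)
    show "sets M = sigma_sets UNIV (Collect closed)" "sets N = sigma_sets UNIV (Collect closed)"
      using M N by (auto simp: borel_eq_closed)
  qed (use eqC in auto)
qed

text \<open>Weak convergence together with convergence of the second moments.  This is convergence in the
  Wasserstein distance, in a form that mentions no coupling and can be verified by dominated
  convergence.\<close>

definition W2_converges :: "(nat \<Rightarrow> 'a::euclidean_space measure) \<Rightarrow> 'a measure \<Rightarrow> bool" where
  "W2_converges \<mu>s \<mu> \<longleftrightarrow>
    (\<forall>h. continuous_on UNIV h \<longrightarrow> (\<forall>x. 0 \<le> h x \<and> h x \<le> 1) \<longrightarrow>
      (\<lambda>n. LINT x|\<mu>s n. h x :: real) \<longlonglongrightarrow> (LINT x|\<mu>. h x)) \<and>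
    (\<lambda>n. LINT x|\<mu>s n. (norm x)\<^sup>2) \<longlonglongrightarrow> (LINT x|\<mu>. (norm x)\<^sup>2)"

lemma W2_converges_const: "W2_converges (\<lambda>_. \<mu>) \<mu>"
  by (simp add: W2_converges_def)

text \<open>Fatou's lemma is applied to \<open>2|X\<^sub>n|\<^sup>2 + 2|Y|\<^sup>2 - |X\<^sub>n - Y|\<^sup>2 \<ge> 0\<close>, along a subsequence on which the last
  term has integral bounded away from zero if the claim fails.\<close>

lemma rms_convergence:
  fixes X :: "nat \<Rightarrow> 'c \<Rightarrow> 'b::euclidean_space"
  assumes X: "\<And>n. X n \<in> sqint M" and Y: "Y \<in> sqint M"
    and lim: "AE x in M. (\<lambda>n. X n x) \<longlonglongrightarrow> Y x"
    and norms: "(\<lambda>n. LINT x|M. (norm (X n x))\<^sup>2) \<longlonglongrightarrow> (LINT x|M. (norm (Y x))\<^sup>2)"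
  shows "(\<lambda>n. rms M (\<lambda>x. X n x - Y x)) \<longlonglongrightarrow> 0"
proof -
  define d where "d n x = (norm (X n x - Y x))\<^sup>2" for n x
  define y where "y = (LINT x|M. (norm (Y x))\<^sup>2)"
  have id: "integrable M (d n)" for n
    using sqint_diff[OF X Y, of n] by (auto simp: d_def[abs_def])
  have iX: "integrable M (\<lambda>x. (norm (X n x))\<^sup>2)" for n using X by auto
  have iY: "integrable M (\<lambda>x. (norm (Y x))\<^sup>2)" using Y by auto
  have "(\<lambda>n. LINT x|M. d n x) \<longlonglongrightarrow> 0"
  proof (rule LIMSEQ_I, rule ccontr)
    fix e :: real assume e: "e > 0" "\<not> (\<exists>no. \<forall>n\<ge>no. norm ((LINT x|M. d n x) - 0) < e)"
    then have "\<not> (\<forall>\<^sub>F n in sequentially. (LINT x|M. d n x) < e)"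
      by (auto simp: eventually_sequentially d_def)
    from not_eventually_sequentiallyD[OF this] obtain r where
      r: "strict_mono (r :: nat \<Rightarrow> nat)" "\<And>n. e \<le> (LINT x|M. d (r n) x)" by (auto simp: not_less)
    define g where "g n x = 2 * (norm (X (r n) x))\<^sup>2 + 2 * (norm (Y x))\<^sup>2 - d (r n) x" for n x
    have ig: "integrable M (g n)" for n
      unfolding g_def[abs_def] using iX iY id by auto
    have g0: "0 \<le> g n x" for n x
      using norm_add_power2_le[of "X (r n) x" "- Y x"] by (simp add: g_def d_def)
    have lg: "AE x in M. (\<lambda>n. g n x) \<longlonglongrightarrow> 4 * (norm (Y x))\<^sup>2"
      using lim
    proof eventually_elim
      fix x assume "(\<lambda>n. X n x) \<longlonglongrightarrow> Y x"
      then have l: "(\<lambda>n. X (r n) x) \<longlonglongrightarrow> Y x" using LIMSEQ_subseq_LIMSEQ[OF _ r(1)] by (simp add: o_def)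
      have "(\<lambda>n. g n x) \<longlonglongrightarrow> 2 * (norm (Y x))\<^sup>2 + 2 * (norm (Y x))\<^sup>2 - (norm (Y x - Y x))\<^sup>2"
        unfolding g_def d_def by (intro tendsto_intros l)
      then show "(\<lambda>n. g n x) \<longlonglongrightarrow> 4 * (norm (Y x))\<^sup>2" by simp
    qed
    have Ig: "(LINT x|M. g n x) = 2 * (LINT x|M. (norm (X (r n) x))\<^sup>2) + 2 * y - (LINT x|M. d (r n) x)" for n
      unfolding g_def y_def using iX iY id by simp
    have "(\<lambda>n. 2 * (LINT x|M. (norm (X (r n) x))\<^sup>2) + 2 * y - e) \<longlonglongrightarrow> 2 * y + 2 * y - e"
      using LIMSEQ_subseq_LIMSEQ[OF norms r(1)] unfolding y_def
      by (intro tendsto_intros) (simp add: o_def)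
    then have "\<forall>\<^sub>F n in sequentially. 2 * (LINT x|M. (norm (X (r n) x))\<^sup>2) + 2 * y - e < 4 * y - e / 2"
      using e(1) by (intro order_tendstoD) auto
    then have ev: "\<forall>\<^sub>F n in sequentially. (LINT x|M. g n x) \<le> max 0 (4 * y - e / 2)"
      by eventually_elim (use r(2) Ig in \<open>smt (verit)\<close>)
    have "(LINT x|M. 4 * (norm (Y x))\<^sup>2) \<le> max 0 (4 * y - e / 2)"
      by (rule Fatou_integral_le(2)[OF ig g0 _ lg ev]) (use iY in auto)
    then have "4 * y \<le> max 0 (4 * y - e / 2)" by (simp add: y_def)
    moreover have "y \<ge> 0" by (simp add: y_def)
    ultimately have y0: "y = 0" using e(1) by linarith
    have "(\<lambda>n. 2 * (LINT x|M. (norm (X (r n) x))\<^sup>2) + 2 * y) \<longlonglongrightarrow> 2 * y + 2 * y"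
      using LIMSEQ_subseq_LIMSEQ[OF norms r(1)] unfolding y_def
      by (intro tendsto_intros) (simp add: o_def)
    then have "\<forall>\<^sub>F n in sequentially. 2 * (LINT x|M. (norm (X (r n) x))\<^sup>2) + 2 * y < e"
      using e(1) y0 by (intro order_tendstoD) auto
    then obtain n where "2 * (LINT x|M. (norm (X (r n) x))\<^sup>2) + 2 * y < e"
      using eventually_happens'[OF sequentially_bot] by blast
    moreover have "0 \<le> (LINT x|M. g n x)" using g0 by simp
    ultimately show False using Ig[of n] r(2)[of n] by linarith
  qed
  then have "(\<lambda>n. sqrt (LINT x|M. d n x)) \<longlonglongrightarrow> sqrt 0" by (intro tendsto_intros)
  then show ?thesis by (simp add: rms_def d_def)
qed

lemma rms_tendsto:
  assumes X: "\<And>n. X n \<in> sqint M" and Y: "Y \<in> sqint M"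
    and lim: "(\<lambda>n. rms M (\<lambda>x. X n x - Y x)) \<longlonglongrightarrow> 0"
  shows "(\<lambda>n. rms M (X n)) \<longlonglongrightarrow> rms M Y"
proof -
  have "(\<lambda>n. rms M (X n) - rms M Y) \<longlonglongrightarrow> 0"
    by (rule Lim_null_comparison[OF _ lim]) (use rms_diff_ge[OF X Y] in auto)
  then show ?thesis by (simp add: LIM_zero_iff)
qed

text \<open>Along a subsequence the couplings are the laws of random variables that converge almost everywhere.
  Weak convergence of the marginals identifies the marginals of the limit, and convergence of their
  second moments turns almost everywhere convergence into convergence in \<open>L\<^sup>2\<close>.\<close>

theorem couplings_compact:
  fixes \<mu> \<nu> :: "'a::euclidean_space measure"
  assumes \<mu>: "\<mu> \<in> P2" and \<nu>: "\<nu> \<in> P2"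
    and g: "\<And>n. \<gamma> n \<in> couplings (\<mu>s n) (\<nu>s n)"
    and c: "W2_converges \<mu>s \<mu>" "W2_converges \<nu>s \<nu>"
  obtains r :: "nat \<Rightarrow> nat" and \<Omega> :: "real measure" and A B A' B' where
    "strict_mono r" "prob_space \<Omega>" "\<And>n. A n \<in> sqint \<Omega>" "\<And>n. B n \<in> sqint \<Omega>"
    "A' \<in> sqint \<Omega>" "B' \<in> sqint \<Omega>"
    "\<And>n. distr \<Omega> borel (\<lambda>\<omega>. (A n \<omega>, B n \<omega>)) = \<gamma> (r n)"
    "distr \<Omega> borel A' = \<mu>" "distr \<Omega> borel B' = \<nu>"
    "(\<lambda>n. rms \<Omega> (\<lambda>\<omega>. A n \<omega> - A' \<omega>)) \<longlonglongrightarrow> 0" "(\<lambda>n. rms \<Omega> (\<lambda>\<omega>. B n \<omega> - B' \<omega>)) \<longlonglongrightarrow> 0"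
proof -
  have "Bseq (\<lambda>n. LINT x|\<mu>s n. (norm x)\<^sup>2)" "Bseq (\<lambda>n. LINT x|\<nu>s n. (norm x)\<^sup>2)"
    using c by (auto simp: W2_converges_def intro!: convergent_imp_Bseq convergentI)
  then obtain C1 C2 where C: "\<And>n. (LINT x|\<mu>s n. (norm x)\<^sup>2) \<le> C1" "\<And>n. (LINT x|\<nu>s n. (norm x)\<^sup>2) \<le> C2"
    unfolding Bseq_def by (metis abs_le_D1 real_norm_def)
  have mom: "(LINT z|\<gamma> n. (norm z)\<^sup>2) \<le> C1 + C2" for n
  proof -
    have "(norm z)\<^sup>2 = (norm (fst z))\<^sup>2 + (norm (snd z))\<^sup>2" for z :: "'a \<times> 'a"
      by (cases z) (simp add: norm_Pair)
    then have "(LINT z|\<gamma> n. (norm z)\<^sup>2) = (LINT z|\<gamma> n. (norm (fst z))\<^sup>2) + (LINT z|\<gamma> n. (norm (snd z))\<^sup>2)"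
      using couplingsD(4,5)[OF g[of n]] by (simp add: sqintD)
    then show ?thesis
      using C[of n] coupling_marginals(1,2)[OF g, of "\<lambda>x. (norm x)\<^sup>2"] by simp
  qed
  obtain r :: "nat \<Rightarrow> nat" and \<Omega> :: "real measure" and X Y where
    r: "strict_mono r" and \<Omega>: "prob_space \<Omega>" and X[measurable]: "\<And>n. X n \<in> borel_measurable \<Omega>"
    and Y[measurable]: "Y \<in> borel_measurable \<Omega>"
    and d: "\<And>n. distr \<Omega> borel (X n) = \<gamma> (r n)" and lim: "AE \<omega> in \<Omega>. (\<lambda>n. X n \<omega>) \<longlonglongrightarrow> Y \<omega>"
    by (rule Skorokhod_subsequence[of \<gamma> "C1 + C2", OF couplingsD(1)[OF g] mom]) blast
  interpret prob_space \<Omega> by (rule \<Omega>)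
  have sub: "W2_converges (\<lambda>n. \<mu>s (r n)) \<mu>" if "W2_converges \<mu>s \<mu>" for \<mu>s and \<mu> :: "'a measure"
    using that LIMSEQ_subseq_LIMSEQ[OF _ r] unfolding W2_converges_def o_def by blast
  \<comment> \<open>The same argument serves both marginals; \<open>p\<close> is the projection.\<close>
  have marg: "p \<circ> X n \<in> sqint \<Omega> \<and> p \<circ> Y \<in> sqint \<Omega> \<and> distr \<Omega> borel (p \<circ> Y) = \<mu> \<and>
      (\<lambda>n. rms \<Omega> (\<lambda>\<omega>. (p \<circ> X n) \<omega> - (p \<circ> Y) \<omega>)) \<longlonglongrightarrow> 0"
    if p: "continuous_on UNIV p" and m: "\<And>n. distr (\<gamma> n) borel p = \<mu>s n"
      and ps: "\<And>n. p \<in> sqint (\<gamma> n)" and c: "W2_converges \<mu>s \<mu>" and \<mu>: "\<mu> \<in> P2"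
    for p :: "'a \<times> 'a \<Rightarrow> 'a" and \<mu>s \<mu> n
  proof -
    have [measurable]: "p \<in> borel_measurable borel" using p by (rule borel_measurable_continuous_onI)
    have dX: "distr \<Omega> borel (p \<circ> X n) = \<mu>s (r n)" for n
      using m[of "r n"] unfolding d[symmetric] by (subst (asm) distr_distr) auto
    have sX: "p \<circ> X n \<in> sqint \<Omega>" for n
      using ps[of "r n"] unfolding d[symmetric] by (auto simp: sqint_def integrable_distr_eq o_def)
    have lp: "AE \<omega> in \<Omega>. (\<lambda>n. (p \<circ> X n) \<omega>) \<longlonglongrightarrow> (p \<circ> Y) \<omega>"
      using lim by eventually_elim (auto intro!: continuous_on_tendsto_compose[OF p])
    have dY: "distr \<Omega> borel (p \<circ> Y) = \<mu>"
    proof (rule measure_eqI_continuous_integrals)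
      show "prob_space (distr \<Omega> borel (p \<circ> Y))" by (rule prob_space_distr) simp
      fix h :: "'a \<Rightarrow> real" assume h: "continuous_on UNIV h" "\<And>x. 0 \<le> h x \<and> h x \<le> 1"
      have [measurable]: "h \<in> borel_measurable borel" using h(1) by (rule borel_measurable_continuous_onI)
      have "(\<lambda>n. LINT \<omega>|\<Omega>. h ((p \<circ> X n) \<omega>)) \<longlonglongrightarrow> (LINT \<omega>|\<Omega>. h ((p \<circ> Y) \<omega>))"
      proof (rule integral_dominated_convergence[where w="\<lambda>_. 1"])
        show "AE \<omega> in \<Omega>. (\<lambda>n. h ((p \<circ> X n) \<omega>)) \<longlonglongrightarrow> h ((p \<circ> Y) \<omega>)"
          using lp by eventually_elim (auto intro!: continuous_on_tendsto_compose[OF h(1)])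
      qed (use h(2) in auto)
      moreover have "(LINT \<omega>|\<Omega>. h ((p \<circ> X n) \<omega>)) = (LINT x|\<mu>s (r n). h x)" for n
        unfolding dX[symmetric] by (subst integral_distr) auto
      moreover have "(\<lambda>n. LINT x|\<mu>s (r n). h x) \<longlonglongrightarrow> (LINT x|\<mu>. h x)"
        using sub[OF c] h unfolding W2_converges_def by blast
      ultimately have "(LINT \<omega>|\<Omega>. h ((p \<circ> Y) \<omega>)) = (LINT x|\<mu>. h x)"
        using LIMSEQ_unique by simp
      then show "(LINT x|distr \<Omega> borel (p \<circ> Y). h x) = (LINT x|\<mu>. h x)"
        by (subst integral_distr) auto
    qed (use P2D[OF \<mu>] in auto)
    have sY: "p \<circ> Y \<in> sqint \<Omega>"
      using P2D(4)[OF \<mu>] unfolding dY[symmetric] by (auto simp: sqint_def integrable_distr_eq o_def)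
    have n: "(LINT \<omega>|\<Omega>. (norm ((p \<circ> X n) \<omega>))\<^sup>2) = (LINT x|\<mu>s (r n). (norm x)\<^sup>2)" for n
      unfolding dX[symmetric] by (subst integral_distr) auto
    have n': "(LINT \<omega>|\<Omega>. (norm ((p \<circ> Y) \<omega>))\<^sup>2) = (LINT x|\<mu>. (norm x)\<^sup>2)"
      unfolding dY[symmetric] by (subst integral_distr) auto
    have "(\<lambda>n. rms \<Omega> (\<lambda>\<omega>. (p \<circ> X n) \<omega> - (p \<circ> Y) \<omega>)) \<longlonglongrightarrow> 0"
      using sub[OF c] unfolding W2_converges_def
      by (intro rms_convergence[OF sX sY lp]) (simp only: n n')
    with sX sY dY show ?thesis by blast
  qed
  note A = marg[OF continuous_on_fst[OF continuous_on_id] couplingsD(2)[OF g] couplingsD(4)[OF g] c(1) \<mu>]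
  note B = marg[OF continuous_on_snd[OF continuous_on_id] couplingsD(3)[OF g] couplingsD(5)[OF g] c(2) \<nu>]
  show ?thesis
    by (rule that[of r \<Omega> "\<lambda>n. fst \<circ> X n" "\<lambda>n. snd \<circ> X n" "fst \<circ> Y" "snd \<circ> Y"])
       (use r \<Omega> A B d in auto)
qed

text \<open>The direct method: a minimising sequence of couplings has a limit, and the cost converges because
  the representing random variables converge in \<open>L\<^sup>2\<close>.  Without existence, the defining condition
  of \<^const>\<open>wsubdiff\<close> would say nothing about the measures that have no optimal coupling with \<open>\<mu>\<close>.\<close>

theorem optimal_coupling_exists:
  assumes \<mu>: "\<mu> \<in> P2" and \<nu>: "\<nu> \<in> P2"
  shows "optimal_couplings \<mu> \<nu> \<noteq> {}"
proof -
  have "\<exists>\<gamma>\<in>couplings \<mu> \<nu>. sqrt (transport_cost \<gamma>) < W2 \<mu> \<nu> + 1 / Suc n" for n :: nat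
  proof -
    have "(INF \<gamma>\<in>couplings \<mu> \<nu>. sqrt (transport_cost \<gamma>)) < W2 \<mu> \<nu> + 1 / Suc n"
      by (simp add: W2_def)
    then show ?thesis
      by (subst (asm) cINF_less_iff)
         (auto intro!: bdd_belowI[of _ 0] simp: transport_cost_nonneg couplings_nonempty[OF assms])
  qed
  then obtain \<gamma> where g: "\<And>n. \<gamma> n \<in> couplings \<mu> \<nu>"
    and gc: "\<And>n. sqrt (transport_cost (\<gamma> n)) < W2 \<mu> \<nu> + 1 / Suc n" by metis
  obtain r :: "nat \<Rightarrow> nat" and \<Omega> :: "real measure" and A B A' B' where
    r: "strict_mono r" and \<Omega>: "prob_space \<Omega>" and A: "\<And>n. A n \<in> sqint \<Omega>" and B: "\<And>n. B n \<in> sqint \<Omega>"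
    and A': "A' \<in> sqint \<Omega>" and B': "B' \<in> sqint \<Omega>"
    and d: "\<And>n. distr \<Omega> borel (\<lambda>\<omega>. (A n \<omega>, B n \<omega>)) = \<gamma> (r n)"
    and d': "distr \<Omega> borel A' = \<mu>" "distr \<Omega> borel B' = \<nu>"
    and lA: "(\<lambda>n. rms \<Omega> (\<lambda>\<omega>. A n \<omega> - A' \<omega>)) \<longlonglongrightarrow> 0" and lB: "(\<lambda>n. rms \<Omega> (\<lambda>\<omega>. B n \<omega> - B' \<omega>)) \<longlonglongrightarrow> 0"
    by (rule couplings_compact[of \<mu> \<nu> \<gamma> "\<lambda>_. \<mu>" "\<lambda>_. \<nu>", OF \<mu> \<nu> g W2_converges_const W2_converges_const]) blast
  define D where "D n = rms \<Omega> (\<lambda>\<omega>. A n \<omega> - B n \<omega>)" for n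
  have D: "D n < W2 \<mu> \<nu> + 1 / Suc (r n)" for n
    using gc[of "r n"] coupling_of_random_variables(2)[OF \<Omega> A B, of n n] by (simp add: d D_def)
  have le: "rms \<Omega> (\<lambda>\<omega>. A' \<omega> - B' \<omega>) \<le> D n + rms \<Omega> (\<lambda>\<omega>. A n \<omega> - A' \<omega>) + rms \<Omega> (\<lambda>\<omega>. B n \<omega> - B' \<omega>)" for n
    using rms_triangle[OF A' A B', of n] rms_triangle[OF A B B', of n n] rms_minus_commute[of \<Omega> "A n" A']
    by (simp add: D_def)
  have "(\<lambda>n. W2 \<mu> \<nu> + 1 / Suc (r n) + rms \<Omega> (\<lambda>\<omega>. A n \<omega> - A' \<omega>) + rms \<Omega> (\<lambda>\<omega>. B n \<omega> - B' \<omega>))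
      \<longlonglongrightarrow> W2 \<mu> \<nu> + 0 + 0 + 0"
    using LIMSEQ_subseq_LIMSEQ[OF LIMSEQ_inverse_real_of_nat r]
    by (intro tendsto_add tendsto_const lA lB) (simp add: o_def inverse_eq_divide)
  moreover have "rms \<Omega> (\<lambda>\<omega>. A' \<omega> - B' \<omega>)
      \<le> W2 \<mu> \<nu> + 1 / Suc (r n) + rms \<Omega> (\<lambda>\<omega>. A n \<omega> - A' \<omega>) + rms \<Omega> (\<lambda>\<omega>. B n \<omega> - B' \<omega>)" for n
    using le[of n] D[of n] by linarith
  ultimately have "rms \<Omega> (\<lambda>\<omega>. A' \<omega> - B' \<omega>) \<le> W2 \<mu> \<nu> + 0 + 0 + 0"
    by (intro LIMSEQ_le_const) auto
  then have "(rms \<Omega> (\<lambda>\<omega>. A' \<omega> - B' \<omega>))\<^sup>2 \<le> (W2 \<mu> \<nu>)\<^sup>2" by (intro power_mono) auto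
  then have "distr \<Omega> borel (\<lambda>\<omega>. (A' \<omega>, B' \<omega>)) \<in> optimal_couplings \<mu> \<nu>"
    using coupling_of_random_variables[OF \<Omega> A' B'] d' by (intro optimal_couplingI) auto
  then show ?thesis by blast
qed

section \<open>Smooth functions and test gradients\<close>

text \<open>Membership in \<^const>\<open>test_functions\<close> without the condition on the support.\<close>

definition smooth :: "('a::euclidean_space \<Rightarrow> real) \<Rightarrow> bool" where
  "smooth f \<longleftrightarrow> (\<forall>k. Ck_fun k f)"

lemma has_derivative_frechet:
  "f differentiable (at x) \<Longrightarrow> (f has_derivative frechet_derivative f (at x)) (at x)"
  by (simp add: frechet_derivative_works)

lemma Ck_funI:
  assumes "\<And>x. (f has_derivative D x) (at x)" "\<And>v. Ck_fun k (\<lambda>x. D x v)"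
  shows "Ck_fun (Suc k) f"
proof -
  have "frechet_derivative f (at x) = D x" for x using frechet_derivative_at[OF assms(1)] by simp
  then show ?thesis using assms by (auto simp: differentiable_def)
qed

lemma Ck_fun_SucD: "Ck_fun (Suc k) f \<Longrightarrow> Ck_fun k f"
proof (induction k arbitrary: f)
  case 0
  then show ?case
    by (auto simp: continuous_on_eq_continuous_at intro: differentiable_imp_continuous_within)
qed auto

lemma Ck_fun_const: "Ck_fun k (\<lambda>x. c)"
proof (induction k arbitrary: c)
  case (Suc k)
  show ?case by (rule Ck_funI[where D="\<lambda>_ _. 0"]) (auto intro: Suc)
qed simp

lemma Ck_fun_add: "Ck_fun k f \<Longrightarrow> Ck_fun k g \<Longrightarrow> Ck_fun k (\<lambda>x. f x + g x)"
proof (induction k arbitrary: f g)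
  case (Suc k)
  show ?case
    by (rule Ck_funI[where D="\<lambda>x v. frechet_derivative f (at x) v + frechet_derivative g (at x) v"])
       (use Suc in \<open>auto intro!: has_derivative_add has_derivative_frechet\<close>)
qed (auto intro: continuous_on_add)

lemma Ck_fun_mult: "Ck_fun k f \<Longrightarrow> Ck_fun k g \<Longrightarrow> Ck_fun k (\<lambda>x. f x * g x)"
proof (induction k arbitrary: f g)
  case (Suc k)
  have "Ck_fun k (\<lambda>x. f x * frechet_derivative g (at x) v + frechet_derivative f (at x) v * g x)" for v
    using Suc.prems by (intro Ck_fun_add Suc.IH Ck_fun_SucD[OF Suc.prems(1)] Ck_fun_SucD[OF Suc.prems(2)]) auto
  then show ?case
    by (intro Ck_funI[where D="\<lambda>x v. f x * frechet_derivative g (at x) v + frechet_derivative f (at x) v * g x"])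
       (use Suc in \<open>auto intro!: has_derivative_mult has_derivative_frechet\<close>)
qed (auto intro: continuous_on_mult)

lemma smoothD:
  assumes "smooth f"
  shows "(f has_derivative frechet_derivative f (at x)) (at x)" "f differentiable (at x)"
    "smooth (\<lambda>x. frechet_derivative f (at x) v)" "continuous_on UNIV f"
proof -
  have "Ck_fun (Suc k) f" for k using assms by (simp add: smooth_def)
  then show "f differentiable (at x)" "smooth (\<lambda>x. frechet_derivative f (at x) v)"
    by (auto simp: smooth_def)
  then show "(f has_derivative frechet_derivative f (at x)) (at x)" by (simp add: has_derivative_frechet)
  have "Ck_fun 0 f" using assms by (auto simp: smooth_def simp del: Ck_fun.simps)
  then show "continuous_on UNIV f" by simp
qed

lemma smooth_const: "smooth (\<lambda>x. c)"
  by (simp add: smooth_def Ck_fun_const)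

lemma smooth_add: "smooth f \<Longrightarrow> smooth g \<Longrightarrow> smooth (\<lambda>x. f x + g x)"
  by (simp add: smooth_def Ck_fun_add)

lemma smooth_mult: "smooth f \<Longrightarrow> smooth g \<Longrightarrow> smooth (\<lambda>x. f x * g x)"
  by (simp add: smooth_def Ck_fun_mult)

lemma smooth_sum: "(\<And>i. i \<in> I \<Longrightarrow> smooth (f i)) \<Longrightarrow> smooth (\<lambda>x. \<Sum>i\<in>I. f i x)"
  by (induction I rule: infinite_finite_induct) (auto intro: smooth_const smooth_add)

lemma smooth_diff: "smooth f \<Longrightarrow> smooth g \<Longrightarrow> smooth (\<lambda>x. f x - g x)"
  using smooth_add[of f "\<lambda>x. -1 * g x"] smooth_mult[OF smooth_const, of g "-1"] by simp

lemma smooth_inner: "smooth (\<lambda>x. (x - p) \<bullet> v)"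
proof -
  have "Ck_fun k (\<lambda>x. (x - p) \<bullet> v)" for k
  proof (cases k)
    case (Suc m)
    show ?thesis unfolding Suc
      by (rule Ck_funI[where D="\<lambda>_ w. w \<bullet> v"]) (auto intro!: derivative_eq_intros Ck_fun_const)
  qed (auto intro!: continuous_intros)
  then show ?thesis by (simp add: smooth_def)
qed

lemma smooth_compose:
  fixes g :: "real \<Rightarrow> real"
  assumes g: "smooth g" and q: "smooth q"
  shows "smooth (\<lambda>x. g (q x))"
proof -
  have "Ck_fun k (\<lambda>x. g (q x))" for k
    using g
  proof (induction k arbitrary: g)
    case 0
    then show ?case using smoothD(4)[OF q] smoothD(4)[OF 0]
      by (auto intro: continuous_on_compose2[where t=UNIV])
  next
    case (Suc k)
    define D where "D x v = frechet_derivative g (at (q x)) 1 * frechet_derivative q (at x) v" for x v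
    have "((\<lambda>x. g (q x)) has_derivative D x) (at x)" for x
    proof -
      have "((\<lambda>x. g (q x)) has_derivative
          (\<lambda>v. frechet_derivative g (at (q x)) (frechet_derivative q (at x) v))) (at x)"
        using has_derivative_compose[OF smoothD(1)[OF q] smoothD(1)[OF Suc.prems]] .
      moreover have "(\<lambda>v. frechet_derivative g (at (q x)) (frechet_derivative q (at x) v)) = D x"
      proof
        fix v
        show "frechet_derivative g (at (q x)) (frechet_derivative q (at x) v) = D x v"
          unfolding D_def
          using linear_scale[OF has_derivative_linear[OF smoothD(1)[OF Suc.prems, of "q x"]],
              of "frechet_derivative q (at x) v" 1]
          by (simp add: mult.commute)
      qed
      ultimately show ?thesis by metis
    qed
    moreover have "Ck_fun k (\<lambda>x. D x v)" for v
      unfolding D_def using Suc.IH[OF smoothD(3)[OF Suc.prems]] smoothD(3)[OF q]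
      by (intro Ck_fun_mult) (auto simp: smooth_def)
    ultimately show ?case by (rule Ck_funI)
  qed
  then show ?thesis by (simp add: smooth_def)
qed

text \<open>Functions \<open>P(1/s) exp(-1/s)\<close> with \<open>P\<close> a polynomial, extended by zero, are closed under
  differentiation.\<close>

definition flat_fun :: "real poly \<Rightarrow> real \<Rightarrow> real" where
  "flat_fun p s = (if s \<le> 0 then 0 else poly p (1/s) * exp (- (1/s)))"

lemma poly_div_exp_tendsto_0: "((\<lambda>u::real. poly p u / exp u) \<longlongrightarrow> 0) at_top"
proof -
  have "((\<lambda>u::real. \<Sum>i\<le>degree p. coeff p i * (u ^ i / exp u)) \<longlongrightarrow> (\<Sum>i\<le>degree p. coeff p i * 0)) at_top"
    by (intro tendsto_intros tendsto_power_div_exp_0)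
  then show ?thesis by (simp add: poly_altdef sum_divide_distrib)
qed

lemma flat_fun_deriv: "(flat_fun p has_real_derivative flat_fun (monom 1 2 * (p - pderiv p)) s) (at s)"
proof -
  consider "s < 0" | "s > 0" | "s = 0" by linarith
  then show ?thesis
  proof cases
    case 1
    have "((\<lambda>_. 0) has_real_derivative 0) (at s)" by simp
    then have "(flat_fun p has_real_derivative 0) (at s)"
      by (rule has_field_derivative_transform_within_open[of _ _ _ "{..<0}"])
         (use 1 in \<open>auto simp: flat_fun_def\<close>)
    then show ?thesis using 1 by (simp add: flat_fun_def)
  next
    case 2
    have "((\<lambda>s. poly p (1/s) * exp (- (1/s))) has_real_derivative
        flat_fun (monom 1 2 * (p - pderiv p)) s) (at s)"
      unfolding flat_fun_def using 2
      by (auto intro!: derivative_eq_intros DERIV_chain2[OF poly_DERIV]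
          simp: poly_monom power2_eq_square field_simps)
    then show ?thesis
      by (rule has_field_derivative_transform_within_open[of _ _ _ "{0<..}"])
         (use 2 in \<open>auto simp: flat_fun_def\<close>)
  next
    case 3
    have "((\<lambda>h. flat_fun p h / h) \<longlongrightarrow> 0) (at_left 0)"
    proof (rule tendsto_eventually)
      show "\<forall>\<^sub>F h in at_left 0. flat_fun p h / h = 0"
        by (auto simp: flat_fun_def eventually_at_left_field intro!: exI[of _ "-1"])
    qed
    moreover have "((\<lambda>h. flat_fun p h / h) \<longlongrightarrow> 0) (at_right 0)"
    proof -
      have "((\<lambda>h::real. poly (pCons 0 p) (inverse h) / exp (inverse h)) \<longlongrightarrow> 0) (at_right 0)"
        by (rule filterlim_compose[OF poly_div_exp_tendsto_0 filterlim_inverse_at_top_right])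
      moreover have "\<forall>\<^sub>F h in at_right (0::real). poly (pCons 0 p) (inverse h) / exp (inverse h) = flat_fun p h / h"
        by (auto simp: eventually_at_right_field flat_fun_def exp_minus field_simps intro!: exI[of _ 1])
      ultimately show ?thesis by (rule Lim_transform_eventually)
    qed
    ultimately have "((\<lambda>h. flat_fun p h / h) \<longlongrightarrow> 0) (at 0)"
      by (simp add: filterlim_split_at)
    then have "(flat_fun p has_real_derivative 0) (at 0)"
      by (simp add: DERIV_def flat_fun_def)
    then show ?thesis using 3 by (simp add: flat_fun_def)
  qed
qed

lemma smooth_flat_fun: "smooth (flat_fun p)"
proof -
  have "Ck_fun k (flat_fun p)" for k
  proof (induction k arbitrary: p)
    case 0
    then show ?case
      by (auto simp: continuous_on_eq_continuous_at intro!: DERIV_isCont flat_fun_deriv)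
  next
    case (Suc k)
    show ?case
      by (rule Ck_funI[where D="\<lambda>s v. flat_fun (monom 1 2 * (p - pderiv p)) s * v"])
         (use flat_fun_deriv[of p] in \<open>simp add: has_field_derivative_def\<close>,
          intro Ck_fun_mult Suc Ck_fun_const)
  qed
  then show ?thesis by (simp add: smooth_def)
qed

text \<open>With \<open>h(s) = exp(-1/s)\<close> for \<open>s > 0\<close> and \<open>h(s) = 0\<close> otherwise, \<open>h(h(1) - h(s))\<close> is constant
  and positive for \<open>s \<le> 0\<close> and vanishes for \<open>s \<ge> 1\<close>.\<close>

lemma smooth_cutoff_real:
  obtains H :: "real \<Rightarrow> real" where "smooth H" "\<And>s. s \<le> 0 \<Longrightarrow> H s = 1" "\<And>s. 1 \<le> s \<Longrightarrow> H s = 0"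
proof
  define h where "h = flat_fun 1"
  have h1: "h 1 > 0" and h0: "\<And>s. s \<le> 0 \<Longrightarrow> h s = 0" and hpos: "\<And>s. s > 0 \<Longrightarrow> h s > 0"
    by (auto simp: h_def flat_fun_def)
  have hmono: "h 1 \<le> h s" if "1 \<le> s" for s using that by (auto simp: h_def flat_fun_def)
  define H where "H s = (1 / h (h 1)) * h (h 1 - h s)" for s
  have sh: "smooth h" by (simp add: h_def smooth_flat_fun)
  show "smooth H" unfolding H_def
    by (rule smooth_mult[OF smooth_const smooth_compose[OF sh smooth_diff[OF smooth_const sh]]])
  show "H s = 1" if "s \<le> 0" for s using h0[OF that] hpos[OF h1] by (simp add: H_def)
  show "H s = 0" if "1 \<le> s" for s using hmono[OF that] h0 by (simp add: H_def)
qed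

lemma smooth_bump:
  fixes p :: "'a::euclidean_space"
  assumes "r > 0"
  obtains \<beta> where "smooth \<beta>" "\<And>x. norm (x - p) \<le> r \<Longrightarrow> \<beta> x = 1" "\<And>x. 2 * r \<le> norm (x - p) \<Longrightarrow> \<beta> x = 0"
proof -
  obtain H :: "real \<Rightarrow> real" where H: "smooth H" "\<And>s. s \<le> 0 \<Longrightarrow> H s = 1" "\<And>s. 1 \<le> s \<Longrightarrow> H s = 0"
    by (rule smooth_cutoff_real) blast
  define q where "q x = (\<Sum>b\<in>Basis. ((x - p) \<bullet> b) * ((x - p) \<bullet> b)) * (1 / r\<^sup>2) - 1" for x
  have q: "q x = (norm (x - p))\<^sup>2 / r\<^sup>2 - 1" for x
    unfolding q_def power2_norm_eq_inner euclidean_inner[of "x - p" "x - p"] by simp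
  have "smooth q" unfolding q_def
    by (intro smooth_diff smooth_mult smooth_sum smooth_const smooth_inner)
  then have 1: "smooth (\<lambda>x. H (q x))" by (rule smooth_compose[OF H(1)])
  show ?thesis
  proof (rule that[OF 1])
    fix x assume "norm (x - p) \<le> r"
    then have "(norm (x - p))\<^sup>2 \<le> r\<^sup>2" by (intro power_mono) auto
    then show "H (q x) = 1" using assms by (intro H(2)) (simp add: q field_simps)
  next
    fix x assume "2 * r \<le> norm (x - p)"
    then have "(2 * r)\<^sup>2 \<le> (norm (x - p))\<^sup>2" using assms by (intro power_mono) auto
    then have "2 * r\<^sup>2 \<le> (norm (x - p))\<^sup>2" by (simp add: power_mult_distrib) (use zero_le_power2[of r] in linarith)
    then show "H (q x) = 0" using assms by (intro H(3)) (simp add: q field_simps)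
  qed
qed

lemma test_functions_iff:
  "\<phi> \<in> test_functions \<longleftrightarrow> smooth \<phi> \<and> (\<exists>R. \<forall>x. R < norm x \<longrightarrow> \<phi> x = 0)"
proof -
  have "compact (closure {x. \<phi> x \<noteq> 0}) \<longleftrightarrow> (\<exists>R. \<forall>x. R < norm x \<longrightarrow> \<phi> x = 0)"
    unfolding compact_closure bounded_iff by (auto simp: not_less[symmetric])
  then show ?thesis by (simp add: test_functions_def smooth_def)
qed

lemma linear_functional_repr:
  fixes L :: "'a::euclidean_space \<Rightarrow> real"
  assumes "linear L"
  shows "L v = v \<bullet> (\<Sum>b\<in>Basis. L b *\<^sub>R b)"
proof -
  have "L v = L (\<Sum>b\<in>Basis. (v \<bullet> b) *\<^sub>R b)" by (simp add: euclidean_representation)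
  also have "\<dots> = (\<Sum>b\<in>Basis. (v \<bullet> b) * L b)"
    using assms by (simp add: linear_sum linear_scale)
  finally show ?thesis by (simp add: inner_sum_right mult.commute)
qed

lemma gradient_unique:
  assumes "(\<phi> has_derivative (\<lambda>v. v \<bullet> D)) (at x)"
  shows "gradient \<phi> x = D"
  unfolding gradient_def gderiv_def
proof (rule the_equality[where P="\<lambda>D. (\<phi> has_derivative (\<lambda>v. v \<bullet> D)) (at x)", OF assms])
  fix D' assume "(\<phi> has_derivative (\<lambda>v. v \<bullet> D')) (at x)"
  from has_derivative_unique[OF this assms] have "\<And>v. v \<bullet> D' = v \<bullet> D" by metis
  then show "D' = D" by (metis inner_commute vector_eq_rdot)
qed

lemma gradient_has_derivative:
  assumes "\<phi> differentiable (at x)"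
  shows "(\<phi> has_derivative (\<lambda>v. v \<bullet> gradient \<phi> x)) (at x)"
    "frechet_derivative \<phi> (at x) v = v \<bullet> gradient \<phi> x"
proof -
  define D where "D = (\<Sum>b\<in>Basis. frechet_derivative \<phi> (at x) b *\<^sub>R b)"
  have f: "(\<phi> has_derivative frechet_derivative \<phi> (at x)) (at x)"
    using assms by (rule has_derivative_frechet)
  then have e: "frechet_derivative \<phi> (at x) = (\<lambda>v. v \<bullet> D)"
    unfolding D_def by (intro ext linear_functional_repr has_derivative_linear)
  with f show "(\<phi> has_derivative (\<lambda>v. v \<bullet> gradient \<phi> x)) (at x)"
    "frechet_derivative \<phi> (at x) v = v \<bullet> gradient \<phi> x"
    using gradient_unique[of \<phi> D x] by auto
qed

lemma test_gradients_add:
  assumes "\<zeta>\<^sub>1 \<in> test_gradients" "\<zeta>\<^sub>2 \<in> test_gradients"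
  shows "(\<lambda>x. \<zeta>\<^sub>1 x + \<zeta>\<^sub>2 x) \<in> test_gradients"
proof -
  obtain f g where f: "f \<in> test_functions" "\<zeta>\<^sub>1 = gradient f" and g: "g \<in> test_functions" "\<zeta>\<^sub>2 = gradient g"
    using assms by (auto simp: test_gradients_def)
  obtain R1 R2 where "\<And>x. R1 < norm x \<Longrightarrow> f x = 0" "\<And>x. R2 < norm x \<Longrightarrow> g x = 0"
    using f g by (auto simp: test_functions_iff)
  then have "(\<lambda>x. f x + g x) \<in> test_functions"
    using f g by (auto simp: test_functions_iff intro!: smooth_add exI[of _ "max R1 R2"])
  moreover have "gradient (\<lambda>x. f x + g x) = (\<lambda>x. \<zeta>\<^sub>1 x + \<zeta>\<^sub>2 x)"
  proof
    fix x
    have "((\<lambda>x. f x + g x) has_derivative (\<lambda>v. v \<bullet> gradient f x + v \<bullet> gradient g x)) (at x)"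
      using f g by (intro has_derivative_add gradient_has_derivative) (auto simp: test_functions_iff smoothD)
    then show "gradient (\<lambda>x. f x + g x) x = \<zeta>\<^sub>1 x + \<zeta>\<^sub>2 x"
      using f g by (intro gradient_unique) (simp add: inner_add_right)
  qed
  ultimately show ?thesis unfolding test_gradients_def by (metis imageI)
qed

lemma test_gradients_scale:
  assumes "\<zeta> \<in> test_gradients"
  shows "(\<lambda>x. c *\<^sub>R \<zeta> x) \<in> test_gradients"
proof -
  obtain f where f: "f \<in> test_functions" "\<zeta> = gradient f"
    using assms by (auto simp: test_gradients_def)
  then have "(\<lambda>x. c * f x) \<in> test_functions"
    by (auto simp: test_functions_iff intro!: smooth_mult smooth_const)
  moreover have "gradient (\<lambda>x. c * f x) = (\<lambda>x. c *\<^sub>R \<zeta> x)"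
  proof
    fix x
    have "((\<lambda>x. c * f x) has_derivative (\<lambda>v. c * (v \<bullet> gradient f x))) (at x)"
      using f by (intro has_derivative_mult_right gradient_has_derivative) (auto simp: test_functions_iff smoothD)
    then show "gradient (\<lambda>x. c * f x) x = c *\<^sub>R \<zeta> x"
      using f by (intro gradient_unique) simp
  qed
  ultimately show ?thesis unfolding test_gradients_def by (metis imageI)
qed

lemma compact_support_deriv:
  assumes f: "smooth f" and z: "\<And>x. R < norm x \<Longrightarrow> f x = 0" and x: "R < norm x"
  shows "frechet_derivative f (at x) v = 0"
proof -
  have "((\<lambda>_. 0) has_derivative (\<lambda>_. 0)) (at x)" by simp
  then have "(f has_derivative (\<lambda>_. 0)) (at x)"
    by (rule has_derivative_transform_within_open[where s="{x. R < norm x}"])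
       (use x z in \<open>auto intro!: open_Collect_less continuous_intros\<close>)
  then show ?thesis using frechet_derivative_at by metis
qed

lemma compact_support_bounded:
  fixes f :: "'a::euclidean_space \<Rightarrow> real"
  assumes "continuous_on UNIV f" and z: "\<And>x. R < norm x \<Longrightarrow> f x = 0"
  shows "\<exists>B\<ge>0. \<forall>x. \<bar>f x\<bar> \<le> B"
proof -
  have "compact (f ` cball 0 R)"
    using assms(1) by (intro compact_continuous_image) (auto intro: continuous_on_subset)
  then obtain B where B: "\<And>y. y \<in> f ` cball 0 R \<Longrightarrow> norm y \<le> B" "B > 0"
    by (meson compact_imp_bounded bounded_pos)
  have "\<bar>f x\<bar> \<le> B" for x
    using B(1)[of "f x"] B(2) z[of x] by (cases "R < norm x") auto
  with B(2) show ?thesis by (meson less_imp_le)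
qed

lemma compact_support_deriv_bounded:
  fixes f :: "'a::euclidean_space \<Rightarrow> real"
  assumes f: "smooth f" and z: "\<And>x. R < norm x \<Longrightarrow> f x = 0"
  obtains L where "L \<ge> 0" "\<And>x v. \<bar>frechet_derivative f (at x) v\<bar> \<le> L * norm v"
proof -
  have "\<exists>B. B \<ge> 0 \<and> (\<forall>x. \<bar>frechet_derivative f (at x) v\<bar> \<le> B)" for v
    by (rule compact_support_bounded[OF smoothD(4)[OF smoothD(3)[OF f]], where R=R])
       (rule compact_support_deriv[OF f], rule z)
  then obtain B where B: "\<And>v. B v \<ge> 0" "\<And>v x. \<bar>frechet_derivative f (at x) v\<bar> \<le> B v" by metis
  have "\<bar>frechet_derivative f (at x) v\<bar> \<le> (\<Sum>b\<in>Basis. B b) * norm v" for x v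
  proof -
    have "frechet_derivative f (at x) v = (\<Sum>b\<in>Basis. (v \<bullet> b) * frechet_derivative f (at x) b)"
      using linear_functional_repr[OF has_derivative_linear[OF smoothD(1)[OF f]], of x v]
      by (simp add: inner_sum_right mult.commute)
    also have "\<bar>\<dots>\<bar> \<le> (\<Sum>b\<in>Basis. norm v * B b)"
      by (intro sum_abs[THEN order_trans] sum_mono) (auto simp: abs_mult B Basis_le_norm intro!: mult_mono)
    finally show ?thesis by (simp add: sum_distrib_left mult.commute)
  qed
  moreover have "0 \<le> (\<Sum>b\<in>Basis. B b)" using B by (intro sum_nonneg) auto
  ultimately show ?thesis using that by blast
qed

text \<open>The mean value theorem is applied to the increment of \<open>\<phi>\<close> in direction \<open>w\<close>, as a function along
  \<open>v\<close>, and then to the derivative in direction \<open>v\<close>, as a function along \<open>w\<close>.\<close>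

lemma mean_value_second_difference:
  fixes \<phi> :: "'a::euclidean_space \<Rightarrow> real"
  assumes s: "smooth \<phi>" and h: "h > 0"
  shows "\<exists>p. norm (p - x) \<le> h * (norm v + norm w) \<and>
    \<phi> (x + h *\<^sub>R v + h *\<^sub>R w) - \<phi> (x + h *\<^sub>R v) - \<phi> (x + h *\<^sub>R w) + \<phi> x
      = h\<^sup>2 * frechet_derivative (\<lambda>y. frechet_derivative \<phi> (at y) v) (at p) w"
proof -
  define A where "A y = frechet_derivative \<phi> (at y) v" for y
  have sA: "smooth A" unfolding A_def by (rule smoothD(3)[OF s])
  have d: "((\<lambda>t. f (c + t *\<^sub>R u)) has_real_derivative frechet_derivative f (at (c + t *\<^sub>R u)) u) (at t)"
    if "smooth f" for f c u t
  proof -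
    have "((\<lambda>t. f (c + t *\<^sub>R u)) has_derivative (\<lambda>r. frechet_derivative f (at (c + t *\<^sub>R u)) (r *\<^sub>R u))) (at t)"
      by (rule has_derivative_compose[OF _ smoothD(1)[OF that], of "\<lambda>t. c + t *\<^sub>R u" "\<lambda>r. r *\<^sub>R u"])
         (auto intro!: derivative_eq_intros)
    then show ?thesis
      by (rule has_derivative_imp_has_field_derivative)
         (simp add: linear_scale[OF has_derivative_linear[OF smoothD(1)[OF that]]])
  qed
  have d1: "((\<lambda>t. \<phi> ((x + h *\<^sub>R w) + t *\<^sub>R v) - \<phi> (x + t *\<^sub>R v)) has_real_derivative
      A ((x + h *\<^sub>R w) + t *\<^sub>R v) - A (x + t *\<^sub>R v)) (at t)" for t
    unfolding A_def by (intro DERIV_diff d s)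
  from MVT2[OF h d1] obtain t where t: "0 < t" "t < h"
    "\<phi> (x + h *\<^sub>R w + h *\<^sub>R v) - \<phi> (x + h *\<^sub>R v) - (\<phi> (x + h *\<^sub>R w + 0 *\<^sub>R v) - \<phi> (x + 0 *\<^sub>R v))
      = (h - 0) * (A (x + h *\<^sub>R w + t *\<^sub>R v) - A (x + t *\<^sub>R v))" by blast
  from MVT2[OF h d[OF sA, of "x + t *\<^sub>R v" w]] obtain r where r: "0 < r" "r < h"
    "A (x + t *\<^sub>R v + h *\<^sub>R w) - A (x + t *\<^sub>R v + 0 *\<^sub>R w)
      = (h - 0) * frechet_derivative A (at (x + t *\<^sub>R v + r *\<^sub>R w)) w" by blast
  show ?thesis
  proof (intro exI[of _ "x + t *\<^sub>R v + r *\<^sub>R w"] conjI)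
    have "norm (t *\<^sub>R v + r *\<^sub>R w) \<le> t * norm v + r * norm w"
      using norm_triangle_ineq[of "t *\<^sub>R v" "r *\<^sub>R w"] t r by simp
    also have "\<dots> \<le> h * norm v + h * norm w"
      using t r by (intro add_mono mult_right_mono) auto
    finally show "norm (x + t *\<^sub>R v + r *\<^sub>R w - x) \<le> h * (norm v + norm w)"
      by (simp add: algebra_simps)
    show "\<phi> (x + h *\<^sub>R v + h *\<^sub>R w) - \<phi> (x + h *\<^sub>R v) - \<phi> (x + h *\<^sub>R w) + \<phi> x
      = h\<^sup>2 * frechet_derivative (\<lambda>y. frechet_derivative \<phi> (at y) v) (at (x + t *\<^sub>R v + r *\<^sub>R w)) w"
      using t(3) r(3) unfolding A_def[symmetric] by (simp add: add_ac power2_eq_square)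
  qed
qed

text \<open>The second difference is symmetric in the two directions, so that both mixed derivatives take the
  same values at points arbitrarily close to \<open>x\<close>.\<close>

lemma second_derivative_symmetric:
  fixes \<phi> :: "'a::euclidean_space \<Rightarrow> real"
  assumes s: "smooth \<phi>"
  shows "frechet_derivative (\<lambda>y. frechet_derivative \<phi> (at y) v) (at x) w
    = frechet_derivative (\<lambda>y. frechet_derivative \<phi> (at y) w) (at x) v"
proof -
  define B where "B p = frechet_derivative (\<lambda>y. frechet_derivative \<phi> (at y) v) (at p) w" for p
  define C where "C p = frechet_derivative (\<lambda>y. frechet_derivative \<phi> (at y) w) (at p) v" for p
  have ex: "\<exists>p q. norm (p - x) \<le> h * (norm v + norm w) \<and> norm (q - x) \<le> h * (norm v + norm w) \<and> B p = C q"
    if h: "h > 0" for h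
  proof -
    obtain p where p: "norm (p - x) \<le> h * (norm v + norm w)"
      "\<phi> (x + h *\<^sub>R v + h *\<^sub>R w) - \<phi> (x + h *\<^sub>R v) - \<phi> (x + h *\<^sub>R w) + \<phi> x = h\<^sup>2 * B p"
      using mean_value_second_difference[OF s h, of x v w] unfolding B_def by blast
    obtain q where q: "norm (q - x) \<le> h * (norm w + norm v)"
      "\<phi> (x + h *\<^sub>R w + h *\<^sub>R v) - \<phi> (x + h *\<^sub>R w) - \<phi> (x + h *\<^sub>R v) + \<phi> x = h\<^sup>2 * C q"
      using mean_value_second_difference[OF s h, of x w v] unfolding C_def by blast
    have "x + h *\<^sub>R w + h *\<^sub>R v = x + h *\<^sub>R v + h *\<^sub>R w" by (simp add: add_ac)
    then have "\<phi> (x + h *\<^sub>R w + h *\<^sub>R v) = \<phi> (x + h *\<^sub>R v + h *\<^sub>R w)" by (rule arg_cong)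
    then have "h\<^sup>2 * B p = h\<^sup>2 * C q" using p(2) q(2) by linarith
    then show ?thesis using p(1) q(1) h by (auto simp: add_ac)
  qed
  have "\<exists>p q. norm (p - x) \<le> 1 / Suc n * (norm v + norm w) \<and>
      norm (q - x) \<le> 1 / Suc n * (norm v + norm w) \<and> B p = C q" for n :: nat
    by (rule ex) simp
  then obtain p q where pq: "\<And>n::nat. norm (p n - x) \<le> 1 / Suc n * (norm v + norm w)"
    "\<And>n::nat. norm (q n - x) \<le> 1 / Suc n * (norm v + norm w)" "\<And>n. B (p n) = C (q n)"
    by metis
  have "(\<lambda>n. 1 / Suc n * (norm v + norm w)) \<longlonglongrightarrow> 0"
    using LIMSEQ_inverse_real_of_nat by (intro tendsto_mult_left_zero) (simp add: inverse_eq_divide)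
  note null = this
  have lim: "p \<longlonglongrightarrow> x"
    by (rule LIM_zero_cancel, rule Lim_null_comparison[OF _ null]) (use pq(1) in auto)
  have lim': "q \<longlonglongrightarrow> x"
    by (rule LIM_zero_cancel, rule Lim_null_comparison[OF _ null]) (use pq(2) in auto)
  have cont: "isCont B x" "isCont C x"
    using smoothD(4)[OF smoothD(3)[OF smoothD(3)[OF s]]] unfolding B_def C_def
    by (auto simp: continuous_on_eq_continuous_at)
  have "(\<lambda>n. B (p n)) \<longlonglongrightarrow> B x" "(\<lambda>n. C (q n)) \<longlonglongrightarrow> C x"
    using isCont_tendsto_compose[OF cont(1) lim] isCont_tendsto_compose[OF cont(2) lim'] by auto
  then have "B x = C x" using pq(3) LIMSEQ_unique by simp
  then show ?thesis by (simp add: B_def C_def)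
qed

lemma test_gradientD:
  fixes \<zeta> :: "'a::euclidean_space \<Rightarrow> 'a"
  assumes "\<zeta> \<in> test_gradients"
  obtains \<phi> R where "smooth \<phi>" "\<And>x. R < norm x \<Longrightarrow> \<phi> x = 0"
    "\<And>x. (\<phi> has_derivative (\<lambda>v. v \<bullet> \<zeta> x)) (at x)" "\<And>x. R < norm x \<Longrightarrow> \<zeta> x = 0"
    "\<And>v. smooth (\<lambda>x. \<zeta> x \<bullet> v)" "\<And>x v. frechet_derivative \<phi> (at x) v = \<zeta> x \<bullet> v"
proof -
  obtain \<phi> where \<phi>: "\<phi> \<in> test_functions" and \<zeta>: "\<zeta> = gradient \<phi>"
    using assms by (auto simp: test_gradients_def)
  obtain R where s: "smooth \<phi>" and R: "\<And>x. R < norm x \<Longrightarrow> \<phi> x = 0"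
    using \<phi> by (auto simp: test_functions_iff)
  have f: "frechet_derivative \<phi> (at x) v = \<zeta> x \<bullet> v" for x v
    using gradient_has_derivative(2)[OF smoothD(2)[OF s]] by (simp add: \<zeta> inner_commute)
  show ?thesis
  proof (rule that[of \<phi> R])
    show "(\<phi> has_derivative (\<lambda>v. v \<bullet> \<zeta> x)) (at x)" for x
      unfolding \<zeta> by (rule gradient_has_derivative(1)[OF smoothD(2)[OF s]])
    show "\<zeta> x = 0" if "R < norm x" for x
      using compact_support_deriv[OF s, of R x "\<zeta> x"] R that f by simp
    show "smooth (\<lambda>x. \<zeta> x \<bullet> v)" for v
      using smoothD(3)[OF s, of v] by (simp add: f)
  qed (use s R f in auto)
qed

lemma vector_function_has_derivative:
  fixes \<zeta> :: "'a::euclidean_space \<Rightarrow> 'a"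
  assumes s: "\<And>v. smooth (\<lambda>x. \<zeta> x \<bullet> v)"
  shows "(\<zeta> has_derivative frechet_derivative \<zeta> (at x)) (at x)"
    "frechet_derivative \<zeta> (at x) w \<bullet> v = frechet_derivative (\<lambda>x. \<zeta> x \<bullet> v) (at x) w"
proof -
  have "(\<zeta> has_derivative (\<lambda>w. \<Sum>b\<in>Basis. frechet_derivative (\<lambda>x. \<zeta> x \<bullet> b) (at x) w *\<^sub>R b)) (at x)"
    by (subst has_derivative_componentwise_within)
       (auto simp: inner_sum_left_Basis smoothD(1)[OF s])
  then have "\<zeta> differentiable (at x)" by (auto simp: differentiable_def)
  then show d: "(\<zeta> has_derivative frechet_derivative \<zeta> (at x)) (at x)" by (rule has_derivative_frechet)
  have "((\<lambda>x. \<zeta> x \<bullet> v) has_derivative (\<lambda>w. frechet_derivative \<zeta> (at x) w \<bullet> v)) (at x)"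
    by (rule has_derivative_inner_left[OF d])
  then show "frechet_derivative \<zeta> (at x) w \<bullet> v = frechet_derivative (\<lambda>x. \<zeta> x \<bullet> v) (at x) w"
    using frechet_derivative_at by metis
qed

text \<open>The quantitative information about a test gradient \<open>\<zeta> = \<nabla>\<phi>\<close> on which the estimates below rest:
  bounds, a Lipschitz constant, and Taylor's formula for the potential \<open>\<phi>\<close>.\<close>

lemma test_gradient_facts:
  fixes \<zeta> :: "'a::euclidean_space \<Rightarrow> 'a"
  assumes "\<zeta> \<in> test_gradients"
  obtains \<phi> B L where "B \<ge> 0" "L > 0" "continuous_on UNIV \<phi>" "\<And>x. \<bar>\<phi> x\<bar> \<le> B" "\<And>x. norm (\<zeta> x) \<le> B"
    "continuous_on UNIV \<zeta>"
    "\<And>x y. norm (\<zeta> x - \<zeta> y) \<le> L * norm (x - y)"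
    "\<And>x y. \<bar>\<phi> y - \<phi> x - \<zeta> x \<bullet> (y - x)\<bar> \<le> L * (norm (y - x))\<^sup>2"
    "\<And>x. (\<zeta> has_derivative frechet_derivative \<zeta> (at x)) (at x)"
proof -
  obtain \<phi> R where s: "smooth \<phi>" and R: "\<And>x. R < norm x \<Longrightarrow> \<phi> x = 0"
    and d: "\<And>x. (\<phi> has_derivative (\<lambda>v. v \<bullet> \<zeta> x)) (at x)" and R': "\<And>x. R < norm x \<Longrightarrow> \<zeta> x = 0"
    and sv: "\<And>v. smooth (\<lambda>x. \<zeta> x \<bullet> v)"
    by (rule test_gradientD[OF assms]) blast
  note hd = vector_function_has_derivative[OF sv]
  have c: "continuous_on UNIV \<zeta>"
    by (simp add: continuous_on_eq_continuous_at has_derivative_continuous[OF hd(1)])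
  obtain B1 where B1: "B1 \<ge> 0" "\<And>x. \<bar>\<phi> x\<bar> \<le> B1"
    using compact_support_bounded[of \<phi> R] smoothD(4)[OF s] R by auto
  obtain B2 where B2: "B2 \<ge> 0" "\<And>x. \<bar>norm (\<zeta> x)\<bar> \<le> B2"
    using compact_support_bounded[of "\<lambda>x. norm (\<zeta> x)" R] c R' continuous_on_norm[OF c] by auto
  have "\<exists>K. K \<ge> 0 \<and> (\<forall>x v. \<bar>frechet_derivative (\<lambda>x. \<zeta> x \<bullet> b) (at x) v\<bar> \<le> K * norm v)" for b
    by (rule compact_support_deriv_bounded[OF sv, of R b]) (use R' in auto)
  then obtain K where K: "\<And>b. K b \<ge> 0" "\<And>b x v. \<bar>frechet_derivative (\<lambda>x. \<zeta> x \<bullet> b) (at x) v\<bar> \<le> K b * norm v"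
    by metis
  define L where "L = (\<Sum>b\<in>Basis. K b) + 1"
  have L: "L > 0" using K by (simp add: L_def add_nonneg_pos sum_nonneg)
  have J: "norm (frechet_derivative \<zeta> (at x) v) \<le> L * norm v" for x v
  proof -
    have "norm (frechet_derivative \<zeta> (at x) v) \<le> (\<Sum>b\<in>Basis. \<bar>frechet_derivative \<zeta> (at x) v \<bullet> b\<bar>)"
      by (rule norm_le_l1)
    also have "\<dots> \<le> (\<Sum>b\<in>Basis. K b * norm v)" by (intro sum_mono) (simp add: hd K)
    also have "\<dots> \<le> L * norm v" by (simp add: L_def sum_distrib_right distrib_right)
    finally show ?thesis .
  qed
  have lip: "norm (\<zeta> x - \<zeta> y) \<le> L * norm (x - y)" for x y
    by (rule differentiable_bound[of UNIV \<zeta> "\<lambda>x. frechet_derivative \<zeta> (at x)"])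
       (use hd J L in \<open>auto intro!: onorm_le simp: mult.commute\<close>)
  have tay: "\<bar>\<phi> y - \<phi> x - \<zeta> x \<bullet> (y - x)\<bar> \<le> L * (norm (y - x))\<^sup>2" for x y
  proof -
    have "norm ((\<phi> y - y \<bullet> \<zeta> x) - (\<phi> x - x \<bullet> \<zeta> x)) \<le> (L * norm (y - x)) * norm (y - x)"
    proof (rule differentiable_bound[of "closed_segment x y" "\<lambda>z. \<phi> z - z \<bullet> \<zeta> x" "\<lambda>z v. v \<bullet> \<zeta> z - v \<bullet> \<zeta> x"])
      fix z assume z: "z \<in> closed_segment x y"
      show "((\<lambda>z. \<phi> z - z \<bullet> \<zeta> x) has_derivative (\<lambda>v. v \<bullet> \<zeta> z - v \<bullet> \<zeta> x)) (at z within closed_segment x y)"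
        by (intro has_derivative_diff has_derivative_at_withinI[OF d] has_derivative_inner_left)
           (rule derivative_eq_intros refl)+
      have "\<bar>v \<bullet> \<zeta> z - v \<bullet> \<zeta> x\<bar> \<le> (L * norm (y - x)) * norm v" for v
      proof -
        have "\<bar>v \<bullet> \<zeta> z - v \<bullet> \<zeta> x\<bar> \<le> norm v * norm (\<zeta> z - \<zeta> x)"
          by (metis Cauchy_Schwarz_ineq2 inner_diff_right)
        also have "\<dots> \<le> norm v * (L * norm (z - x))" using lip by (intro mult_left_mono) auto
        also have "\<dots> \<le> norm v * (L * norm (y - x))"
          using segment_bound(1)[OF z] L by (intro mult_left_mono) (auto simp: norm_minus_commute)
        finally show ?thesis by (simp only: mult.commute mult.left_commute)
      qed
      then show "onorm (\<lambda>v. v \<bullet> \<zeta> z - v \<bullet> \<zeta> x) \<le> L * norm (y - x)" by (intro onorm_le) auto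
    qed auto
    moreover have "\<phi> y - \<phi> x - \<zeta> x \<bullet> (y - x) = (\<phi> y - y \<bullet> \<zeta> x) - (\<phi> x - x \<bullet> \<zeta> x)"
      by (simp add: inner_diff_right inner_commute)
    ultimately show ?thesis by (simp add: power2_eq_square mult.assoc)
  qed
  show ?thesis
  proof (rule that[of "max B1 B2" L \<phi>])
    show "\<bar>\<phi> x\<bar> \<le> max B1 B2" "norm (\<zeta> x) \<le> max B1 B2" for x
      using B1(2)[of x] B2(2)[of x] by auto
  qed (use B1 L smoothD(4)[OF s] c lip tay hd in auto)
qed

text \<open>The acceleration term \<open>\<nabla>\<zeta> \<zeta>\<close> of the Hessian is a test gradient: for \<open>\<zeta> = \<nabla>\<phi>\<close> it is the
  gradient of \<open>|\<zeta>|\<^sup>2/2\<close>, because the second derivative of \<open>\<phi>\<close> is symmetric.\<close>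

lemma acceleration_test_gradient:
  fixes \<zeta> :: "'a::euclidean_space \<Rightarrow> 'a"
  assumes "\<zeta> \<in> test_gradients"
  shows "(\<lambda>x. frechet_derivative \<zeta> (at x) (\<zeta> x)) \<in> test_gradients"
proof -
  obtain \<phi> R where s: "smooth \<phi>" and R': "\<And>x. R < norm x \<Longrightarrow> \<zeta> x = 0"
    and sv: "\<And>v. smooth (\<lambda>x. \<zeta> x \<bullet> v)" and f: "\<And>x v. frechet_derivative \<phi> (at x) v = \<zeta> x \<bullet> v"
    by (rule test_gradientD[OF assms]) blast
  note hd = vector_function_has_derivative[OF sv]
  have sym: "frechet_derivative \<zeta> (at x) v \<bullet> w = frechet_derivative \<zeta> (at x) w \<bullet> v" for x v w
    using second_derivative_symmetric[OF s, of w x v] by (simp add: f hd(2))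
  define \<alpha> where "\<alpha> x = (\<Sum>b\<in>Basis. (\<zeta> x \<bullet> b) * (\<zeta> x \<bullet> b)) * (1/2)" for x
  have a: "\<alpha> x = (\<zeta> x \<bullet> \<zeta> x) * (1/2)" for x
    unfolding \<alpha>_def by (subst (3) euclidean_inner) simp
  have "smooth \<alpha>" unfolding \<alpha>_def by (intro smooth_mult smooth_sum sv smooth_const)
  then have "\<alpha> \<in> test_functions"
    using R' by (auto simp: test_functions_iff a intro!: exI[of _ R])
  moreover have "gradient \<alpha> = (\<lambda>x. frechet_derivative \<zeta> (at x) (\<zeta> x))"
  proof
    fix x
    have "(\<alpha> has_derivative (\<lambda>v. (\<zeta> x \<bullet> frechet_derivative \<zeta> (at x) v + frechet_derivative \<zeta> (at x) v \<bullet> \<zeta> x) * (1/2))) (at x)"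
      unfolding a by (intro has_derivative_mult_left has_derivative_inner hd)
    moreover have "(\<zeta> x \<bullet> frechet_derivative \<zeta> (at x) v + frechet_derivative \<zeta> (at x) v \<bullet> \<zeta> x) * (1/2)
        = v \<bullet> frechet_derivative \<zeta> (at x) (\<zeta> x)" for v
      using sym[of x v "\<zeta> x"] by (simp add: inner_commute)
    ultimately show "gradient \<alpha> x = frechet_derivative \<zeta> (at x) (\<zeta> x)"
      by (intro gradient_unique) simp
  qed
  ultimately show ?thesis unfolding test_gradients_def by (metis imageI)
qed

lemma finite_separation:
  fixes S :: "'a::euclidean_space set"
  assumes "finite S"
  shows "\<exists>d>0. \<forall>p\<in>S. \<forall>q\<in>S. p \<noteq> q \<longrightarrow> d \<le> norm (p - q)"
proof -
  define D where "D = insert 1 ((\<lambda>(p, q). norm (p - q)) ` (S \<times> S) - {0})"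
  have f: "finite D" "D \<noteq> {}" using assms by (auto simp: D_def)
  have "Min D > 0" using f by (subst Min_gr_iff) (auto simp: D_def)
  moreover have "Min D \<le> norm (p - q)" if "p \<in> S" "q \<in> S" "p \<noteq> q" for p q
    using f that by (intro Min_le) (auto simp: D_def)
  ultimately show ?thesis by blast
qed

text \<open>The potential is a sum of linear functions, each multiplied by a bump around one of the points that
  vanishes near the other points.\<close>

lemma locally_constant_test_gradient:
  fixes S :: "'a::euclidean_space set"
  assumes S: "finite S"
  obtains \<zeta> r where "\<zeta> \<in> test_gradients" "r > 0" "\<And>p x. p \<in> S \<Longrightarrow> norm (x - p) < r \<Longrightarrow> \<zeta> x = v p"
proof -
  obtain d where d: "d > 0" "\<And>p q. p \<in> S \<Longrightarrow> q \<in> S \<Longrightarrow> p \<noteq> q \<Longrightarrow> d \<le> norm (p - q)"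
    using finite_separation[OF S] by blast
  define r where "r = d / 3"
  have r: "r > 0" using d by (simp add: r_def)
  have "\<exists>\<beta>. smooth \<beta> \<and> (\<forall>x. norm (x - p) \<le> r \<longrightarrow> \<beta> x = 1) \<and> (\<forall>x. 2 * r \<le> norm (x - p) \<longrightarrow> \<beta> x = 0)"
    for p :: 'a by (rule smooth_bump[OF r, of p]) blast
  then obtain \<beta> where \<beta>: "\<And>p::'a. smooth (\<beta> p)" "\<And>p x. norm (x - p) \<le> r \<Longrightarrow> \<beta> p x = 1"
    "\<And>p x. 2 * r \<le> norm (x - p) \<Longrightarrow> \<beta> p x = 0" by metis
  define \<phi> where "\<phi> x = (\<Sum>p\<in>S. \<beta> p x * ((x - p) \<bullet> v p))" for x
  obtain N where N: "\<And>p. p \<in> S \<Longrightarrow> norm p \<le> N" using finite_imp_bounded[OF S] bounded_iff by blast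
  have "\<phi> x = 0" if "N + 2 * r < norm x" for x
    unfolding \<phi>_def
  proof (intro sum.neutral ballI)
    fix p assume "p \<in> S"
    have "norm x \<le> norm (x - p) + norm p" by (metis diff_add_cancel norm_triangle_ineq)
    then have "2 * r \<le> norm (x - p)" using that N[OF \<open>p \<in> S\<close>] by linarith
    then show "\<beta> p x * ((x - p) \<bullet> v p) = 0" by (simp add: \<beta>)
  qed
  moreover have "smooth \<phi>" unfolding \<phi>_def by (intro smooth_sum smooth_mult \<beta> smooth_inner)
  ultimately have tf: "\<phi> \<in> test_functions" by (auto simp: test_functions_iff)
  have near: "\<phi> x = (x - p) \<bullet> v p" if p: "p \<in> S" and x: "norm (x - p) < r" for p x
  proof -
    have "\<beta> q x * ((x - q) \<bullet> v q) = 0" if "q \<in> S - {p}" for q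
    proof -
      have "d \<le> norm (p - q)" using d(2) p that by auto
      moreover have "norm (p - q) \<le> norm (x - p) + norm (x - q)"
        using norm_triangle_ineq[of "p - x" "x - q"] by (simp add: norm_minus_commute)
      ultimately show ?thesis using x by (simp add: \<beta> r_def)
    qed
    then have "(\<Sum>q\<in>S - {p}. \<beta> q x * ((x - q) \<bullet> v q)) = 0" by (intro sum.neutral) blast
    then have "\<phi> x = \<beta> p x * ((x - p) \<bullet> v p)"
      unfolding \<phi>_def using S p by (subst sum.remove[of S p]) auto
    then show ?thesis using x by (simp add: \<beta>)
  qed
  have g: "gradient \<phi> x = v p" if p: "p \<in> S" and x: "norm (x - p) < r" for p x
  proof (rule gradient_unique)
    have "((\<lambda>x. (x - p) \<bullet> v p) has_derivative (\<lambda>w. w \<bullet> v p)) (at x)"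
      by (auto intro!: derivative_eq_intros)
    then show "(\<phi> has_derivative (\<lambda>w. w \<bullet> v p)) (at x)"
      by (rule has_derivative_transform_within_open[where s="{x. norm (x - p) < r}"])
         (use x near[OF p] in \<open>auto intro!: open_Collect_less continuous_intros\<close>)
  qed
  show ?thesis by (rule that[of "gradient \<phi>" r]) (use tf r g in \<open>auto simp: test_gradients_def\<close>)
qed

section \<open>First-order calculus on the Wasserstein space\<close>

lemma P2_distr_id: "\<mu> \<in> P2 \<Longrightarrow> distr \<mu> borel (\<lambda>x. x) = \<mu>"
  by (rule distr_id2) (simp add: P2D)

lemma test_gradient_sqint:
  assumes "\<zeta> \<in> test_gradients" "\<mu> \<in> P2"
  shows "\<zeta> \<in> sqint \<mu>" "\<zeta> \<in> borel_measurable borel"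
proof -
  obtain B where f: "\<And>x. norm (\<zeta> x) \<le> B" "continuous_on UNIV \<zeta>" by (rule test_gradient_facts[OF assms(1)]) blast
  interpret prob_space \<mu> using assms P2D by auto
  show m: "\<zeta> \<in> borel_measurable borel" using f(2) by (rule borel_measurable_continuous_onI)
  show "\<zeta> \<in> sqint \<mu>"
    by (rule sqint_bounded[OF _ f(1)]) (use m in \<open>simp add: P2_measurable_iff[OF assms(2)]\<close>)
qed

text \<open>The equation \<open>x + s \<zeta>(x) = y\<close> is a fixed point problem for a contraction; its solution depends on
  \<open>y\<close> in a Lipschitz way.\<close>

lemma borel_inverse_of_perturbation:
  fixes \<zeta> :: "'a::euclidean_space \<Rightarrow> 'a"
  assumes lip: "\<And>x y. norm (\<zeta> x - \<zeta> y) \<le> L * norm (x - y)" and s: "\<bar>s\<bar> * L < 1" and L: "L > 0"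
  obtains S where "S \<in> borel_measurable borel" "\<And>x. S (x + s *\<^sub>R \<zeta> x) = x" "\<And>y. S y + s *\<^sub>R \<zeta> (S y) = y"
proof -
  have c: "norm (s *\<^sub>R \<zeta> x - s *\<^sub>R \<zeta> y) \<le> (\<bar>s\<bar> * L) * norm (x - y)" for x y
    using lip[of x y] mult_left_mono[OF lip[of x y], of "\<bar>s\<bar>"] by (simp flip: scaleR_diff_right)
  have "\<exists>!x. y - s *\<^sub>R \<zeta> x = x" for y
    by (rule banach_fix_type[of "\<bar>s\<bar> * L"])
       (use s L c in \<open>auto simp: dist_norm norm_minus_commute\<close>)
  then have "\<exists>x. x + s *\<^sub>R \<zeta> x = y" for y by (metis diff_add_cancel)
  then obtain S where S: "\<And>y. S y + s *\<^sub>R \<zeta> (S y) = y" by metis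
  have expand: "(1 - \<bar>s\<bar> * L) * norm (x - y) \<le> norm ((x + s *\<^sub>R \<zeta> x) - (y + s *\<^sub>R \<zeta> y))" for x y
  proof -
    have "norm (x - y) \<le> norm ((x + s *\<^sub>R \<zeta> x) - (y + s *\<^sub>R \<zeta> y)) + norm (s *\<^sub>R \<zeta> x - s *\<^sub>R \<zeta> y)"
      using norm_triangle_ineq4[of "(x + s *\<^sub>R \<zeta> x) - (y + s *\<^sub>R \<zeta> y)" "s *\<^sub>R \<zeta> x - s *\<^sub>R \<zeta> y"]
      by (simp add: algebra_simps)
    then show ?thesis using c[of x y] by (simp add: algebra_simps)
  qed
  have inv: "S (x + s *\<^sub>R \<zeta> x) = x" for x
  proof -
    have "(1 - \<bar>s\<bar> * L) * norm (S (x + s *\<^sub>R \<zeta> x) - x) \<le> 0"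
      using expand[of "S (x + s *\<^sub>R \<zeta> x)" x] S by simp
    then show ?thesis using s by (simp add: mult_le_0_iff)
  qed
  have "norm (S x - S y) \<le> 1 / (1 - \<bar>s\<bar> * L) * norm (x - y)" for x y
    using expand[of "S x" "S y"] S s by (simp add: field_simps)
  then have "(1 / (1 - \<bar>s\<bar> * L))-lipschitz_on UNIV S"
    using s by (intro lipschitz_onI) (auto simp: dist_norm)
  then have "continuous_on UNIV S" by (rule lipschitz_on_continuous_on)
  then have "S \<in> borel_measurable borel" by (rule borel_measurable_continuous_onI)
  with inv S show ?thesis using that by blast
qed

text \<open>Let \<open>\<zeta> = \<nabla>\<phi>\<close>, \<open>T = id + s\<zeta>\<close> and \<open>S = T\<^sup>-\<^sup>1\<close>.  Taylor's formula gives
  \<open>|x - y|\<^sup>2 \<ge> |S y - y|\<^sup>2 + |x - S y|\<^sup>2/2 - 2s(\<phi>(x) - \<phi>(S y))\<close>.  Under every coupling of \<open>\<mu>\<close> with its image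
  under \<open>T\<close> the first term on the right integrates to the cost of the graph of \<open>T\<close>, and the last one to
  zero; so an optimal coupling satisfies \<open>x = S y\<close> almost everywhere.\<close>

lemma small_displacement_optimal_unique:
  fixes \<zeta> :: "'a::euclidean_space \<Rightarrow> 'a"
  assumes "\<zeta> \<in> test_gradients"
  obtains s0 where "s0 > 0" "\<And>s \<mu> \<gamma>. \<bar>s\<bar> < s0 \<Longrightarrow> \<mu> \<in> P2 \<Longrightarrow>
    \<gamma> \<in> optimal_couplings \<mu> (distr \<mu> borel (\<lambda>x. x + s *\<^sub>R \<zeta> x)) \<Longrightarrow>
    \<gamma> = distr \<mu> borel (\<lambda>x. (x, x + s *\<^sub>R \<zeta> x))"
proof -
  obtain \<phi> B L where B: "B \<ge> 0" and L: "L > 0" and \<phi>c: "continuous_on UNIV \<phi>" and \<phi>B: "\<And>x. \<bar>\<phi> x\<bar> \<le> B"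
    and \<zeta>B: "\<And>x. norm (\<zeta> x) \<le> B" and \<zeta>c: "continuous_on UNIV \<zeta>"
    and lip: "\<And>x y. norm (\<zeta> x - \<zeta> y) \<le> L * norm (x - y)"
    and tay: "\<And>x y. \<bar>\<phi> y - \<phi> x - \<zeta> x \<bullet> (y - x)\<bar> \<le> L * (norm (y - x))\<^sup>2"
    and "\<And>x. (\<zeta> has_derivative frechet_derivative \<zeta> (at x)) (at x)"
    by (rule test_gradient_facts[OF assms]) (rule that, assumption+)
  have "\<gamma> = distr \<mu> borel (\<lambda>x. (x, x + s *\<^sub>R \<zeta> x))"
    if s: "\<bar>s\<bar> < 1 / (4 * L)" and \<mu>: "\<mu> \<in> P2"
      and opt: "\<gamma> \<in> optimal_couplings \<mu> (distr \<mu> borel (\<lambda>x. x + s *\<^sub>R \<zeta> x))" for s \<mu> \<gamma>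
  proof -
    define T where "T x = x + s *\<^sub>R \<zeta> x" for x
    define \<nu> where "\<nu> = distr \<mu> borel T"
    have sL: "\<bar>s\<bar> * L < 1 / 4" using s L by (simp add: field_simps)
    have sL1: "\<bar>s\<bar> * L < 1" using sL by simp
    obtain S where S': "S \<in> borel_measurable borel" "\<And>x. S (x + s *\<^sub>R \<zeta> x) = x" "\<And>y. S y + s *\<^sub>R \<zeta> (S y) = y"
      by (rule borel_inverse_of_perturbation[OF lip sL1 L]) blast
    then have S: "S \<in> borel_measurable borel" "\<And>x. S (T x) = x" "\<And>y. S y + s *\<^sub>R \<zeta> (S y) = y"
      by (auto simp: T_def)
    note S(1)[measurable]
    have [measurable]: "\<zeta> \<in> borel_measurable borel" "\<phi> \<in> borel_measurable borel"
      using test_gradient_sqint[OF assms \<mu>] \<phi>c by (auto intro: borel_measurable_continuous_onI)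
    have [measurable_cong]: "sets \<mu> = sets borel" using P2D[OF \<mu>] by auto
    have [measurable]: "T \<in> borel_measurable borel" unfolding T_def by measurable
    have ps: "prob_space \<mu>" using P2D[OF \<mu>] by auto
    have Ts: "T \<in> sqint \<mu>" unfolding T_def
      by (intro sqint_add P2_id_sqint[OF \<mu>] sqint_scale test_gradient_sqint assms \<mu>)
    have g: "\<gamma> \<in> couplings \<mu> \<nu>" using optimal_couplingD(1)[OF opt] by (simp add: \<nu>_def T_def[abs_def])
    interpret g: prob_space \<gamma> using couplingsD(1)[OF g] P2D by auto
    have [measurable_cong]: "sets \<gamma> = sets borel" using couplingsD(1)[OF g] P2D by auto
    have int\<nu>: "(LINT z|\<gamma>. f (snd z)) = (LINT x|\<mu>. f (T x))" if [measurable]: "f \<in> borel_measurable borel" for f :: "'a \<Rightarrow> real"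
      using coupling_marginals(2)[OF g that] by (simp add: \<nu>_def integral_distr)
    define q where "q z = (norm (fst z - S (snd z)))\<^sup>2" for z
    have Sy: "S y = y - s *\<^sub>R \<zeta> (S y)" for y using S(3)[of y] by (simp add: algebra_simps)
    have pw: "(norm (snd z - fst z))\<^sup>2 \<ge> s\<^sup>2 * (norm (\<zeta> (S (snd z))))\<^sup>2 + (1/2) * q z
        - 2 * s * (\<phi> (fst z) - \<phi> (S (snd z)))" for z
    proof -
      define x where "x = fst z" define x' where "x' = S (snd z)"
      have y: "snd z = x' + s *\<^sub>R \<zeta> x'" using S(3)[of "snd z"] by (simp add: x'_def)
      have "(norm (snd z - x))\<^sup>2 = (norm (s *\<^sub>R \<zeta> x' - (x - x')))\<^sup>2" unfolding y by (simp add: algebra_simps)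
      also have "\<dots> = s\<^sup>2 * (norm (\<zeta> x'))\<^sup>2 - 2 * s * (\<zeta> x' \<bullet> (x - x')) + (norm (x - x'))\<^sup>2"
        unfolding power2_norm_eq_inner by (simp add: inner_simps inner_commute power2_eq_square algebra_simps)
      finally have 1: "(norm (snd z - x))\<^sup>2 = s\<^sup>2 * (norm (\<zeta> x'))\<^sup>2 - 2 * s * (\<zeta> x' \<bullet> (x - x')) + (norm (x - x'))\<^sup>2" .
      have "\<bar>s * (\<phi> x - \<phi> x' - \<zeta> x' \<bullet> (x - x'))\<bar> \<le> \<bar>s\<bar> * (L * (norm (x - x'))\<^sup>2)"
        unfolding abs_mult by (intro mult_left_mono tay) auto
      also have "\<dots> \<le> 1/4 * (norm (x - x'))\<^sup>2"
        using mult_right_mono[OF less_imp_le[OF sL], of "(norm (x - x'))\<^sup>2"] by (simp add: mult.assoc)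
      finally have "\<bar>s * (\<phi> x - \<phi> x') - s * (\<zeta> x' \<bullet> (x - x'))\<bar> \<le> 1/4 * (norm (x - x'))\<^sup>2"
        by (simp add: right_diff_distrib)
      then show ?thesis using 1 unfolding q_def x_def[symmetric] x'_def[symmetric] mult.assoc by linarith
    qed
    have i1: "integrable \<gamma> (\<lambda>z. (norm (snd z - fst z))\<^sup>2)" using coupling_cost(1)[OF g] by auto
    have i2: "integrable \<gamma> (\<lambda>z. s\<^sup>2 * (norm (\<zeta> (S (snd z))))\<^sup>2)"
      by (rule g.integrable_const_bound[where B="s\<^sup>2 * B\<^sup>2"])
         (auto intro!: mult_left_mono power_mono \<zeta>B simp: abs_mult)
    have i3: "integrable \<gamma> (\<lambda>z. \<phi> (fst z))" "integrable \<gamma> (\<lambda>z. \<phi> (S (snd z)))"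
      by (rule g.integrable_const_bound[where B=B]; simp add: \<phi>B)+
    have i4: "integrable \<gamma> q"
    proof -
      have "(\<lambda>z. (fst z - snd z) + s *\<^sub>R \<zeta> (S (snd z))) \<in> sqint \<gamma>"
        by (intro sqint_add sqint_diff sqint_scale couplingsD[OF g] g.sqint_bounded[of _ B] \<zeta>B) measurable
      moreover have "(fst z - snd z) + s *\<^sub>R \<zeta> (S (snd z)) = fst z - S (snd z)" for z :: "'a \<times> 'a"
        using Sy[of "snd z"] by (simp add: algebra_simps)
      ultimately show ?thesis by (auto simp: q_def[abs_def])
    qed
    have "(LINT z|\<gamma>. s\<^sup>2 * (norm (\<zeta> (S (snd z))))\<^sup>2 + (1/2) * q z - 2 * s * (\<phi> (fst z) - \<phi> (S (snd z))))
        \<le> (LINT z|\<gamma>. (norm (snd z - fst z))\<^sup>2)"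
      by (intro integral_mono pw) (use i1 i2 i3 i4 in auto)
    also have "\<dots> = transport_cost \<gamma>" by (simp add: transport_cost_def norm_minus_commute)
    also have "\<dots> \<le> transport_cost (distr \<mu> borel (\<lambda>x. (x, T x)))"
      using optimal_coupling_cost_le[OF opt, of "distr \<mu> borel (\<lambda>x. (x, T x))"]
        coupling_of_random_variables(1)[OF ps P2_id_sqint[OF \<mu>] Ts] P2_distr_id[OF \<mu>]
      by (simp add: T_def[abs_def])
    also have "\<dots> = (LINT x|\<mu>. s\<^sup>2 * (norm (\<zeta> x))\<^sup>2)"
      using coupling_of_random_variables(2)[OF ps P2_id_sqint[OF \<mu>] Ts]
      by (simp add: rms_power2 T_def power_mult_distrib)
    also have "\<dots> = (LINT z|\<gamma>. s\<^sup>2 * (norm (\<zeta> (S (snd z))))\<^sup>2)"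
    proof -
      have "(\<lambda>y. s\<^sup>2 * (norm (\<zeta> (S y)))\<^sup>2) \<in> borel_measurable borel" by measurable
      from int\<nu>[OF this] show ?thesis unfolding S(2) by (rule sym)
    qed
    finally have "(1/2) * (LINT z|\<gamma>. q z) - 2 * s * ((LINT z|\<gamma>. \<phi> (fst z)) - (LINT z|\<gamma>. \<phi> (S (snd z)))) \<le> 0"
      using i2 i3 i4 by simp
    moreover have "(LINT z|\<gamma>. \<phi> (fst z)) = (LINT z|\<gamma>. \<phi> (S (snd z)))"
      using int\<nu>[of "\<lambda>y. \<phi> (S y)"] S(2) coupling_marginals(1)[OF g, of \<phi>] by simp
    ultimately have "(LINT z|\<gamma>. q z) \<le> 0" by simp
    then have "(LINT z|\<gamma>. q z) = 0" by (intro antisym integral_nonneg_AE) (auto simp: q_def)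
    then have "AE z in \<gamma>. q z = 0"
      using i4 by (subst (asm) integral_nonneg_eq_0_iff_AE) (auto simp: q_def)
    then have "AE z in \<gamma>. (fst z, snd z) = (fst z, T (fst z))"
    proof eventually_elim
      fix z assume "q z = 0"
      then have "fst z = S (snd z)" by (simp add: q_def)
      then show "(fst z, snd z) = (fst z, T (fst z))" using S(3)[of "snd z"] by (simp add: T_def)
    qed
    moreover have [measurable]: "(\<lambda>z. (fst z, T (fst z))) \<in> borel_measurable \<gamma>"
      "(\<lambda>x. (x, T x)) \<in> borel_measurable borel" by (intro borel_measurable_Pair; measurable)+
    ultimately have "distr \<gamma> borel (\<lambda>z. z) = distr \<gamma> borel (\<lambda>z. (fst z, T (fst z)))"
      by (intro distr_cong_AE) auto
    also have "\<dots> = distr (distr \<gamma> borel fst) borel (\<lambda>x. (x, T x))"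
      by (subst distr_distr) (auto simp: o_def)
    also have "distr \<gamma> borel (\<lambda>z. z) = \<gamma>" by (rule distr_id2) (use couplingsD(1)[OF g] P2D in auto)
    finally show ?thesis using couplingsD(2)[OF g] by (simp add: T_def[abs_def])
  qed
  then show ?thesis using L by (intro that[of "1 / (4 * L)"]) auto
qed

lemma wsubdiffD:
  assumes "\<xi> \<in> wsubdiff G \<mu>" "\<epsilon> > 0"
  shows "\<xi> \<in> sqint \<mu>" "\<exists>\<delta>>0. \<forall>\<nu>\<in>P2. W2 \<mu> \<nu> < \<delta> \<longrightarrow> (\<forall>\<gamma>\<in>optimal_couplings \<mu> \<nu>.
    \<bar>G \<nu> - G \<mu> - (LINT z|\<gamma>. \<xi> (fst z) \<bullet> (snd z - fst z))\<bar> \<le> \<epsilon> * W2 \<mu> \<nu>)"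
  using assms by (auto simp: wsubdiff_def L2_eq_sqint)

lemma coupling_pairing:
  assumes \<xi>: "\<xi> \<in> sqint \<mu>" and g: "\<gamma> \<in> couplings \<mu> \<nu>"
  shows "integrable \<gamma> (\<lambda>z. \<xi> (fst z) \<bullet> (snd z - fst z))"
    "\<bar>LINT z|\<gamma>. \<xi> (fst z) \<bullet> (snd z - fst z)\<bar> \<le> rms \<mu> \<xi> * rms \<gamma> (\<lambda>z. snd z - fst z)"
  using sqint_inner[OF coupling_sqint_fst(1)[OF g \<xi>] coupling_cost(1)[OF g]]
    Cauchy_Schwarz_rms[OF coupling_sqint_fst(1)[OF g \<xi>] coupling_cost(1)[OF g]]
    coupling_sqint_fst(2)[OF g \<xi>] by auto

lemma wsubdiff_closed:
  assumes \<xi>: "\<xi> \<in> sqint \<mu>"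
    and cl: "\<And>e. e > 0 \<Longrightarrow> \<exists>\<eta>\<in>wsubdiff G \<mu>. rms \<mu> (\<lambda>x. \<xi> x - \<eta> x) < e"
  shows "\<xi> \<in> wsubdiff G \<mu>"
  unfolding wsubdiff_def L2_eq_sqint
proof (intro CollectI conjI \<xi> allI impI)
  fix \<epsilon> :: real assume e: "\<epsilon> > 0"
  obtain \<eta> where \<eta>: "\<eta> \<in> wsubdiff G \<mu>" "rms \<mu> (\<lambda>x. \<xi> x - \<eta> x) < \<epsilon> / 2" using cl[of "\<epsilon> / 2"] e by auto
  note h = wsubdiffD[OF \<eta>(1) half_gt_zero[OF e]]
  obtain \<delta> where d: "\<delta> > 0" "\<And>\<nu> \<gamma>. \<nu> \<in> P2 \<Longrightarrow> W2 \<mu> \<nu> < \<delta> \<Longrightarrow> \<gamma> \<in> optimal_couplings \<mu> \<nu> \<Longrightarrow>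
    \<bar>G \<nu> - G \<mu> - (LINT z|\<gamma>. \<eta> (fst z) \<bullet> (snd z - fst z))\<bar> \<le> \<epsilon> / 2 * W2 \<mu> \<nu>" using h(2) by blast
  have "\<bar>G \<nu> - G \<mu> - (LINT z|\<gamma>. \<xi> (fst z) \<bullet> (snd z - fst z))\<bar> \<le> \<epsilon> * W2 \<mu> \<nu>"
    if \<nu>: "\<nu> \<in> P2" "W2 \<mu> \<nu> < \<delta>" and o: "\<gamma> \<in> optimal_couplings \<mu> \<nu>" for \<nu> \<gamma>
  proof -
    have g: "\<gamma> \<in> couplings \<mu> \<nu>" using optimal_couplingD(1)[OF o] .
    have W: "0 \<le> W2 \<mu> \<nu>" using optimal_couplingD(3)[OF o] rms_nonneg by metis
    have "(LINT z|\<gamma>. \<xi> (fst z) \<bullet> (snd z - fst z)) - (LINT z|\<gamma>. \<eta> (fst z) \<bullet> (snd z - fst z))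
        = (LINT z|\<gamma>. (\<xi> (fst z) - \<eta> (fst z)) \<bullet> (snd z - fst z))"
      using coupling_pairing(1)[OF \<xi> g] coupling_pairing(1)[OF h(1) g] by (simp add: inner_diff_left)
    moreover have "\<bar>LINT z|\<gamma>. (\<xi> (fst z) - \<eta> (fst z)) \<bullet> (snd z - fst z)\<bar> \<le> rms \<mu> (\<lambda>x. \<xi> x - \<eta> x) * W2 \<mu> \<nu>"
      using coupling_pairing(2)[OF sqint_diff[OF \<xi> h(1)] g] optimal_couplingD(3)[OF o] by simp
    moreover have "rms \<mu> (\<lambda>x. \<xi> x - \<eta> x) * W2 \<mu> \<nu> \<le> \<epsilon> / 2 * W2 \<mu> \<nu>"
      using \<eta>(2) W by (intro mult_right_mono) auto
    moreover have "\<epsilon> * W2 \<mu> \<nu> = \<epsilon> / 2 * W2 \<mu> \<nu> + \<epsilon> / 2 * W2 \<mu> \<nu>" by simp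
    ultimately show ?thesis using d(2)[OF \<nu> o] by linarith
  qed
  then show "\<exists>\<delta>>0. \<forall>\<nu>\<in>P2. W2 \<mu> \<nu> < \<delta> \<longrightarrow> (\<forall>\<gamma>\<in>optimal_couplings \<mu> \<nu>.
    \<bar>G \<nu> - G \<mu> - (LINT z|\<gamma>. \<xi> (fst z) \<bullet> (snd z - fst z))\<bar> \<le> \<epsilon> * W2 \<mu> \<nu>)" using d(1) by blast
qed

lemma wsubdiff_linear:
  assumes \<xi>: "\<xi> \<in> wsubdiff G \<mu>" and \<eta>: "\<eta> \<in> wsubdiff H \<mu>"
  shows "(\<lambda>x. a *\<^sub>R \<xi> x + b *\<^sub>R \<eta> x) \<in> wsubdiff (\<lambda>\<nu>. a * G \<nu> + b * H \<nu>) \<mu>"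
  unfolding wsubdiff_def L2_eq_sqint
proof (intro CollectI conjI allI impI)
  have xs: "\<xi> \<in> sqint \<mu>" "\<eta> \<in> sqint \<mu>" using wsubdiffD(1)[OF _ zero_less_one] \<xi> \<eta> by blast+
  then show "(\<lambda>x. a *\<^sub>R \<xi> x + b *\<^sub>R \<eta> x) \<in> sqint \<mu>" by (intro sqint_add sqint_scale)
  fix \<epsilon> :: real assume e: "\<epsilon> > 0"
  define M where "M = \<bar>a\<bar> + \<bar>b\<bar> + 1"
  have M: "M > 0" "\<epsilon> / M > 0" using e by (auto simp: M_def intro!: divide_pos_pos)
  obtain \<delta>1 where d1: "\<delta>1 > 0" "\<And>\<nu> \<gamma>. \<nu> \<in> P2 \<Longrightarrow> W2 \<mu> \<nu> < \<delta>1 \<Longrightarrow> \<gamma> \<in> optimal_couplings \<mu> \<nu> \<Longrightarrow>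
    \<bar>G \<nu> - G \<mu> - (LINT z|\<gamma>. \<xi> (fst z) \<bullet> (snd z - fst z))\<bar> \<le> \<epsilon> / M * W2 \<mu> \<nu>"
    using wsubdiffD(2)[OF \<xi> M(2)] by blast
  obtain \<delta>2 where d2: "\<delta>2 > 0" "\<And>\<nu> \<gamma>. \<nu> \<in> P2 \<Longrightarrow> W2 \<mu> \<nu> < \<delta>2 \<Longrightarrow> \<gamma> \<in> optimal_couplings \<mu> \<nu> \<Longrightarrow>
    \<bar>H \<nu> - H \<mu> - (LINT z|\<gamma>. \<eta> (fst z) \<bullet> (snd z - fst z))\<bar> \<le> \<epsilon> / M * W2 \<mu> \<nu>"
    using wsubdiffD(2)[OF \<eta> M(2)] by blast
  have "\<bar>(a * G \<nu> + b * H \<nu>) - (a * G \<mu> + b * H \<mu>)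
      - (LINT z|\<gamma>. (a *\<^sub>R \<xi> (fst z) + b *\<^sub>R \<eta> (fst z)) \<bullet> (snd z - fst z))\<bar> \<le> \<epsilon> * W2 \<mu> \<nu>"
    if \<nu>: "\<nu> \<in> P2" "W2 \<mu> \<nu> < min \<delta>1 \<delta>2" and o: "\<gamma> \<in> optimal_couplings \<mu> \<nu>" for \<nu> \<gamma>
  proof -
    have g: "\<gamma> \<in> couplings \<mu> \<nu>" using optimal_couplingD(1)[OF o] .
    have W: "0 \<le> W2 \<mu> \<nu>" using optimal_couplingD(3)[OF o] rms_nonneg by metis
    define u where "u = G \<nu> - G \<mu> - (LINT z|\<gamma>. \<xi> (fst z) \<bullet> (snd z - fst z))"
    define v where "v = H \<nu> - H \<mu> - (LINT z|\<gamma>. \<eta> (fst z) \<bullet> (snd z - fst z))"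
    have "(LINT z|\<gamma>. (a *\<^sub>R \<xi> (fst z) + b *\<^sub>R \<eta> (fst z)) \<bullet> (snd z - fst z))
        = a * (LINT z|\<gamma>. \<xi> (fst z) \<bullet> (snd z - fst z)) + b * (LINT z|\<gamma>. \<eta> (fst z) \<bullet> (snd z - fst z))"
      using coupling_pairing(1)[OF xs(1) g] coupling_pairing(1)[OF xs(2) g] by (simp add: inner_add_left)
    then have "(a * G \<nu> + b * H \<nu>) - (a * G \<mu> + b * H \<mu>)
      - (LINT z|\<gamma>. (a *\<^sub>R \<xi> (fst z) + b *\<^sub>R \<eta> (fst z)) \<bullet> (snd z - fst z)) = a * u + b * v"
      by (simp add: u_def v_def algebra_simps)
    also have "\<bar>a * u + b * v\<bar> \<le> \<bar>a\<bar> * \<bar>u\<bar> + \<bar>b\<bar> * \<bar>v\<bar>"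
      by (metis abs_mult abs_triangle_ineq)
    also have "\<dots> \<le> \<bar>a\<bar> * (\<epsilon> / M * W2 \<mu> \<nu>) + \<bar>b\<bar> * (\<epsilon> / M * W2 \<mu> \<nu>)"
      using d1(2)[OF \<nu>(1) _ o] d2(2)[OF \<nu>(1) _ o] \<nu>(2) unfolding u_def[symmetric] v_def[symmetric]
      by (intro add_mono mult_left_mono) simp_all
    also have "\<dots> \<le> M * (\<epsilon> / M * W2 \<mu> \<nu>)"
      using W M unfolding distrib_right[symmetric] by (intro mult_right_mono) (auto simp: M_def e less_imp_le)
    also have "\<dots> = \<epsilon> * W2 \<mu> \<nu>" using M by simp
    finally show ?thesis .
  qed
  then show "\<exists>\<delta>>0. \<forall>\<nu>\<in>P2. W2 \<mu> \<nu> < \<delta> \<longrightarrow> (\<forall>\<gamma>\<in>optimal_couplings \<mu> \<nu>.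
    \<bar>(a * G \<nu> + b * H \<nu>) - (a * G \<mu> + b * H \<mu>)
      - (LINT z|\<gamma>. (a *\<^sub>R \<xi> (fst z) + b *\<^sub>R \<eta> (fst z)) \<bullet> (snd z - fst z))\<bar> \<le> \<epsilon> * W2 \<mu> \<nu>)"
    using d1(1) d2(1) by (intro exI[of _ "min \<delta>1 \<delta>2"]) auto
qed

text \<open>\<^const>\<open>wgrad\<close> is chosen by \<^const>\<open>arg_min_on\<close>, which carries information only if a minimiser exists.  It does,
  because \<^const>\<open>wsubdiff\<close> is closed and convex.\<close>

lemma wgrad_in_wsubdiff:
  assumes \<mu>: "\<mu> \<in> P2" and d: "wdifferentiable G \<mu>"
  shows "wgrad G \<mu> \<in> wsubdiff G \<mu>"
proof -
  interpret prob_space \<mu> using P2D[OF \<mu>] by auto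
  have "\<exists>f\<in>wsubdiff G \<mu>. \<forall>g\<in>wsubdiff G \<mu>. rms \<mu> f \<le> rms \<mu> g"
  proof (rule min_rms_exists)
    show "wsubdiff G \<mu> \<noteq> {}" using d by (simp add: wdifferentiable_def)
    show "wsubdiff G \<mu> \<subseteq> sqint \<mu>" using wsubdiffD(1)[OF _ zero_less_one] by blast
    show "(\<lambda>x. (1/2) *\<^sub>R (f x + g x)) \<in> wsubdiff G \<mu>" if "f \<in> wsubdiff G \<mu>" "g \<in> wsubdiff G \<mu>" for f g
      using wsubdiff_linear[OF that, of "1/2" "1/2"] by (simp add: scaleR_add_right)
  qed (use wsubdiff_closed in blast)
  then obtain f where "f \<in> wsubdiff G \<mu>" "\<And>g. g \<in> wsubdiff G \<mu> \<Longrightarrow> L2_norm \<mu> f \<le> L2_norm \<mu> g"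
    by (auto simp: L2_norm_eq_rms)
  then have "is_arg_min (L2_norm \<mu>) (\<lambda>x. x \<in> wsubdiff G \<mu>) f"
    by (auto simp: is_arg_min_def not_less)
  then have "is_arg_min (L2_norm \<mu>) (\<lambda>x. x \<in> wsubdiff G \<mu>) (wgrad G \<mu>)"
    unfolding wgrad_def arg_min_on_def arg_min_def
    by (rule someI[of "is_arg_min (L2_norm \<mu>) (\<lambda>x. x \<in> wsubdiff G \<mu>)"])
  then show ?thesis by (simp add: is_arg_min_def)
qed

lemma W2_self_distr:
  fixes T :: "'a::euclidean_space \<Rightarrow> 'a"
  assumes \<mu>: "\<mu> \<in> P2" and T: "T \<in> sqint \<mu>"
  shows "W2 \<mu> (distr \<mu> borel T) \<le> rms \<mu> (\<lambda>x. T x - x)"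
  using W2_le_rms[OF P2D(1)[OF \<mu>] P2_id_sqint[OF \<mu>] T P2_distr_id[OF \<mu>] refl]
    rms_minus_commute[of \<mu> T "\<lambda>x. x"] by simp

lemma wdifferentiable_continuous:
  assumes \<mu>: "\<mu> \<in> P2" and d: "wdifferentiable G \<mu>" and \<nu>: "\<And>i. \<nu> i \<in> P2"
    and lim: "((\<lambda>i. W2 \<mu> (\<nu> i)) \<longlongrightarrow> 0) F"
  shows "((\<lambda>i. G (\<nu> i)) \<longlongrightarrow> G \<mu>) F"
proof -
  obtain \<xi> where \<xi>: "\<xi> \<in> wsubdiff G \<mu>" using d by (auto simp: wdifferentiable_def)
  note h = wsubdiffD[OF \<xi> zero_less_one]
  obtain \<delta> where del: "\<delta> > 0" "\<And>\<nu> \<gamma>. \<nu> \<in> P2 \<Longrightarrow> W2 \<mu> \<nu> < \<delta> \<Longrightarrow> \<gamma> \<in> optimal_couplings \<mu> \<nu> \<Longrightarrow>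
    \<bar>G \<nu> - G \<mu> - (LINT z|\<gamma>. \<xi> (fst z) \<bullet> (snd z - fst z))\<bar> \<le> 1 * W2 \<mu> \<nu>" using h(2) by blast
  have "\<forall>\<^sub>F i in F. W2 \<mu> (\<nu> i) < \<delta>" using lim del(1) by (rule order_tendstoD)
  then have "\<forall>\<^sub>F i in F. norm (G (\<nu> i) - G \<mu>) \<le> (rms \<mu> \<xi> + 1) * W2 \<mu> (\<nu> i)"
  proof eventually_elim
    fix i assume i: "W2 \<mu> (\<nu> i) < \<delta>"
    obtain \<gamma> where o: "\<gamma> \<in> optimal_couplings \<mu> (\<nu> i)" using optimal_coupling_exists[OF \<mu> \<nu>] by blast
    show "norm (G (\<nu> i) - G \<mu>) \<le> (rms \<mu> \<xi> + 1) * W2 \<mu> (\<nu> i)"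
      using del(2)[OF \<nu> i o] coupling_pairing(2)[OF h(1) optimal_couplingD(1)[OF o]] optimal_couplingD(3)[OF o]
      by (simp add: distrib_right)
  qed
  moreover have "((\<lambda>i. (rms \<mu> \<xi> + 1) * W2 \<mu> (\<nu> i)) \<longlongrightarrow> 0) F"
    using lim by (rule tendsto_mult_right_zero)
  ultimately have "((\<lambda>i. G (\<nu> i) - G \<mu>) \<longlongrightarrow> 0) F" by (rule Lim_null_comparison)
  then show ?thesis by (rule LIM_zero_cancel)
qed

text \<open>An optimal coupling of \<open>\<mu>\<close> with its image under \<open>id + e(a + r)\<close>, where \<open>a = \<nabla>\<phi>\<close> and \<open>r\<close> is
  small, need not be carried by the graph of that map, but it displaces mass by nearly \<open>e a\<close>: its
  cost is at most that of the map, and \<open>\<integral> a(x\<^sub>1) \<bullet> (x\<^sub>2 - x\<^sub>1)\<close> is up to second order the increment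
  of \<open>\<integral> \<phi>\<close>, which depends on the two marginals only.\<close>

lemma optimal_displacement_deviation:
  fixes a :: "'a::euclidean_space \<Rightarrow> 'a"
  assumes a: "a \<in> test_gradients"
  obtains C where "C > 0" "\<And>\<mu> r e \<gamma>. \<mu> \<in> P2 \<Longrightarrow> r \<in> sqint \<mu> \<Longrightarrow>
    \<gamma> \<in> optimal_couplings \<mu> (distr \<mu> borel (\<lambda>x. x + e *\<^sub>R (a x + r x))) \<Longrightarrow>
    (rms \<gamma> (\<lambda>z. (snd z - fst z) - e *\<^sub>R a (fst z)))\<^sup>2
      \<le> e\<^sup>2 * ((rms \<mu> r)\<^sup>2 + 4 * C * \<bar>e\<bar> * (rms \<mu> a + rms \<mu> r)\<^sup>2)"
proof -
  obtain \<phi> B C where B: "B \<ge> 0" and C: "C > 0" and \<phi>c: "continuous_on UNIV \<phi>" and \<phi>B: "\<And>x. \<bar>\<phi> x\<bar> \<le> B"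
    and aB: "\<And>x. norm (a x) \<le> B" and ac: "continuous_on UNIV a"
    and lip: "\<And>x y. norm (a x - a y) \<le> C * norm (x - y)"
    and tay: "\<And>x y. \<bar>\<phi> y - \<phi> x - a x \<bullet> (y - x)\<bar> \<le> C * (norm (y - x))\<^sup>2"
    and "\<And>x. (a has_derivative frechet_derivative a (at x)) (at x)"
    by (rule test_gradient_facts[OF a]) (rule that, assumption+)
  have "(rms \<gamma> (\<lambda>z. (snd z - fst z) - e *\<^sub>R a (fst z)))\<^sup>2
      \<le> e\<^sup>2 * ((rms \<mu> r)\<^sup>2 + 4 * C * \<bar>e\<bar> * (rms \<mu> a + rms \<mu> r)\<^sup>2)"
    if \<mu>: "\<mu> \<in> P2" and r: "r \<in> sqint \<mu>"
      and o: "\<gamma> \<in> optimal_couplings \<mu> (distr \<mu> borel (\<lambda>x. x + e *\<^sub>R (a x + r x)))" for \<mu> r e \<gamma>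
  proof -
    define T where "T x = x + e *\<^sub>R (a x + r x)" for x
    define N where "N = (rms \<mu> (\<lambda>x. a x + r x))\<^sup>2"
    define ar where "ar = (LINT x|\<mu>. a x \<bullet> r x)"
    interpret \<mu>: prob_space \<mu> using P2D[OF \<mu>] by auto
    have as: "a \<in> sqint \<mu>" and am[measurable]: "a \<in> borel_measurable borel" using test_gradient_sqint[OF a \<mu>] by auto
    have [measurable]: "\<phi> \<in> borel_measurable borel" using \<phi>c by (rule borel_measurable_continuous_onI)
    have [measurable_cong]: "sets \<mu> = sets borel" using P2D[OF \<mu>] by auto
    have Ts: "T \<in> sqint \<mu>" unfolding T_def by (intro sqint_add P2_id_sqint[OF \<mu>] sqint_scale as r)
    then have [measurable]: "T \<in> borel_measurable \<mu>" by auto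
    have ars: "(\<lambda>x. a x + r x) \<in> sqint \<mu>" using as r by (rule sqint_add)
    have g: "\<gamma> \<in> couplings \<mu> (distr \<mu> borel T)" using optimal_couplingD(1)[OF o] by (simp add: T_def[abs_def])
    interpret g: prob_space \<gamma> using couplingsD(1)[OF g] P2D by auto
    have [measurable_cong]: "sets \<gamma> = sets borel" using couplingsD(1)[OF g] P2D by auto
    have ids: "(\<lambda>z. snd z - fst z) \<in> sqint \<gamma>" using coupling_cost(1)[OF g] .
    have "rms \<gamma> (\<lambda>z. snd z - fst z) = W2 \<mu> (distr \<mu> borel T)"
      using optimal_couplingD(3)[OF o] by (simp add: T_def[abs_def])
    also have "\<dots> \<le> rms \<mu> (\<lambda>x. T x - x)" by (rule W2_self_distr[OF \<mu> Ts])
    also have "\<dots> = \<bar>e\<bar> * rms \<mu> (\<lambda>x. a x + r x)" by (simp add: T_def rms_scale)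
    finally have "(rms \<gamma> (\<lambda>z. snd z - fst z))\<^sup>2 \<le> (\<bar>e\<bar> * rms \<mu> (\<lambda>x. a x + r x))\<^sup>2" by (rule power_mono) simp
    then have c: "(rms \<gamma> (\<lambda>z. snd z - fst z))\<^sup>2 \<le> e\<^sup>2 * N" by (simp add: N_def power_mult_distrib)
    define I where "I = (LINT z|\<gamma>. a (fst z) \<bullet> (snd z - fst z))"
    define P where "P = (LINT x|\<mu>. \<phi> (T x)) - (LINT x|\<mu>. \<phi> x)"
    have i\<phi>: "integrable \<gamma> (\<lambda>z. \<phi> (fst z))" "integrable \<gamma> (\<lambda>z. \<phi> (snd z))"
      by (rule g.integrable_const_bound[where B=B]; simp add: \<phi>B)+
    have i\<phi>': "integrable \<mu> (\<lambda>x. \<phi> x)" "integrable \<mu> (\<lambda>x. \<phi> (T x))"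
      by (rule \<mu>.integrable_const_bound[where B=B]; simp add: \<phi>B)+
    have Pg: "P = (LINT z|\<gamma>. \<phi> (snd z) - \<phi> (fst z))"
      using i\<phi> coupling_marginals(1,2)[OF g, of \<phi>] by (simp add: P_def integral_distr)
    have IP: "\<bar>P - I\<bar> \<le> C * (rms \<gamma> (\<lambda>z. snd z - fst z))\<^sup>2"
    proof -
      have "P - I = (LINT z|\<gamma>. \<phi> (snd z) - \<phi> (fst z) - a (fst z) \<bullet> (snd z - fst z))"
        unfolding Pg I_def using i\<phi> coupling_pairing(1)[OF as g] by simp
      also have "\<bar>\<dots>\<bar> \<le> (LINT z|\<gamma>. \<bar>\<phi> (snd z) - \<phi> (fst z) - a (fst z) \<bullet> (snd z - fst z)\<bar>)"
        by (rule integral_abs_bound)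
      also have "\<dots> \<le> (LINT z|\<gamma>. C * (norm (snd z - fst z))\<^sup>2)"
        by (intro integral_mono tay) (use i\<phi> coupling_pairing(1)[OF as g] ids in auto)
      finally show ?thesis by (simp add: rms_power2)
    qed
    have PE: "\<bar>P - e * ((rms \<mu> a)\<^sup>2 + ar)\<bar> \<le> C * (e\<^sup>2 * N)"
    proof -
      have i: "integrable \<mu> (\<lambda>x. a x \<bullet> (T x - x))" "integrable \<mu> (\<lambda>x. (norm (T x - x))\<^sup>2)"
        using sqint_inner[OF as sqint_diff[OF Ts P2_id_sqint[OF \<mu>]]] sqint_diff[OF Ts P2_id_sqint[OF \<mu>]] by auto
      have "(LINT x|\<mu>. a x \<bullet> (T x - x)) = (LINT x|\<mu>. e * (a x \<bullet> a x + a x \<bullet> r x))"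
        by (simp add: T_def inner_add_right)
      also have "\<dots> = e * ((rms \<mu> a)\<^sup>2 + ar)"
        using sqint_inner[OF as as] sqint_inner[OF as r] by (simp add: rms_power2 ar_def power2_norm_eq_inner)
      finally have "P - e * ((rms \<mu> a)\<^sup>2 + ar) = (LINT x|\<mu>. \<phi> (T x) - \<phi> x - a x \<bullet> (T x - x))"
        using i i\<phi>' by (simp add: P_def)
      also have "\<bar>\<dots>\<bar> \<le> (LINT x|\<mu>. \<bar>\<phi> (T x) - \<phi> x - a x \<bullet> (T x - x)\<bar>)"
        by (rule integral_abs_bound)
      also have "\<dots> \<le> (LINT x|\<mu>. C * (norm (T x - x))\<^sup>2)"
        by (intro integral_mono tay) (use i i\<phi>' in auto)
      also have "\<dots> = C * (rms \<mu> (\<lambda>x. T x - x))\<^sup>2" by (simp add: rms_power2)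
      also have "\<dots> = C * (e\<^sup>2 * N)" by (simp add: T_def rms_scale N_def power_mult_distrib)
      finally show ?thesis .
    qed
    have CN: "C * (rms \<gamma> (\<lambda>z. snd z - fst z))\<^sup>2 \<le> C * (e\<^sup>2 * N)" using c C by (intro mult_left_mono) auto
    define D where "D = I - e * ((rms \<mu> a)\<^sup>2 + ar)"
    have D: "\<bar>D\<bar> \<le> 2 * C * (e\<^sup>2 * N)" using IP PE CN unfolding D_def by linarith
    have NN: "N = (rms \<mu> a)\<^sup>2 + 2 * ar + (rms \<mu> r)\<^sup>2"
      using rms_expand[OF as r, of 1] by (simp add: N_def ar_def)
    have "(rms \<gamma> (\<lambda>z. (snd z - fst z) + (-e) *\<^sub>R a (fst z)))\<^sup>2
        = (rms \<gamma> (\<lambda>z. snd z - fst z))\<^sup>2 + 2 * (-e) * (LINT z|\<gamma>. (snd z - fst z) \<bullet> a (fst z))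
          + (-e)\<^sup>2 * (rms \<gamma> (\<lambda>z. a (fst z)))\<^sup>2"
      by (rule rms_expand[OF ids coupling_sqint_fst(1)[OF g as]])
    also have "\<dots> = (rms \<gamma> (\<lambda>z. snd z - fst z))\<^sup>2 - 2 * e * I + e\<^sup>2 * (rms \<mu> a)\<^sup>2"
      using coupling_sqint_fst(2)[OF g as] by (simp add: I_def inner_commute)
    also have "\<dots> \<le> e\<^sup>2 * N - 2 * e * I + e\<^sup>2 * (rms \<mu> a)\<^sup>2" using c by simp
    also have "\<dots> = e\<^sup>2 * (rms \<mu> r)\<^sup>2 - 2 * (e * D)"
      unfolding NN D_def by (simp add: power2_eq_square algebra_simps)
    also have "\<dots> \<le> e\<^sup>2 * (rms \<mu> r)\<^sup>2 + 2 * (\<bar>e\<bar> * (2 * C * (e\<^sup>2 * N)))"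
    proof -
      have "- (e * D) \<le> \<bar>e\<bar> * \<bar>D\<bar>" by (metis abs_ge_minus_self abs_mult)
      also have "\<dots> \<le> \<bar>e\<bar> * (2 * C * (e\<^sup>2 * N))" using D by (intro mult_left_mono) auto
      finally show ?thesis by linarith
    qed
    also have "\<dots> = e\<^sup>2 * ((rms \<mu> r)\<^sup>2 + 4 * C * \<bar>e\<bar> * N)" by (simp add: algebra_simps)
    also have "\<dots> \<le> e\<^sup>2 * ((rms \<mu> r)\<^sup>2 + 4 * C * \<bar>e\<bar> * (rms \<mu> a + rms \<mu> r)\<^sup>2)"
      unfolding N_def using C rms_add_le[OF as r]
      by (intro mult_left_mono add_left_mono power_mono) auto
    finally show ?thesis by simp
  qed
  with C show ?thesis by (rule that)
qed

text \<open>Differentiability controls increments of \<open>G\<close> through optimal couplings, whereas the proofs move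
  measures by explicit maps.  The deviation estimate bridges the gap for maps that are, to leading
  order, displacements along a test gradient.\<close>

theorem derivative_along_perturbation:
  fixes a :: "'a::euclidean_space \<Rightarrow> 'a"
  assumes \<mu>: "\<mu> \<in> P2" and \<xi>: "\<xi> \<in> wsubdiff G \<mu>" and a: "a \<in> test_gradients"
    and e: "(e \<longlongrightarrow> 0) F" "\<forall>\<^sub>F i in F. e i \<noteq> 0"
    and r: "\<And>i. r i \<in> sqint \<mu>" "((\<lambda>i. rms \<mu> (r i)) \<longlongrightarrow> 0) F"
  shows "((\<lambda>i. (G (distr \<mu> borel (\<lambda>x. x + e i *\<^sub>R (a x + r i x))) - G \<mu>) / e i) \<longlongrightarrow> L2_inner \<mu> a \<xi>) F"
proof -
  define T where "T i x = x + e i *\<^sub>R (a x + r i x)" for i x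
  define \<nu> where "\<nu> i = distr \<mu> borel (T i)" for i
  have as: "a \<in> sqint \<mu>" using test_gradient_sqint[OF a \<mu>] by auto
  have \<xi>s: "\<xi> \<in> sqint \<mu>" using wsubdiffD(1)[OF \<xi> zero_less_one] .
  have Ts: "T i \<in> sqint \<mu>" for i unfolding T_def by (intro sqint_add P2_id_sqint[OF \<mu>] sqint_scale as r)
  have \<nu>P: "\<nu> i \<in> P2" for i unfolding \<nu>_def using P2D(1)[OF \<mu>] Ts by (rule distr_in_P2)
  obtain C where C: "C > 0" and dev: "\<And>\<mu> r e \<gamma>. \<mu> \<in> P2 \<Longrightarrow> r \<in> sqint \<mu> \<Longrightarrow>
    \<gamma> \<in> optimal_couplings \<mu> (distr \<mu> borel (\<lambda>x. x + e *\<^sub>R (a x + r x))) \<Longrightarrow>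
    (rms \<gamma> (\<lambda>z. (snd z - fst z) - e *\<^sub>R a (fst z)))\<^sup>2
      \<le> e\<^sup>2 * ((rms \<mu> r)\<^sup>2 + 4 * C * \<bar>e\<bar> * (rms \<mu> a + rms \<mu> r)\<^sup>2)"
    by (rule optimal_displacement_deviation[OF a]) (rule that, assumption+)
  define \<rho> where "\<rho> i = rms \<mu> (r i)" for i
  define K where "K i = (\<rho> i)\<^sup>2 + 4 * C * \<bar>e i\<bar> * (rms \<mu> a + \<rho> i)\<^sup>2" for i
  have "((\<lambda>i. sqrt (K i)) \<longlongrightarrow> sqrt (0\<^sup>2 + 4 * C * \<bar>0\<bar> * (rms \<mu> a + 0)\<^sup>2)) F"
    unfolding K_def \<rho>_def by (intro tendsto_intros r e)
  then have K0: "((\<lambda>i. rms \<mu> \<xi> * sqrt (K i)) \<longlongrightarrow> 0) F"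
    by (intro tendsto_mult_right_zero) simp
  have Wle: "W2 \<mu> (\<nu> i) \<le> \<bar>e i\<bar> * (rms \<mu> a + \<rho> i)" for i
  proof -
    have "W2 \<mu> (\<nu> i) \<le> rms \<mu> (\<lambda>x. T i x - x)" unfolding \<nu>_def by (rule W2_self_distr[OF \<mu> Ts])
    also have "\<dots> = \<bar>e i\<bar> * rms \<mu> (\<lambda>x. a x + r i x)" by (simp add: T_def rms_scale)
    also have "\<dots> \<le> \<bar>e i\<bar> * (rms \<mu> a + \<rho> i)" unfolding \<rho>_def using rms_add_le[OF as r(1)] by (intro mult_left_mono) auto
    finally show ?thesis .
  qed
  have "((\<lambda>i. \<bar>e i\<bar> * (rms \<mu> a + \<rho> i)) \<longlongrightarrow> \<bar>0\<bar> * (rms \<mu> a + 0)) F"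
    unfolding \<rho>_def by (intro tendsto_intros r e)
  then have W0: "((\<lambda>i. \<bar>e i\<bar> * (rms \<mu> a + \<rho> i)) \<longlongrightarrow> 0) F" by simp
  have "((\<lambda>i. (G (\<nu> i) - G \<mu>) / e i) \<longlongrightarrow> L2_inner \<mu> a \<xi>) F"
  proof (rule tendstoI)
    fix \<eta> :: real assume \<eta>: "\<eta> > 0"
    define \<epsilon> where "\<epsilon> = \<eta> / (2 * (rms \<mu> a + 1))"
    have pa: "rms \<mu> a + 1 > 0" using rms_nonneg[of \<mu> a] by linarith
    have \<epsilon>: "\<epsilon> > 0" using \<eta> pa by (simp add: \<epsilon>_def)
    obtain \<delta> where del: "\<delta> > 0" "\<And>\<nu> \<gamma>. \<nu> \<in> P2 \<Longrightarrow> W2 \<mu> \<nu> < \<delta> \<Longrightarrow> \<gamma> \<in> optimal_couplings \<mu> \<nu> \<Longrightarrow>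
      \<bar>G \<nu> - G \<mu> - (LINT z|\<gamma>. \<xi> (fst z) \<bullet> (snd z - fst z))\<bar> \<le> \<epsilon> * W2 \<mu> \<nu>"
      using wsubdiffD(2)[OF \<xi> \<epsilon>] by blast
    have "\<forall>\<^sub>F i in F. \<bar>e i\<bar> * (rms \<mu> a + \<rho> i) < \<delta>" using W0 del(1) by (rule order_tendstoD)
    moreover have "\<forall>\<^sub>F i in F. rms \<mu> \<xi> * sqrt (K i) < \<eta> / 2" using K0 by (rule order_tendstoD) (use \<eta> in simp)
    moreover have "\<forall>\<^sub>F i in F. \<rho> i < 1" unfolding \<rho>_def using r(2) by (rule order_tendstoD) simp
    ultimately show "\<forall>\<^sub>F i in F. dist ((G (\<nu> i) - G \<mu>) / e i) (L2_inner \<mu> a \<xi>) < \<eta>"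
      using e(2)
    proof eventually_elim
      fix i assume i: "\<bar>e i\<bar> * (rms \<mu> a + \<rho> i) < \<delta>" "rms \<mu> \<xi> * sqrt (K i) < \<eta> / 2" "\<rho> i < 1" "e i \<noteq> 0"
      obtain \<gamma> where o: "\<gamma> \<in> optimal_couplings \<mu> (\<nu> i)" using optimal_coupling_exists[OF \<mu> \<nu>P] by blast
      have g: "\<gamma> \<in> couplings \<mu> (\<nu> i)" using optimal_couplingD(1)[OF o] .
      have dvs: "(\<lambda>z. (snd z - fst z) - e i *\<^sub>R a (fst z)) \<in> sqint \<gamma>"
        by (intro sqint_diff sqint_scale couplingsD[OF g] coupling_sqint_fst(1)[OF g as])
      have ax: "(LINT z|\<gamma>. \<xi> (fst z) \<bullet> a (fst z)) = L2_inner \<mu> a \<xi>"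
        "integrable \<gamma> (\<lambda>z. \<xi> (fst z) \<bullet> a (fst z))"
      proof -
        have "\<xi> \<in> borel_measurable borel" "a \<in> borel_measurable borel"
          using \<xi>s as P2_measurable_iff[OF \<mu>] by auto
        then have m: "(\<lambda>x. \<xi> x \<bullet> a x) \<in> borel_measurable borel" by measurable
        show "(LINT z|\<gamma>. \<xi> (fst z) \<bullet> a (fst z)) = L2_inner \<mu> a \<xi>"
          using coupling_marginals(1)[OF g m] by (simp add: L2_inner_def inner_commute)
        show "integrable \<gamma> (\<lambda>z. \<xi> (fst z) \<bullet> a (fst z))"
          using coupling_marginals(3)[OF g m] sqint_inner[OF \<xi>s as] by simp
      qed
      have "(LINT z|\<gamma>. \<xi> (fst z) \<bullet> (snd z - fst z)) - e i * L2_inner \<mu> a \<xi>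
          = (LINT z|\<gamma>. \<xi> (fst z) \<bullet> ((snd z - fst z) - e i *\<^sub>R a (fst z)))"
        using coupling_pairing(1)[OF \<xi>s g] ax by (simp add: inner_diff_right[of _ "snd _ - fst _"])
      also have "\<bar>\<dots>\<bar> \<le> rms \<mu> \<xi> * rms \<gamma> (\<lambda>z. (snd z - fst z) - e i *\<^sub>R a (fst z))"
        using Cauchy_Schwarz_rms[OF coupling_sqint_fst(1)[OF g \<xi>s] dvs] coupling_sqint_fst(2)[OF g \<xi>s] by simp
      also have "\<dots> \<le> rms \<mu> \<xi> * (\<bar>e i\<bar> * sqrt (K i))"
      proof (intro mult_left_mono)
        have "(rms \<gamma> (\<lambda>z. (snd z - fst z) - e i *\<^sub>R a (fst z)))\<^sup>2 \<le> (e i)\<^sup>2 * K i"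
          using dev[OF \<mu> r(1), of \<gamma> "e i" i] o unfolding \<nu>_def T_def K_def \<rho>_def by simp
        then have "rms \<gamma> (\<lambda>z. (snd z - fst z) - e i *\<^sub>R a (fst z)) \<le> sqrt ((e i)\<^sup>2 * K i)"
          by (rule real_le_rsqrt)
        then show "rms \<gamma> (\<lambda>z. (snd z - fst z) - e i *\<^sub>R a (fst z)) \<le> \<bar>e i\<bar> * sqrt (K i)"
          by (simp add: real_sqrt_mult)
      qed simp
      finally have 1: "\<bar>(LINT z|\<gamma>. \<xi> (fst z) \<bullet> (snd z - fst z)) - e i * L2_inner \<mu> a \<xi>\<bar> \<le> \<bar>e i\<bar> * (rms \<mu> \<xi> * sqrt (K i))"
        by (simp only: mult.left_commute)
      have "W2 \<mu> (\<nu> i) < \<delta>" using Wle[of i] i(1) by linarith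
      from del(2)[OF \<nu>P this o]
      have 2: "\<bar>G (\<nu> i) - G \<mu> - (LINT z|\<gamma>. \<xi> (fst z) \<bullet> (snd z - fst z))\<bar> \<le> \<epsilon> * W2 \<mu> (\<nu> i)" .
      have "\<epsilon> * W2 \<mu> (\<nu> i) \<le> \<epsilon> * (\<bar>e i\<bar> * (rms \<mu> a + 1))"
      proof -
        have "\<bar>e i\<bar> * (rms \<mu> a + \<rho> i) \<le> \<bar>e i\<bar> * (rms \<mu> a + 1)" using i(3) by (intro mult_left_mono) auto
        then show ?thesis using Wle[of i] \<epsilon> by (intro mult_left_mono) auto
      qed
      also have "\<dots> = \<bar>e i\<bar> * (\<eta> / 2)" using pa by (simp add: \<epsilon>_def field_simps)
      finally have 3: "\<epsilon> * W2 \<mu> (\<nu> i) \<le> \<bar>e i\<bar> * (\<eta> / 2)" .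
      have 4: "\<bar>e i\<bar> * (rms \<mu> \<xi> * sqrt (K i)) < \<bar>e i\<bar> * (\<eta> / 2)" using i by (intro mult_strict_left_mono) auto
      have "\<bar>G (\<nu> i) - G \<mu> - e i * L2_inner \<mu> a \<xi>\<bar> < \<bar>e i\<bar> * \<eta>"
        using 1 2 3 4 by (simp add: field_simps)
      then have "\<bar>G (\<nu> i) - G \<mu> - e i * L2_inner \<mu> a \<xi>\<bar> / \<bar>e i\<bar> < \<eta>" using i(4) by (simp add: field_simps)
      moreover have "(G (\<nu> i) - G \<mu>) / e i - L2_inner \<mu> a \<xi> = (G (\<nu> i) - G \<mu> - e i * L2_inner \<mu> a \<xi>) / e i"
        using i(4) by (simp add: field_simps)
      ultimately show "dist ((G (\<nu> i) - G \<mu>) / e i) (L2_inner \<mu> a \<xi>) < \<eta>"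
        by (simp add: dist_real_def abs_divide)
    qed
  qed
  then show ?thesis by (simp add: \<nu>_def T_def[abs_def])
qed

corollary derivative_along_test_gradient:
  assumes \<mu>: "\<mu> \<in> P2" and \<xi>: "\<xi> \<in> wsubdiff G \<mu>" and a: "a \<in> test_gradients"
  shows "((\<lambda>t. G (distr \<mu> borel (\<lambda>x. x + t *\<^sub>R a x))) has_real_derivative L2_inner \<mu> a \<xi>) (at 0)"
proof -
  have z: "(\<lambda>_. 0) \<in> sqint \<mu>" "rms \<mu> (\<lambda>_. 0) = 0" by (auto simp: sqint_def rms_def)
  have "((\<lambda>t. (G (distr \<mu> borel (\<lambda>x. x + t *\<^sub>R (a x + 0))) - G \<mu>) / t) \<longlongrightarrow> L2_inner \<mu> a \<xi>) (at 0)"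
    by (rule derivative_along_perturbation[OF \<mu> \<xi> a])
       (auto simp: z eventually_at_filter intro!: tendsto_ident_at)
  moreover have "distr \<mu> borel (\<lambda>x. x) = \<mu>" using P2_distr_id[OF \<mu>] .
  ultimately show ?thesis by (simp add: DERIV_def)
qed

text \<open>Both sides are the derivative of \<open>G\<close> along \<open>a\<close>.\<close>

corollary dir_deriv_eq:
  assumes \<mu>: "\<mu> \<in> P2" and \<xi>: "\<xi> \<in> wsubdiff G \<mu>" and a: "a \<in> test_gradients"
  shows "dir_deriv a G \<mu> = L2_inner \<mu> a \<xi>"
proof -
  have "wdifferentiable G \<mu>" using \<xi> by (auto simp: wdifferentiable_def)
  from derivative_along_test_gradient[OF \<mu> wgrad_in_wsubdiff[OF \<mu> this] a]
    derivative_along_test_gradient[OF \<mu> \<xi> a]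
  show ?thesis unfolding dir_deriv_def using DERIV_unique by blast
qed

section \<open>The Hessian as a bounded bilinear form\<close>

lemma L2_inner_linear:
  assumes "\<xi> \<in> sqint \<mu>" "\<eta> \<in> sqint \<mu>" "\<zeta> \<in> sqint \<mu>"
  shows "L2_inner \<mu> (\<lambda>x. a *\<^sub>R \<xi> x + b *\<^sub>R \<eta> x) \<zeta> = a * L2_inner \<mu> \<xi> \<zeta> + b * L2_inner \<mu> \<eta> \<zeta>"
    "L2_inner \<mu> \<zeta> (\<lambda>x. a *\<^sub>R \<xi> x + b *\<^sub>R \<eta> x) = a * L2_inner \<mu> \<zeta> \<xi> + b * L2_inner \<mu> \<zeta> \<eta>"
  using sqint_inner[OF assms(1,3)] sqint_inner[OF assms(2,3)] sqint_inner[OF assms(3,1)] sqint_inner[OF assms(3,2)]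
  by (simp_all add: L2_inner_def inner_add_left inner_add_right)

lemma test_gradients_combine:
  assumes "\<zeta>\<^sub>1 \<in> test_gradients" "\<zeta>\<^sub>2 \<in> test_gradients"
  shows "(\<lambda>x. a *\<^sub>R \<zeta>\<^sub>1 x + b *\<^sub>R \<zeta>\<^sub>2 x) \<in> test_gradients"
  using assms by (intro test_gradients_add test_gradients_scale)

lemma test_gradient_derivative:
  assumes "\<zeta> \<in> test_gradients"
  shows "(\<zeta> has_derivative frechet_derivative \<zeta> (at x)) (at x)"
  by (rule test_gradient_facts[OF assms])

lemma jacobian_apply_sqint:
  fixes \<zeta>\<^sub>1 \<zeta>\<^sub>2 :: "'a::euclidean_space \<Rightarrow> 'a"
  assumes \<zeta>\<^sub>1: "\<zeta>\<^sub>1 \<in> test_gradients" and \<zeta>\<^sub>2: "\<zeta>\<^sub>2 \<in> test_gradients" and \<mu>: "\<mu> \<in> P2"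
  shows "(\<lambda>x. frechet_derivative \<zeta>\<^sub>2 (at x) (\<zeta>\<^sub>1 x)) \<in> sqint \<mu>"
proof -
  define f where "f x = frechet_derivative \<zeta>\<^sub>2 (at x) (\<zeta>\<^sub>1 x)" for x
  obtain R where R: "\<And>x. R < norm x \<Longrightarrow> \<zeta>\<^sub>1 x = 0" and s1: "\<And>v. smooth (\<lambda>x. \<zeta>\<^sub>1 x \<bullet> v)"
    by (rule test_gradientD[OF \<zeta>\<^sub>1]) (rule that, assumption+)
  obtain \<phi> :: "'a \<Rightarrow> real" where s2: "\<And>v. smooth (\<lambda>x. \<zeta>\<^sub>2 x \<bullet> v)"
    by (rule test_gradientD[OF \<zeta>\<^sub>2]) (rule that, assumption+)
  note hd = vector_function_has_derivative[OF s2]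
  have lin: "linear (frechet_derivative \<zeta>\<^sub>2 (at x))" for x
    using hd(1) by (rule has_derivative_linear)
  have eq: "f = (\<lambda>x. \<Sum>i\<in>Basis. (\<Sum>b\<in>Basis. (\<zeta>\<^sub>1 x \<bullet> b) * frechet_derivative (\<lambda>x. \<zeta>\<^sub>2 x \<bullet> i) (at x) b) *\<^sub>R i)"
  proof
    fix x
    have "f x \<bullet> i = (\<Sum>b\<in>Basis. (\<zeta>\<^sub>1 x \<bullet> b) * frechet_derivative (\<lambda>x. \<zeta>\<^sub>2 x \<bullet> i) (at x) b)" for i
      using linear_functional_repr[OF has_derivative_linear[OF smoothD(1)[OF s2[of i]]], of x "\<zeta>\<^sub>1 x"]
      by (simp add: f_def hd(2) inner_sum_right mult.commute)
    then show "f x = (\<Sum>i\<in>Basis. (\<Sum>b\<in>Basis. (\<zeta>\<^sub>1 x \<bullet> b) * frechet_derivative (\<lambda>x. \<zeta>\<^sub>2 x \<bullet> i) (at x) b) *\<^sub>R i)"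
      by (metis (no_types, lifting) euclidean_representation sum.cong)
  qed
  have c: "continuous_on UNIV f" unfolding eq
    by (intro continuous_on_sum continuous_on_scaleR continuous_on_mult continuous_on_const
        smoothD(4)[OF s1] smoothD(4)[OF smoothD(3)[OF s2]])
  have "f x = 0" if "R < norm x" for x using R[OF that] linear_0[OF lin] by (simp add: f_def)
  then obtain B where B: "\<And>x. norm (f x) \<le> B"
    using compact_support_bounded[of "\<lambda>x. norm (f x)" R] continuous_on_norm[OF c] by auto
  interpret prob_space \<mu> using P2D[OF \<mu>] by auto
  have "f \<in> sqint \<mu>"
    by (rule sqint_bounded[OF _ B])
       (unfold P2_measurable_iff[OF \<mu>], rule borel_measurable_continuous_onI[OF c])
  then show ?thesis by (simp add: f_def[abs_def])
qed

lemma W2_self: "\<mu> \<in> P2 \<Longrightarrow> W2 \<mu> \<mu> = 0"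
  using W2_self_distr[of \<mu> "\<lambda>x. x"] P2_id_sqint[of \<mu>] P2_distr_id[of \<mu>] W2_nonneg[of \<mu> \<mu>]
  by (simp add: rms_def)

lemma twice_wdifferentiableD:
  assumes \<mu>: "\<mu> \<in> P2" and t: "twice_wdifferentiable F \<mu>"
  shows "wdifferentiable F \<mu>" "\<zeta> \<in> test_gradients \<Longrightarrow> wdifferentiable (\<lambda>\<nu>. dir_deriv \<zeta> F \<nu>) \<mu>"
  using t W2_self[OF \<mu>] \<mu> unfolding twice_wdifferentiable_def pre_hess_exists_def by auto

lemma wsubdiff_cong:
  assumes "\<mu> \<in> P2" "\<And>\<nu>. \<nu> \<in> P2 \<Longrightarrow> G \<nu> = H \<nu>"
  shows "wsubdiff G \<mu> = wsubdiff H \<mu>"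
  using assms by (simp add: wsubdiff_def)

lemma dir_deriv_linear:
  assumes \<mu>: "\<mu> \<in> P2" and d: "wdifferentiable G \<mu>" and s: "\<xi> \<in> sqint \<mu>" "\<eta> \<in> sqint \<mu>"
  shows "dir_deriv (\<lambda>x. a *\<^sub>R \<xi> x + b *\<^sub>R \<eta> x) G \<mu> = a * dir_deriv \<xi> G \<mu> + b * dir_deriv \<eta> G \<mu>"
  unfolding dir_deriv_def
  by (rule L2_inner_linear[OF s wsubdiffD(1)[OF wgrad_in_wsubdiff[OF \<mu> d] zero_less_one]])

lemma pre_hess_linear_left:
  assumes \<mu>: "\<mu> \<in> P2" and t: "twice_wdifferentiable F \<mu>"
    and \<zeta>: "\<zeta>\<^sub>1 \<in> test_gradients" "\<zeta>\<^sub>2 \<in> test_gradients" "\<zeta> \<in> test_gradients"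
  shows "pre_hess F \<mu> (\<lambda>x. a *\<^sub>R \<zeta>\<^sub>1 x + b *\<^sub>R \<zeta>\<^sub>2 x) \<zeta> = a * pre_hess F \<mu> \<zeta>\<^sub>1 \<zeta> + b * pre_hess F \<mu> \<zeta>\<^sub>2 \<zeta>"
proof -
  have "linear (frechet_derivative \<zeta> (at x))" for x
    using test_gradient_derivative[OF \<zeta>(3)] by (rule has_derivative_linear)
  then have "frechet_derivative \<zeta> (at x) (a *\<^sub>R \<zeta>\<^sub>1 x + b *\<^sub>R \<zeta>\<^sub>2 x)
      = a *\<^sub>R frechet_derivative \<zeta> (at x) (\<zeta>\<^sub>1 x) + b *\<^sub>R frechet_derivative \<zeta> (at x) (\<zeta>\<^sub>2 x)" for x
    by (simp add: linear_add linear_scale)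
  then show ?thesis
    unfolding pre_hess_def
    using dir_deriv_linear[OF \<mu> twice_wdifferentiableD(2)[OF \<mu> t \<zeta>(3)] test_gradient_sqint(1)[OF \<zeta>(1) \<mu>]
        test_gradient_sqint(1)[OF \<zeta>(2) \<mu>]]
      dir_deriv_linear[OF \<mu> twice_wdifferentiableD(1)[OF \<mu> t] jacobian_apply_sqint[OF \<zeta>(1,3) \<mu>]
        jacobian_apply_sqint[OF \<zeta>(2,3) \<mu>]]
    by (simp add: algebra_simps)
qed

text \<open>The first term of \<^const>\<open>pre_hess\<close> differentiates the functional \<open>\<nu> \<mapsto> dir_deriv \<zeta> F \<nu>\<close>, which is linear in \<open>\<zeta>\<close>
  at every \<open>\<nu>\<close>.  The minimal gradient of a linear combination is not computed; a linear combination of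
  gradients has the same pairings with test gradients.\<close>

lemma pre_hess_linear_right:
  assumes t: "\<And>\<mu>. \<mu> \<in> P2 \<Longrightarrow> twice_wdifferentiable F \<mu>" and \<mu>: "\<mu> \<in> P2"
    and \<zeta>: "\<zeta>\<^sub>1 \<in> test_gradients" "\<zeta>\<^sub>2 \<in> test_gradients" "\<zeta> \<in> test_gradients"
  shows "pre_hess F \<mu> \<zeta> (\<lambda>x. a *\<^sub>R \<zeta>\<^sub>1 x + b *\<^sub>R \<zeta>\<^sub>2 x) = a * pre_hess F \<mu> \<zeta> \<zeta>\<^sub>1 + b * pre_hess F \<mu> \<zeta> \<zeta>\<^sub>2"
proof -
  have j: "frechet_derivative (\<lambda>x. a *\<^sub>R \<zeta>\<^sub>1 x + b *\<^sub>R \<zeta>\<^sub>2 x) (at x) v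
      = a *\<^sub>R frechet_derivative \<zeta>\<^sub>1 (at x) v + b *\<^sub>R frechet_derivative \<zeta>\<^sub>2 (at x) v" for x v
  proof -
    have "((\<lambda>x. a *\<^sub>R \<zeta>\<^sub>1 x + b *\<^sub>R \<zeta>\<^sub>2 x) has_derivative
        (\<lambda>v. a *\<^sub>R frechet_derivative \<zeta>\<^sub>1 (at x) v + b *\<^sub>R frechet_derivative \<zeta>\<^sub>2 (at x) v)) (at x)"
      by (intro has_derivative_add has_derivative_scaleR_right test_gradient_derivative \<zeta>)
    from frechet_derivative_at[OF this] show ?thesis by metis
  qed
  let ?D = "\<lambda>\<zeta>' \<nu>. dir_deriv \<zeta>' F \<nu>"
  let ?\<zeta> = "\<lambda>x. a *\<^sub>R \<zeta>\<^sub>1 x + b *\<^sub>R \<zeta>\<^sub>2 x"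
  define \<xi>1 where "\<xi>1 = wgrad (?D \<zeta>\<^sub>1) \<mu>"
  define \<xi>2 where "\<xi>2 = wgrad (?D \<zeta>\<^sub>2) \<mu>"
  have x1: "\<xi>1 \<in> wsubdiff (?D \<zeta>\<^sub>1) \<mu>" and x2: "\<xi>2 \<in> wsubdiff (?D \<zeta>\<^sub>2) \<mu>"
    unfolding \<xi>1_def \<xi>2_def by (intro wgrad_in_wsubdiff[OF \<mu>] twice_wdifferentiableD(2)[OF \<mu> t[OF \<mu>]] \<zeta>)+
  have "?D ?\<zeta> \<nu> = a * ?D \<zeta>\<^sub>1 \<nu> + b * ?D \<zeta>\<^sub>2 \<nu>" if "\<nu> \<in> P2" for \<nu>
    by (intro dir_deriv_linear twice_wdifferentiableD(1) t test_gradient_sqint(1) \<zeta> that)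
  then have "(\<lambda>x. a *\<^sub>R \<xi>1 x + b *\<^sub>R \<xi>2 x) \<in> wsubdiff (?D ?\<zeta>) \<mu>"
    using wsubdiff_linear[OF x1 x2, of a b] wsubdiff_cong[OF \<mu>, of "?D ?\<zeta>" "\<lambda>\<nu>. a * ?D \<zeta>\<^sub>1 \<nu> + b * ?D \<zeta>\<^sub>2 \<nu>"]
    by simp
  from dir_deriv_eq[OF \<mu> this \<zeta>(3)]
  have "dir_deriv \<zeta> (?D ?\<zeta>) \<mu> = a * L2_inner \<mu> \<zeta> \<xi>1 + b * L2_inner \<mu> \<zeta> \<xi>2"
    using L2_inner_linear(2)[OF wsubdiffD(1)[OF x1 zero_less_one] wsubdiffD(1)[OF x2 zero_less_one]
      test_gradient_sqint(1)[OF \<zeta>(3) \<mu>]] by simp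
  also have "\<dots> = a * dir_deriv \<zeta> (?D \<zeta>\<^sub>1) \<mu> + b * dir_deriv \<zeta> (?D \<zeta>\<^sub>2) \<mu>"
    by (simp add: dir_deriv_def[of \<zeta>] \<xi>1_def \<xi>2_def)
  finally show ?thesis
    unfolding pre_hess_def j
    using dir_deriv_linear[OF \<mu> twice_wdifferentiableD(1)[OF \<mu> t[OF \<mu>]] jacobian_apply_sqint[OF \<zeta>(3,1) \<mu>]
        jacobian_apply_sqint[OF \<zeta>(3,2) \<mu>]]
    by (simp add: algebra_simps)
qed

lemma pre_hess_bounded:
  assumes \<mu>: "\<mu> \<in> P2" and t: "twice_wdifferentiable F \<mu>"
  obtains C where "C \<ge> 0" "\<And>\<zeta>\<^sub>1 \<zeta>\<^sub>2. \<zeta>\<^sub>1 \<in> test_gradients \<Longrightarrow> \<zeta>\<^sub>2 \<in> test_gradients \<Longrightarrow>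
    \<bar>pre_hess F \<mu> \<zeta>\<^sub>1 \<zeta>\<^sub>2\<bar> \<le> C * rms \<mu> \<zeta>\<^sub>1 * rms \<mu> \<zeta>\<^sub>2"
proof -
  obtain C where C: "\<And>\<zeta>\<^sub>1 \<zeta>\<^sub>2. \<zeta>\<^sub>1 \<in> test_gradients \<Longrightarrow> \<zeta>\<^sub>2 \<in> test_gradients \<Longrightarrow>
    pre_hess F \<mu> \<zeta>\<^sub>1 \<zeta>\<^sub>2 \<le> C * rms \<mu> \<zeta>\<^sub>1 * rms \<mu> \<zeta>\<^sub>2"
    using t by (auto simp: twice_wdifferentiable_def L2_norm_eq_rms)
  show ?thesis
  proof (rule that[of "\<bar>C\<bar>"])
    fix \<zeta>\<^sub>1 \<zeta>\<^sub>2 :: "'a \<Rightarrow> 'a" assume z: "\<zeta>\<^sub>1 \<in> test_gradients" "\<zeta>\<^sub>2 \<in> test_gradients"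
    have "pre_hess F \<mu> (\<lambda>x. (-1) *\<^sub>R \<zeta>\<^sub>1 x) \<zeta>\<^sub>2 = - pre_hess F \<mu> \<zeta>\<^sub>1 \<zeta>\<^sub>2"
      using pre_hess_linear_left[OF \<mu> t z(1) z(1) z(2), of "-1" 0] by simp
    moreover have "pre_hess F \<mu> (\<lambda>x. (-1) *\<^sub>R \<zeta>\<^sub>1 x) \<zeta>\<^sub>2 \<le> C * rms \<mu> (\<lambda>x. (-1) *\<^sub>R \<zeta>\<^sub>1 x) * rms \<mu> \<zeta>\<^sub>2"
      by (intro C test_gradients_scale z)
    ultimately have "\<bar>pre_hess F \<mu> \<zeta>\<^sub>1 \<zeta>\<^sub>2\<bar> \<le> C * rms \<mu> \<zeta>\<^sub>1 * rms \<mu> \<zeta>\<^sub>2"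
      using C[OF z] unfolding rms_scale by simp
    also have "\<dots> \<le> \<bar>C\<bar> * rms \<mu> \<zeta>\<^sub>1 * rms \<mu> \<zeta>\<^sub>2" by (intro mult_right_mono) auto
    finally show "\<bar>pre_hess F \<mu> \<zeta>\<^sub>1 \<zeta>\<^sub>2\<bar> \<le> \<bar>C\<bar> * rms \<mu> \<zeta>\<^sub>1 * rms \<mu> \<zeta>\<^sub>2" .
  qed simp
qed

lemma tangent_space_iff:
  "\<xi> \<in> tangent_space \<mu> \<longleftrightarrow> \<xi> \<in> sqint \<mu> \<and> (\<forall>\<epsilon>>0. \<exists>\<zeta>\<in>test_gradients. rms \<mu> (\<lambda>x. \<xi> x - \<zeta> x) < \<epsilon>)"
  by (simp add: tangent_space_def L2_eq_sqint L2_norm_eq_rms)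

lemma test_gradients_tangent:
  assumes "\<zeta> \<in> test_gradients" "\<mu> \<in> P2"
  shows "\<zeta> \<in> tangent_space \<mu>"
  unfolding tangent_space_iff using test_gradient_sqint(1)[OF assms] assms(1)
  by (auto simp: rms_def intro!: bexI[of _ \<zeta>])

lemma tangent_space_sequence:
  assumes "\<xi> \<in> tangent_space \<mu>"
  obtains z where "\<And>n. z n \<in> test_gradients" "(\<lambda>n. rms \<mu> (\<lambda>x. \<xi> x - z n x)) \<longlonglongrightarrow> 0"
proof -
  have "\<exists>\<zeta>\<in>test_gradients. rms \<mu> (\<lambda>x. \<xi> x - \<zeta> x) < 1 / Suc n" for n :: nat
    using assms by (simp add: tangent_space_iff)
  then obtain z where z: "\<And>n::nat. z n \<in> test_gradients" "\<And>n::nat. rms \<mu> (\<lambda>x. \<xi> x - z n x) < 1 / Suc n" by metis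
  have "(\<lambda>n. 1 / real (Suc n)) \<longlonglongrightarrow> 0" using LIMSEQ_inverse_real_of_nat by (simp add: inverse_eq_divide)
  then have "(\<lambda>n. rms \<mu> (\<lambda>x. \<xi> x - z n x)) \<longlonglongrightarrow> 0"
    by (rule Lim_null_comparison[rotated]) (use less_imp_le[OF z(2)] in \<open>simp\<close>)
  with z(1) show ?thesis by (rule that)
qed

lemma tangent_space_combine:
  assumes \<mu>: "\<mu> \<in> P2" and \<xi>: "\<xi> \<in> tangent_space \<mu>" and \<eta>: "\<eta> \<in> tangent_space \<mu>"
    and z: "\<And>n. z n \<in> test_gradients" "(\<lambda>n. rms \<mu> (\<lambda>x. \<xi> x - z n x)) \<longlonglongrightarrow> 0"
    and w: "\<And>n. w n \<in> test_gradients" "(\<lambda>n. rms \<mu> (\<lambda>x. \<eta> x - w n x)) \<longlonglongrightarrow> 0"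
  shows "(\<lambda>n. rms \<mu> (\<lambda>x. (a *\<^sub>R \<xi> x + b *\<^sub>R \<eta> x) - (a *\<^sub>R z n x + b *\<^sub>R w n x))) \<longlonglongrightarrow> 0"
    "(\<lambda>x. a *\<^sub>R \<xi> x + b *\<^sub>R \<eta> x) \<in> tangent_space \<mu>"
proof -
  have s: "\<xi> \<in> sqint \<mu>" "\<eta> \<in> sqint \<mu>" "z n \<in> sqint \<mu>" "w n \<in> sqint \<mu>" for n
    using \<xi> \<eta> test_gradient_sqint(1)[OF z(1) \<mu>] test_gradient_sqint(1)[OF w(1) \<mu>] by (auto simp: tangent_space_iff)
  have le: "rms \<mu> (\<lambda>x. (a *\<^sub>R \<xi> x + b *\<^sub>R \<eta> x) - (a *\<^sub>R z n x + b *\<^sub>R w n x))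
      \<le> \<bar>a\<bar> * rms \<mu> (\<lambda>x. \<xi> x - z n x) + \<bar>b\<bar> * rms \<mu> (\<lambda>x. \<eta> x - w n x)" for n
  proof -
    have "(a *\<^sub>R \<xi> x + b *\<^sub>R \<eta> x) - (a *\<^sub>R z n x + b *\<^sub>R w n x) = a *\<^sub>R (\<xi> x - z n x) + b *\<^sub>R (\<eta> x - w n x)" for x
      by (simp add: algebra_simps)
    then show ?thesis
      using rms_add_le[OF sqint_scale[OF sqint_diff[OF s(1) s(3)[of n]], of a] sqint_scale[OF sqint_diff[OF s(2) s(4)[of n]], of b]]
      by (simp add: rms_scale)
  qed
  have "(\<lambda>n. \<bar>a\<bar> * rms \<mu> (\<lambda>x. \<xi> x - z n x) + \<bar>b\<bar> * rms \<mu> (\<lambda>x. \<eta> x - w n x)) \<longlonglongrightarrow> \<bar>a\<bar> * 0 + \<bar>b\<bar> * 0"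
    by (intro tendsto_intros z w)
  then have "(\<lambda>n. \<bar>a\<bar> * rms \<mu> (\<lambda>x. \<xi> x - z n x) + \<bar>b\<bar> * rms \<mu> (\<lambda>x. \<eta> x - w n x)) \<longlonglongrightarrow> 0" by simp
  then show lim: "(\<lambda>n. rms \<mu> (\<lambda>x. (a *\<^sub>R \<xi> x + b *\<^sub>R \<eta> x) - (a *\<^sub>R z n x + b *\<^sub>R w n x))) \<longlonglongrightarrow> 0"
    by (rule Lim_null_comparison[rotated]) (use le in auto)
  show "(\<lambda>x. a *\<^sub>R \<xi> x + b *\<^sub>R \<eta> x) \<in> tangent_space \<mu>"
    unfolding tangent_space_iff
  proof (intro conjI allI impI)
    show "(\<lambda>x. a *\<^sub>R \<xi> x + b *\<^sub>R \<eta> x) \<in> sqint \<mu>" using s by (intro sqint_add sqint_scale)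
    fix \<epsilon> :: real assume "\<epsilon> > 0"
    then have "\<forall>\<^sub>F n in sequentially. rms \<mu> (\<lambda>x. (a *\<^sub>R \<xi> x + b *\<^sub>R \<eta> x) - (a *\<^sub>R z n x + b *\<^sub>R w n x)) < \<epsilon>"
      using lim by (intro order_tendstoD)
    then obtain n where "rms \<mu> (\<lambda>x. (a *\<^sub>R \<xi> x + b *\<^sub>R \<eta> x) - (a *\<^sub>R z n x + b *\<^sub>R w n x)) < \<epsilon>"
      using eventually_happens'[OF sequentially_bot] by blast
    moreover have "(\<lambda>x. a *\<^sub>R z n x + b *\<^sub>R w n x) \<in> test_gradients" by (rule test_gradients_combine[OF z(1) w(1)])
    ultimately show "\<exists>\<zeta>\<in>test_gradients. rms \<mu> (\<lambda>x. a *\<^sub>R \<xi> x + b *\<^sub>R \<eta> x - \<zeta> x) < \<epsilon>"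
      by (rule bexI[of _ "\<lambda>x. a *\<^sub>R z n x + b *\<^sub>R w n x"])
  qed
qed

text \<open>The values of the extension are limits along approximating sequences of test gradients; the bound
  makes these sequences of values Cauchy, and their limits independent of the choice.\<close>

lemma bilinear_extension:
  fixes \<mu> :: "'a::euclidean_space measure"
  assumes \<mu>: "\<mu> \<in> P2" and C: "C \<ge> 0"
    and left: "\<And>\<zeta>\<^sub>1 \<zeta>\<^sub>2 \<zeta> a b. \<zeta>\<^sub>1 \<in> test_gradients \<Longrightarrow> \<zeta>\<^sub>2 \<in> test_gradients \<Longrightarrow> \<zeta> \<in> test_gradients \<Longrightarrow>
      P (\<lambda>x. a *\<^sub>R \<zeta>\<^sub>1 x + b *\<^sub>R \<zeta>\<^sub>2 x) \<zeta> = a * P \<zeta>\<^sub>1 \<zeta> + b * P \<zeta>\<^sub>2 \<zeta>"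
    and right: "\<And>\<zeta>\<^sub>1 \<zeta>\<^sub>2 \<zeta> a b. \<zeta>\<^sub>1 \<in> test_gradients \<Longrightarrow> \<zeta>\<^sub>2 \<in> test_gradients \<Longrightarrow> \<zeta> \<in> test_gradients \<Longrightarrow>
      P \<zeta> (\<lambda>x. a *\<^sub>R \<zeta>\<^sub>1 x + b *\<^sub>R \<zeta>\<^sub>2 x) = a * P \<zeta> \<zeta>\<^sub>1 + b * P \<zeta> \<zeta>\<^sub>2"
    and bound: "\<And>\<zeta>\<^sub>1 \<zeta>\<^sub>2. \<zeta>\<^sub>1 \<in> test_gradients \<Longrightarrow> \<zeta>\<^sub>2 \<in> test_gradients \<Longrightarrow>
      \<bar>P \<zeta>\<^sub>1 \<zeta>\<^sub>2\<bar> \<le> C * rms \<mu> \<zeta>\<^sub>1 * rms \<mu> \<zeta>\<^sub>2"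
  shows "\<exists>B. tangent_bounded_bilinear \<mu> B \<and> (\<forall>\<zeta>\<^sub>1\<in>test_gradients. \<forall>\<zeta>\<^sub>2\<in>test_gradients. B \<zeta>\<^sub>1 \<zeta>\<^sub>2 = P \<zeta>\<^sub>1 \<zeta>\<^sub>2)"
proof -
  let ?V = "tangent_space \<mu>" and ?D = "test_gradients :: ('a \<Rightarrow> 'a) set"
  have "\<exists>z. (\<forall>n. z n \<in> ?D) \<and> (\<lambda>n. rms \<mu> (\<lambda>x. \<xi> x - z n x)) \<longlonglongrightarrow> 0" if "\<xi> \<in> ?V" for \<xi>
    by (rule tangent_space_sequence[OF that]) blast
  then obtain A where A: "\<And>\<xi> n. \<xi> \<in> ?V \<Longrightarrow> A \<xi> n \<in> ?D"
    "\<And>\<xi>. \<xi> \<in> ?V \<Longrightarrow> (\<lambda>n. rms \<mu> (\<lambda>x. \<xi> x - A \<xi> n x)) \<longlonglongrightarrow> 0" by metis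
  have Ds: "\<zeta> \<in> sqint \<mu>" if "\<zeta> \<in> ?D" for \<zeta> using test_gradient_sqint(1)[OF that \<mu>] .
  have Vs: "\<xi> \<in> sqint \<mu>" if "\<xi> \<in> ?V" for \<xi> using that by (simp add: tangent_space_iff)
  have norms: "(\<lambda>n. rms \<mu> (z n)) \<longlonglongrightarrow> rms \<mu> \<xi>"
    if "\<xi> \<in> ?V" "\<And>n. z n \<in> ?D" "(\<lambda>n. rms \<mu> (\<lambda>x. \<xi> x - z n x)) \<longlonglongrightarrow> 0" for \<xi> z
  proof (rule rms_tendsto)
    show "(\<lambda>n. rms \<mu> (\<lambda>x. z n x - \<xi> x)) \<longlonglongrightarrow> 0" using that(3) by (subst rms_minus_commute)
  qed (use that Ds Vs in auto)
  have diff: "\<bar>P z w - P z' w'\<bar> \<le> C * rms \<mu> (\<lambda>x. z x - z' x) * rms \<mu> w + C * rms \<mu> z' * rms \<mu> (\<lambda>x. w x - w' x)"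
    if D: "z \<in> ?D" "w \<in> ?D" "z' \<in> ?D" "w' \<in> ?D" for z w z' w'
  proof -
    have m: "(\<lambda>x. 1 *\<^sub>R f x + (-1) *\<^sub>R g x) = (\<lambda>x. f x - g x)" for f g :: "'a \<Rightarrow> 'a" by simp
    have d: "(\<lambda>x. z x - z' x) \<in> ?D" "(\<lambda>x. w x - w' x) \<in> ?D"
      using test_gradients_combine[OF D(1,3), of 1 "-1"] test_gradients_combine[OF D(2,4), of 1 "-1"] by simp_all
    have "P z w - P z' w' = P (\<lambda>x. z x - z' x) w + P z' (\<lambda>x. w x - w' x)"
      using left[OF D(1,3,2), of 1 "-1"] right[OF D(2,4,3), of 1 "-1"] by simp
    then show ?thesis using bound[OF d(1) D(2)] bound[OF D(3) d(2)] by linarith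
  qed
  define B where "B \<xi> \<eta> = lim (\<lambda>n. P (A \<xi> n) (A \<eta> n))" for \<xi> \<eta>
  have limA: "(\<lambda>n. P (A \<xi> n) (A \<eta> n)) \<longlonglongrightarrow> B \<xi> \<eta>" if V: "\<xi> \<in> ?V" "\<eta> \<in> ?V" for \<xi> \<eta>
  proof -
    let ?a = "\<lambda>n. rms \<mu> (\<lambda>x. \<xi> x - A \<xi> n x)" and ?b = "\<lambda>n. rms \<mu> (\<lambda>x. \<eta> x - A \<eta> n x)"
    have "Bseq (\<lambda>n. rms \<mu> (A \<xi> n))" "Bseq (\<lambda>n. rms \<mu> (A \<eta> n))"
      using norms[OF V(1) A(1)[OF V(1)] A(2)[OF V(1)]] norms[OF V(2) A(1)[OF V(2)] A(2)[OF V(2)]]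
      by (auto intro!: convergent_imp_Bseq convergentI)
    then obtain K1 K2 where K: "\<And>n. rms \<mu> (A \<xi> n) \<le> K1" "\<And>n. rms \<mu> (A \<eta> n) \<le> K2" "K1 > 0" "K2 > 0"
      unfolding Bseq_def by (metis abs_le_D1 real_norm_def)
    have est: "\<bar>P (A \<xi> n) (A \<eta> n) - P (A \<xi> m) (A \<eta> m)\<bar> \<le> (C * K2 * ?a n + C * K1 * ?b n) + (C * K2 * ?a m + C * K1 * ?b m)" for n m
    proof -
      have t1: "rms \<mu> (\<lambda>x. A \<xi> n x - A \<xi> m x) \<le> ?a n + ?a m"
        using rms_triangle[OF Ds[OF A(1)[OF V(1)]] Vs[OF V(1)] Ds[OF A(1)[OF V(1)]], of n m]
          rms_minus_commute[of \<mu> \<xi> "A \<xi> n"] by simp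
      have t2: "rms \<mu> (\<lambda>x. A \<eta> n x - A \<eta> m x) \<le> ?b n + ?b m"
        using rms_triangle[OF Ds[OF A(1)[OF V(2)]] Vs[OF V(2)] Ds[OF A(1)[OF V(2)]], of n m]
          rms_minus_commute[of \<mu> \<eta> "A \<eta> n"] by simp
      have "\<bar>P (A \<xi> n) (A \<eta> n) - P (A \<xi> m) (A \<eta> m)\<bar>
          \<le> C * rms \<mu> (\<lambda>x. A \<xi> n x - A \<xi> m x) * rms \<mu> (A \<eta> n) + C * rms \<mu> (A \<xi> m) * rms \<mu> (\<lambda>x. A \<eta> n x - A \<eta> m x)"
        by (rule diff) (use A V in auto)
      also have "\<dots> \<le> C * (?a n + ?a m) * K2 + C * K1 * (?b n + ?b m)"
        using t1 t2 K C by (intro add_mono mult_mono mult_left_mono) (auto intro: add_nonneg_nonneg)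
      finally show ?thesis by (simp add: algebra_simps)
    qed
    have "(\<lambda>n. C * K2 * ?a n + C * K1 * ?b n) \<longlonglongrightarrow> C * K2 * 0 + C * K1 * 0"
      by (intro tendsto_intros A V)
    then have z: "(\<lambda>n. C * K2 * ?a n + C * K1 * ?b n) \<longlonglongrightarrow> 0" by simp
    have "Cauchy (\<lambda>n. P (A \<xi> n) (A \<eta> n))"
    proof (rule CauchyI)
      fix e :: real assume "e > 0"
      then have "\<forall>\<^sub>F n in sequentially. C * K2 * ?a n + C * K1 * ?b n < e / 2" using z by (intro order_tendstoD) auto
      then obtain M where M: "\<And>n. n \<ge> M \<Longrightarrow> C * K2 * ?a n + C * K1 * ?b n < e / 2" by (auto simp: eventually_sequentially)
      have "norm (P (A \<xi> m) (A \<eta> m) - P (A \<xi> n) (A \<eta> n)) < e" if "M \<le> m" "M \<le> n" for m n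
        using est[of m n] M[OF that(1)] M[OF that(2)] by simp
      then show "\<exists>M. \<forall>m\<ge>M. \<forall>n\<ge>M. norm (P (A \<xi> m) (A \<eta> m) - P (A \<xi> n) (A \<eta> n)) < e" by blast
    qed
    then show ?thesis unfolding B_def by (simp add: Cauchy_convergent_iff convergent_LIMSEQ_iff)
  qed
  have lim: "(\<lambda>n. P (z n) (w n)) \<longlonglongrightarrow> B \<xi> \<eta>"
    if V: "\<xi> \<in> ?V" "\<eta> \<in> ?V" and z: "\<And>n. z n \<in> ?D" "(\<lambda>n. rms \<mu> (\<lambda>x. \<xi> x - z n x)) \<longlonglongrightarrow> 0"
      and w: "\<And>n. w n \<in> ?D" "(\<lambda>n. rms \<mu> (\<lambda>x. \<eta> x - w n x)) \<longlonglongrightarrow> 0" for \<xi> \<eta> z w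
  proof -
    have t: "(\<lambda>n. rms \<mu> (\<lambda>x. z n x - A \<xi> n x)) \<longlonglongrightarrow> 0"
      if V: "\<xi> \<in> ?V" and z: "\<And>n. z n \<in> ?D" "(\<lambda>n. rms \<mu> (\<lambda>x. \<xi> x - z n x)) \<longlonglongrightarrow> 0" for \<xi> z
    proof (rule Lim_null_comparison)
      show "(\<lambda>n. rms \<mu> (\<lambda>x. \<xi> x - z n x) + rms \<mu> (\<lambda>x. \<xi> x - A \<xi> n x)) \<longlonglongrightarrow> 0"
        using tendsto_add[OF z(2) A(2)[OF V]] by simp
      show "\<forall>\<^sub>F n in sequentially. norm (rms \<mu> (\<lambda>x. z n x - A \<xi> n x))
          \<le> rms \<mu> (\<lambda>x. \<xi> x - z n x) + rms \<mu> (\<lambda>x. \<xi> x - A \<xi> n x)"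
        using rms_triangle[OF Ds[OF z(1)] Vs[OF V] Ds[OF A(1)[OF V]]] rms_minus_commute[of \<mu> \<xi>] by auto
    qed
    have "(\<lambda>n. C * rms \<mu> (\<lambda>x. z n x - A \<xi> n x) * rms \<mu> (w n) + C * rms \<mu> (A \<xi> n) * rms \<mu> (\<lambda>x. w n x - A \<eta> n x))
        \<longlonglongrightarrow> C * 0 * rms \<mu> \<eta> + C * rms \<mu> \<xi> * 0"
      by (intro tendsto_intros t norms V z w A)
    then have "(\<lambda>n. C * rms \<mu> (\<lambda>x. z n x - A \<xi> n x) * rms \<mu> (w n) + C * rms \<mu> (A \<xi> n) * rms \<mu> (\<lambda>x. w n x - A \<eta> n x))
        \<longlonglongrightarrow> 0" by simp
    then have "(\<lambda>n. P (z n) (w n) - P (A \<xi> n) (A \<eta> n)) \<longlonglongrightarrow> 0"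
      by (rule Lim_null_comparison[rotated]) (use diff[OF z(1) w(1) A(1)[OF V(1)] A(1)[OF V(2)]] in auto)
    from tendsto_add[OF this limA[OF V]] show ?thesis by simp
  qed
  have comb: "B (\<lambda>x. a *\<^sub>R \<xi> x + b *\<^sub>R \<eta> x) \<zeta> = a * B \<xi> \<zeta> + b * B \<eta> \<zeta> \<and>
      B \<zeta> (\<lambda>x. a *\<^sub>R \<xi> x + b *\<^sub>R \<eta> x) = a * B \<zeta> \<xi> + b * B \<zeta> \<eta>"
    if V: "\<xi> \<in> ?V" "\<eta> \<in> ?V" "\<zeta> \<in> ?V" for \<xi> \<eta> \<zeta> a b
  proof -
    note c = tangent_space_combine[OF \<mu> V(1,2) A(1)[OF V(1)] A(2)[OF V(1)] A(1)[OF V(2)] A(2)[OF V(2)], of a b]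
    have D: "(\<lambda>x. a *\<^sub>R A \<xi> n x + b *\<^sub>R A \<eta> n x) \<in> ?D" for n
      by (intro test_gradients_combine A V)
    have "(\<lambda>n. P (\<lambda>x. a *\<^sub>R A \<xi> n x + b *\<^sub>R A \<eta> n x) (A \<zeta> n)) \<longlonglongrightarrow> B (\<lambda>x. a *\<^sub>R \<xi> x + b *\<^sub>R \<eta> x) \<zeta>"
      by (rule lim[OF c(2) V(3) D c(1) A(1)[OF V(3)] A(2)[OF V(3)]])
    moreover have "(\<lambda>n. a * P (A \<xi> n) (A \<zeta> n) + b * P (A \<eta> n) (A \<zeta> n)) \<longlonglongrightarrow> a * B \<xi> \<zeta> + b * B \<eta> \<zeta>"
      by (intro tendsto_intros limA V)
    moreover have "(\<lambda>n. P (A \<zeta> n) (\<lambda>x. a *\<^sub>R A \<xi> n x + b *\<^sub>R A \<eta> n x)) \<longlonglongrightarrow> B \<zeta> (\<lambda>x. a *\<^sub>R \<xi> x + b *\<^sub>R \<eta> x)"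
      by (rule lim[OF V(3) c(2) A(1)[OF V(3)] A(2)[OF V(3)] D c(1)])
    moreover have "(\<lambda>n. a * P (A \<zeta> n) (A \<xi> n) + b * P (A \<zeta> n) (A \<eta> n)) \<longlonglongrightarrow> a * B \<zeta> \<xi> + b * B \<zeta> \<eta>"
      by (intro tendsto_intros limA V)
    ultimately show ?thesis
      using left[OF A(1)[OF V(1)] A(1)[OF V(2)] A(1)[OF V(3)]] right[OF A(1)[OF V(1)] A(1)[OF V(2)] A(1)[OF V(3)]]
      by (simp add: LIMSEQ_unique)
  qed
  have "tangent_bounded_bilinear \<mu> B"
    unfolding tangent_bounded_bilinear_def
  proof (intro conjI ballI allI)
    fix \<xi> \<eta> \<zeta> assume V: "\<xi> \<in> ?V" "\<eta> \<in> ?V" "\<zeta> \<in> ?V"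
    show "B (\<lambda>x. \<xi> x + \<eta> x) \<zeta> = B \<xi> \<zeta> + B \<eta> \<zeta>" "B \<zeta> (\<lambda>x. \<xi> x + \<eta> x) = B \<zeta> \<xi> + B \<zeta> \<eta>"
      using comb[OF V, of 1 1] by simp_all
  next
    fix c \<xi> \<zeta> assume V: "\<xi> \<in> ?V" "\<zeta> \<in> ?V"
    show "B (\<lambda>x. c *\<^sub>R \<xi> x) \<zeta> = c * B \<xi> \<zeta>" "B \<zeta> (\<lambda>x. c *\<^sub>R \<xi> x) = c * B \<zeta> \<xi>"
      using comb[OF V(1,1,2), of c 0] by simp_all
  next
    have "\<bar>B \<xi> \<zeta>\<bar> \<le> C * L2_norm \<mu> \<xi> * L2_norm \<mu> \<zeta>" if V: "\<xi> \<in> ?V" "\<zeta> \<in> ?V" for \<xi> \<zeta>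
    proof (rule LIMSEQ_le)
      show "(\<lambda>n. \<bar>P (A \<xi> n) (A \<zeta> n)\<bar>) \<longlonglongrightarrow> \<bar>B \<xi> \<zeta>\<bar>" by (intro tendsto_intros limA V)
      show "(\<lambda>n. C * rms \<mu> (A \<xi> n) * rms \<mu> (A \<zeta> n)) \<longlonglongrightarrow> C * L2_norm \<mu> \<xi> * L2_norm \<mu> \<zeta>"
        unfolding L2_norm_eq_rms by (intro tendsto_intros norms V A)
    qed (use bound A V in auto)
    then show "\<exists>C. \<forall>\<xi>\<in>?V. \<forall>\<zeta>\<in>?V. \<bar>B \<xi> \<zeta>\<bar> \<le> C * L2_norm \<mu> \<xi> * L2_norm \<mu> \<zeta>" by blast
  qed
  moreover have "B \<zeta>\<^sub>1 \<zeta>\<^sub>2 = P \<zeta>\<^sub>1 \<zeta>\<^sub>2" if D: "\<zeta>\<^sub>1 \<in> ?D" "\<zeta>\<^sub>2 \<in> ?D" for \<zeta>\<^sub>1 \<zeta>\<^sub>2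
  proof -
    have z: "(\<lambda>n::nat. rms \<mu> (\<lambda>x. \<zeta> x - \<zeta> x)) \<longlonglongrightarrow> 0" for \<zeta> :: "'a \<Rightarrow> 'a" by (simp add: rms_def)
    have "(\<lambda>n::nat. P \<zeta>\<^sub>1 \<zeta>\<^sub>2) \<longlonglongrightarrow> B \<zeta>\<^sub>1 \<zeta>\<^sub>2"
      using lim[OF test_gradients_tangent[OF D(1) \<mu>] test_gradients_tangent[OF D(2) \<mu>], of "\<lambda>_. \<zeta>\<^sub>1" "\<lambda>_. \<zeta>\<^sub>2"] D z by blast
    then show ?thesis using LIMSEQ_unique tendsto_const by blast
  qed
  ultimately show ?thesis by blast
qed

theorem Hess_extends_pre_hess:
  assumes t: "\<And>\<mu>. \<mu> \<in> P2 \<Longrightarrow> twice_wdifferentiable F \<mu>" and \<mu>: "\<mu> \<in> P2"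
  shows "tangent_bounded_bilinear \<mu> (Hess F \<mu>)"
    "\<zeta>\<^sub>1 \<in> test_gradients \<Longrightarrow> \<zeta>\<^sub>2 \<in> test_gradients \<Longrightarrow> Hess F \<mu> \<zeta>\<^sub>1 \<zeta>\<^sub>2 = pre_hess F \<mu> \<zeta>\<^sub>1 \<zeta>\<^sub>2"
proof -
  obtain C where C: "C \<ge> 0" "\<And>\<zeta>\<^sub>1 \<zeta>\<^sub>2. \<zeta>\<^sub>1 \<in> test_gradients \<Longrightarrow> \<zeta>\<^sub>2 \<in> test_gradients \<Longrightarrow>
    \<bar>pre_hess F \<mu> \<zeta>\<^sub>1 \<zeta>\<^sub>2\<bar> \<le> C * rms \<mu> \<zeta>\<^sub>1 * rms \<mu> \<zeta>\<^sub>2"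
    by (rule pre_hess_bounded[OF \<mu> t[OF \<mu>]]) (rule that, assumption+)
  have "\<exists>B. tangent_bounded_bilinear \<mu> B \<and>
      (\<forall>\<zeta>\<^sub>1\<in>test_gradients. \<forall>\<zeta>\<^sub>2\<in>test_gradients. B \<zeta>\<^sub>1 \<zeta>\<^sub>2 = pre_hess F \<mu> \<zeta>\<^sub>1 \<zeta>\<^sub>2)"
    by (rule bilinear_extension[OF \<mu> C(1)])
       (intro pre_hess_linear_left[OF \<mu> t[OF \<mu>]] pre_hess_linear_right[OF t \<mu>] C(2); assumption)+
  from someI_ex[OF this]
  show "tangent_bounded_bilinear \<mu> (Hess F \<mu>)"
    "\<zeta>\<^sub>1 \<in> test_gradients \<Longrightarrow> \<zeta>\<^sub>2 \<in> test_gradients \<Longrightarrow> Hess F \<mu> \<zeta>\<^sub>1 \<zeta>\<^sub>2 = pre_hess F \<mu> \<zeta>\<^sub>1 \<zeta>\<^sub>2"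
    unfolding Hess_def by blast+
qed

lemma quadratic_bound_extends:
  assumes \<mu>: "\<mu> \<in> P2" and B: "tangent_bounded_bilinear \<mu> B"
    and D: "\<And>\<zeta>. \<zeta> \<in> test_gradients \<Longrightarrow> l * (rms \<mu> \<zeta>)\<^sup>2 \<le> B \<zeta> \<zeta>"
    and \<xi>: "\<xi> \<in> tangent_space \<mu>"
  shows "l * (rms \<mu> \<xi>)\<^sup>2 \<le> B \<xi> \<xi>"
proof -
  obtain z where z: "\<And>n. z n \<in> test_gradients" "(\<lambda>n. rms \<mu> (\<lambda>x. \<xi> x - z n x)) \<longlonglongrightarrow> 0"
    by (rule tangent_space_sequence[OF \<xi>]) (rule that, assumption+)
  have zV: "z n \<in> tangent_space \<mu>" for n by (rule test_gradients_tangent[OF z(1) \<mu>])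
  have \<xi>s: "\<xi> \<in> sqint \<mu>" using \<xi> by (simp add: tangent_space_iff)
  have zs: "z n \<in> sqint \<mu>" for n using zV by (simp add: tangent_space_iff)
  have "\<exists>C. \<forall>\<xi>\<in>tangent_space \<mu>. \<forall>\<zeta>\<in>tangent_space \<mu>. \<bar>B \<xi> \<zeta>\<bar> \<le> C * rms \<mu> \<xi> * rms \<mu> \<zeta>"
    using B unfolding tangent_bounded_bilinear_def L2_norm_eq_rms by (elim conjE)
  then obtain C where C: "\<And>\<xi> \<zeta>. \<xi> \<in> tangent_space \<mu> \<Longrightarrow> \<zeta> \<in> tangent_space \<mu> \<Longrightarrow> \<bar>B \<xi> \<zeta>\<bar> \<le> C * rms \<mu> \<xi> * rms \<mu> \<zeta>"
    by (elim exE) (rule that, blast)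
  have dV: "(\<lambda>x. \<xi> x - z n x) \<in> tangent_space \<mu>" for n
  proof -
    have "(\<lambda>k::nat. rms \<mu> (\<lambda>x. z n x - z n x)) \<longlonglongrightarrow> 0" by (simp add: rms_def)
    from tangent_space_combine(2)[OF \<mu> \<xi> zV z, where w="\<lambda>_. z n" and a=1 and b="-1", OF z(1) this]
    show ?thesis by simp
  qed
  have add: "B (\<lambda>x. f x + g x) h = B f h + B g h \<and> B h (\<lambda>x. f x + g x) = B h f + B h g"
    if "f \<in> tangent_space \<mu>" "g \<in> tangent_space \<mu>" "h \<in> tangent_space \<mu>" for f g h
    using B that by (simp add: tangent_bounded_bilinear_def)
  have est: "norm (B \<xi> \<xi> - B (z n) (z n)) \<le> C * rms \<mu> (\<lambda>x. \<xi> x - z n x) * rms \<mu> \<xi> + C * rms \<mu> (z n) * rms \<mu> (\<lambda>x. \<xi> x - z n x)" for n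
  proof -
    have "B \<xi> \<xi> = B (\<lambda>x. \<xi> x - z n x) \<xi> + B (z n) \<xi>" using add[OF dV[of n] zV[of n] \<xi>] by simp
    moreover have "B (z n) \<xi> = B (z n) (\<lambda>x. \<xi> x - z n x) + B (z n) (z n)" using add[OF dV[of n] zV[of n] zV[of n]] by simp
    ultimately show ?thesis using C[OF dV[of n] \<xi>] C[OF zV dV, of n n] by simp
  qed
  have n: "(\<lambda>n. rms \<mu> (z n)) \<longlonglongrightarrow> rms \<mu> \<xi>"
    by (rule rms_tendsto[OF zs \<xi>s]) (use z(2) in \<open>subst rms_minus_commute\<close>)
  have "(\<lambda>n. C * rms \<mu> (\<lambda>x. \<xi> x - z n x) * rms \<mu> \<xi> + C * rms \<mu> (z n) * rms \<mu> (\<lambda>x. \<xi> x - z n x)) \<longlonglongrightarrow> C * 0 * rms \<mu> \<xi> + C * rms \<mu> \<xi> * 0"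
    by (intro tendsto_intros n z)
  then have lim0: "(\<lambda>n. C * rms \<mu> (\<lambda>x. \<xi> x - z n x) * rms \<mu> \<xi> + C * rms \<mu> (z n) * rms \<mu> (\<lambda>x. \<xi> x - z n x)) \<longlonglongrightarrow> 0"
    by simp
  have "(\<lambda>n. B \<xi> \<xi> - B (z n) (z n)) \<longlonglongrightarrow> 0"
    by (rule Lim_null_comparison[OF always_eventually lim0]) (intro allI est)
  from tendsto_diff[OF tendsto_const[of "B \<xi> \<xi>"] this] have "(\<lambda>n. B (z n) (z n)) \<longlonglongrightarrow> B \<xi> \<xi>" by simp
  moreover have "(\<lambda>n. l * (rms \<mu> (z n))\<^sup>2) \<longlonglongrightarrow> l * (rms \<mu> \<xi>)\<^sup>2" by (intro tendsto_intros n)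
  ultimately show ?thesis by (intro LIMSEQ_le[of "\<lambda>n. l * (rms \<mu> (z n))\<^sup>2" _ "\<lambda>n. B (z n) (z n)"]) (use D z(1) in auto)
qed

section \<open>Convexity bounds the Hessian from below\<close>

text \<open>For small \<open>s\<close> the geodesic from \<open>\<nu>\<close> to its image under \<open>id + s\<zeta>\<close> is unique, so the one provided by
  geodesic convexity moves along \<open>\<zeta>\<close>.  Dividing the convexity inequality by \<open>t\<close> and letting \<open>t\<close> tend
  to zero yields the claim.\<close>

lemma convexity_first_order:
  fixes F :: "'a::euclidean_space measure \<Rightarrow> real"
  assumes conv: "geodesically_convex l F" and d: "\<And>\<nu>. \<nu> \<in> P2 \<Longrightarrow> wdifferentiable F \<nu>"
    and \<zeta>: "\<zeta> \<in> test_gradients"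
  obtains s0 where "s0 > 0" "\<And>s \<nu>. \<bar>s\<bar> < s0 \<Longrightarrow> \<nu> \<in> P2 \<Longrightarrow>
    F \<nu> + s * dir_deriv \<zeta> F \<nu> + l / 2 * s\<^sup>2 * (rms \<nu> \<zeta>)\<^sup>2 \<le> F (distr \<nu> borel (\<lambda>x. x + s *\<^sub>R \<zeta> x))"
proof -
  obtain s0 where s0: "s0 > 0" and uniq: "\<And>s \<mu> \<gamma>. \<bar>s\<bar> < s0 \<Longrightarrow> \<mu> \<in> P2 \<Longrightarrow>
    \<gamma> \<in> optimal_couplings \<mu> (distr \<mu> borel (\<lambda>x. x + s *\<^sub>R \<zeta> x)) \<Longrightarrow>
    \<gamma> = distr \<mu> borel (\<lambda>x. (x, x + s *\<^sub>R \<zeta> x))"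
    by (rule small_displacement_optimal_unique[OF \<zeta>]) (rule that, assumption+)
  have "F \<nu> + s * dir_deriv \<zeta> F \<nu> + l / 2 * s\<^sup>2 * (rms \<nu> \<zeta>)\<^sup>2 \<le> F (distr \<nu> borel (\<lambda>x. x + s *\<^sub>R \<zeta> x))"
    if s: "\<bar>s\<bar> < s0" and \<nu>: "\<nu> \<in> P2" for s \<nu>
  proof -
    define h where "h u = F (distr \<nu> borel (\<lambda>x. x + u *\<^sub>R \<zeta> x))" for u
    define \<nu>' where "\<nu>' = distr \<nu> borel (\<lambda>x. x + s *\<^sub>R \<zeta> x)"
    have \<zeta>s: "\<zeta> \<in> sqint \<nu>" and [measurable]: "\<zeta> \<in> borel_measurable borel" using test_gradient_sqint[OF \<zeta> \<nu>] by auto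
    have [measurable_cong]: "sets \<nu> = sets borel" using P2D[OF \<nu>] by auto
    have Ts: "(\<lambda>x. x + s *\<^sub>R \<zeta> x) \<in> sqint \<nu>" by (intro sqint_add sqint_scale P2_id_sqint \<nu> \<zeta>s)
    have \<nu>'P: "\<nu>' \<in> P2" unfolding \<nu>'_def using P2D(1)[OF \<nu>] Ts by (rule distr_in_P2)
    have h0: "h 0 = F \<nu>" using P2_distr_id[OF \<nu>] by (simp add: h_def)
    obtain m where m: "is_geodesic \<nu> \<nu>' m" "\<And>t. t \<in> {0..1} \<Longrightarrow>
      F (m t) \<le> (1 - t) * F \<nu> + t * F \<nu>' - l / 2 * t * (1 - t) * (W2 \<nu> \<nu>')\<^sup>2"
      using conv \<nu> \<nu>'P unfolding geodesically_convex_def by blast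
    obtain \<gamma> where o: "\<gamma> \<in> optimal_couplings \<nu> \<nu>'"
      and mt: "\<And>t. t \<in> {0..1} \<Longrightarrow> m t = distr \<gamma> borel (\<lambda>z. (1 - t) *\<^sub>R fst z + t *\<^sub>R snd z)"
      using m(1) unfolding is_geodesic_def by blast
    have g: "\<gamma> = distr \<nu> borel (\<lambda>x. (x, x + s *\<^sub>R \<zeta> x))" using uniq[OF s \<nu>] o by (simp add: \<nu>'_def)
    have [measurable]: "(\<lambda>x. (x, x + s *\<^sub>R \<zeta> x)) \<in> borel_measurable borel" by (intro borel_measurable_Pair; measurable)
    have Fm: "F (m t) = h (t * s)" if "t \<in> {0..1}" for t
    proof -
      have "m t = distr \<nu> borel (\<lambda>x. (1 - t) *\<^sub>R x + t *\<^sub>R (x + s *\<^sub>R \<zeta> x))"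
        unfolding mt[OF that] g by (subst distr_distr) (auto simp: o_def)
      also have "(\<lambda>x. (1 - t) *\<^sub>R x + t *\<^sub>R (x + s *\<^sub>R \<zeta> x)) = (\<lambda>x. x + (t * s) *\<^sub>R \<zeta> x)"
        by (simp add: algebra_simps fun_eq_iff)
      finally show ?thesis by (simp add: h_def)
    qed
    have W: "(W2 \<nu> \<nu>')\<^sup>2 = s\<^sup>2 * (rms \<nu> \<zeta>)\<^sup>2"
    proof -
      have "(W2 \<nu> \<nu>')\<^sup>2 = (rms \<nu> (\<lambda>x. x - (x + s *\<^sub>R \<zeta> x)))\<^sup>2"
        using optimal_couplingD(2)[OF o] coupling_of_random_variables(2)[OF P2D(1)[OF \<nu>] P2_id_sqint[OF \<nu>] Ts]
        by (simp add: g)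
      also have "\<dots> = s\<^sup>2 * (rms \<nu> \<zeta>)\<^sup>2" using rms_scale[of \<nu> "-s" \<zeta>] by (simp add: power_mult_distrib)
      finally show ?thesis .
    qed
    have "(h has_real_derivative dir_deriv \<zeta> F \<nu>) (at 0)"
      unfolding h_def dir_deriv_def
      by (rule derivative_along_test_gradient[OF \<nu> wgrad_in_wsubdiff[OF \<nu> d[OF \<nu>]] \<zeta>])
    then have "((\<lambda>t. h (t * s)) has_real_derivative dir_deriv \<zeta> F \<nu> * s) (at 0)"
      by (intro DERIV_chain2[where f=h]) (auto intro!: derivative_eq_intros)
    then have "((\<lambda>t. (h (t * s) - F \<nu>) / t) \<longlongrightarrow> dir_deriv \<zeta> F \<nu> * s) (at 0)"
      by (simp add: DERIV_def h0)
    then have lim: "((\<lambda>t. (h (t * s) - F \<nu>) / t) \<longlongrightarrow> dir_deriv \<zeta> F \<nu> * s) (at_right 0)"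
      by (rule tendsto_within_subset) auto
    have "((\<lambda>t. F \<nu>' - F \<nu> - l / 2 * (1 - t) * (s\<^sup>2 * (rms \<nu> \<zeta>)\<^sup>2))
        \<longlongrightarrow> F \<nu>' - F \<nu> - l / 2 * (1 - 0) * (s\<^sup>2 * (rms \<nu> \<zeta>)\<^sup>2)) (at_right 0)"
      by (intro tendsto_intros)
    moreover have "\<forall>\<^sub>F t in at_right 0. (h (t * s) - F \<nu>) / t \<le> F \<nu>' - F \<nu> - l / 2 * (1 - t) * (s\<^sup>2 * (rms \<nu> \<zeta>)\<^sup>2)"
      unfolding eventually_at_right_field
    proof (intro exI[of _ 1] conjI allI impI)
      fix t :: real assume t: "0 < t" "t < 1"
      have "F (m t) \<le> (1 - t) * F \<nu> + t * F \<nu>' - l / 2 * t * (1 - t) * (W2 \<nu> \<nu>')\<^sup>2" using m(2) t by simp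
      moreover have "F (m t) = h (t * s)" using Fm t by simp
      ultimately have "h (t * s) - F \<nu> \<le> t * (F \<nu>' - F \<nu> - l / 2 * (1 - t) * (s\<^sup>2 * (rms \<nu> \<zeta>)\<^sup>2))"
        unfolding W by (simp add: algebra_simps)
      then show "(h (t * s) - F \<nu>) / t \<le> F \<nu>' - F \<nu> - l / 2 * (1 - t) * (s\<^sup>2 * (rms \<nu> \<zeta>)\<^sup>2)"
        using t by (simp add: pos_divide_le_eq mult.commute)
    qed simp
    ultimately have "dir_deriv \<zeta> F \<nu> * s \<le> F \<nu>' - F \<nu> - l / 2 * (1 - 0) * (s\<^sup>2 * (rms \<nu> \<zeta>)\<^sup>2)"
      by (intro tendsto_le[OF _ _ lim]) auto
    then show ?thesis by (simp add: \<nu>'_def algebra_simps)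
  qed
  with s0 show ?thesis by (rule that)
qed

text \<open>The first-order inequality is used at \<open>\<mu>\<close> with displacement \<open>\<tau>\<zeta>\<close>, leading to \<open>\<mu>\<^sub>\<tau>\<close>, and at \<open>\<mu>\<^sub>\<tau>\<close> with
  displacement \<open>-\<tau>\<zeta>\<close>.  The round trip ends at the image of \<open>\<mu>\<close> under \<open>id - \<tau>\<^sup>2 \<nabla>\<zeta> \<zeta> + o(\<tau>\<^sup>2)\<close>, which is
  where the acceleration term of the Hessian comes from.  Expanding \<open>F\<close> there uses differentiability
  at the fixed measure \<open>\<mu>\<close> only.  Differentiating \<open>F\<close> twice along \<open>\<tau> \<mapsto> \<mu>\<^sub>\<tau>\<close> instead would
  bring in the gradients of \<open>F\<close> at \<open>\<mu>\<^sub>\<tau>\<close>, for which no bound uniform in \<open>\<tau>\<close> is at hand.\<close>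

theorem convex_imp_pre_hess_ge:
  fixes F :: "'a::euclidean_space measure \<Rightarrow> real"
  assumes conv: "geodesically_convex l F" and t: "\<And>\<mu>. \<mu> \<in> P2 \<Longrightarrow> twice_wdifferentiable F \<mu>"
    and \<mu>: "\<mu> \<in> P2" and \<zeta>: "\<zeta> \<in> test_gradients"
  shows "l * (rms \<mu> \<zeta>)\<^sup>2 \<le> pre_hess F \<mu> \<zeta> \<zeta>"
proof -
  have d: "wdifferentiable F \<nu>" if "\<nu> \<in> P2" for \<nu> using twice_wdifferentiableD(1)[OF that t[OF that]] .
  obtain s0 where s0: "s0 > 0" and first: "\<And>s \<nu>. \<bar>s\<bar> < s0 \<Longrightarrow> \<nu> \<in> P2 \<Longrightarrow>
    F \<nu> + s * dir_deriv \<zeta> F \<nu> + l / 2 * s\<^sup>2 * (rms \<nu> \<zeta>)\<^sup>2 \<le> F (distr \<nu> borel (\<lambda>x. x + s *\<^sub>R \<zeta> x))"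
    by (rule convexity_first_order[OF conv d \<zeta>]) (assumption, rule that, assumption+)
  obtain \<phi> B L where B: "B \<ge> 0" and L: "L > 0" and \<phi>c: "continuous_on UNIV (\<phi> :: 'a \<Rightarrow> real)" and \<phi>B: "\<And>x. \<bar>\<phi> x\<bar> \<le> B"
    and \<zeta>B: "\<And>x. norm (\<zeta> x) \<le> B" and \<zeta>c: "continuous_on UNIV \<zeta>"
    and lip: "\<And>x y. norm (\<zeta> x - \<zeta> y) \<le> L * norm (x - y)"
    and tay: "\<And>x y. \<bar>\<phi> y - \<phi> x - \<zeta> x \<bullet> (y - x)\<bar> \<le> L * (norm (y - x))\<^sup>2"
    and hd: "\<And>x. (\<zeta> has_derivative frechet_derivative \<zeta> (at x)) (at x)"
    by (rule test_gradient_facts[OF \<zeta>]) (rule that, assumption+)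
  define a where "a x = frechet_derivative \<zeta> (at x) (\<zeta> x)" for x
  have aD: "a \<in> test_gradients" unfolding a_def[abs_def] by (rule acceleration_test_gradient[OF \<zeta>])
  obtain A where aA: "\<And>x. norm (a x) \<le> A" by (rule test_gradient_facts[OF aD]) (rule that, assumption+)
  define g where "g \<nu> = dir_deriv \<zeta> F \<nu>" for \<nu>
  have gd: "wdifferentiable g \<mu>" unfolding g_def[abs_def] using twice_wdifferentiableD(2)[OF \<mu> t[OF \<mu>] \<zeta>] .
  interpret prob_space \<mu> using P2D[OF \<mu>] by auto
  have [measurable_cong]: "sets \<mu> = sets borel" using P2D[OF \<mu>] by auto
  have \<zeta>s: "\<zeta> \<in> sqint \<mu>" and [measurable]: "\<zeta> \<in> borel_measurable borel" using test_gradient_sqint[OF \<zeta> \<mu>] by auto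
  have as: "a \<in> sqint \<mu>" and [measurable]: "a \<in> borel_measurable borel" using test_gradient_sqint[OF aD \<mu>] by auto
  define \<tau> where "\<tau> n = 1 / real (Suc n)" for n
  have \<tau>0: "\<tau> n > 0" for n by (simp add: \<tau>_def)
  have \<tau>lim: "\<tau> \<longlonglongrightarrow> 0" unfolding \<tau>_def using LIMSEQ_inverse_real_of_nat by (simp add: inverse_eq_divide)
  define T where "T n x = x + \<tau> n *\<^sub>R \<zeta> x" for n x
  define m where "m n = distr \<mu> borel (T n)" for n
  have [measurable]: "T n \<in> borel_measurable borel" for n unfolding T_def by measurable
  have mP: "m n \<in> P2" for n unfolding m_def T_def
    by (intro distr_in_P2 P2D(1)[OF \<mu>] sqint_add sqint_scale P2_id_sqint \<mu> \<zeta>s)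
  \<comment> \<open>Moving by \<open>\<tau> \<zeta>\<close> and then back by \<open>- \<tau> \<zeta>\<close> leaves the displacement \<open>- \<tau>\<^sup>2 (a + r)\<close>.\<close>
  define r where "r n x = (\<zeta> (T n x) - \<zeta> x) /\<^sub>R \<tau> n - a x" for n x
  have [measurable]: "r n \<in> borel_measurable borel" for n unfolding r_def by measurable
  have rB: "norm (r n x) \<le> L * B + A" for n x
  proof -
    have "norm (\<zeta> (T n x) - \<zeta> x) \<le> L * norm (\<tau> n *\<^sub>R \<zeta> x)" using lip[of "T n x" x] by (simp add: T_def)
    also have "\<dots> \<le> L * (\<tau> n * B)" using \<tau>0[of n] \<zeta>B[of x] L by (intro mult_left_mono) (auto intro: mult_left_mono)
    finally have "norm (\<zeta> (T n x) - \<zeta> x) / \<tau> n \<le> L * B"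
      using \<tau>0[of n] by (simp add: pos_divide_le_eq mult_ac)
    moreover have "norm ((\<zeta> (T n x) - \<zeta> x) /\<^sub>R \<tau> n) = norm (\<zeta> (T n x) - \<zeta> x) / \<tau> n"
      using \<tau>0[of n] by (simp only: norm_scaleR abs_inverse abs_of_pos divide_inverse_commute)
    ultimately have "norm ((\<zeta> (T n x) - \<zeta> x) /\<^sub>R \<tau> n) \<le> L * B" by simp
    then show ?thesis unfolding r_def using norm_triangle_ineq4[of "(\<zeta> (T n x) - \<zeta> x) /\<^sub>R \<tau> n" "a x"] aA[of x] by linarith
  qed
  have rs: "r n \<in> sqint \<mu>" for n by (rule sqint_bounded[OF _ rB]) simp
  have rlim: "(\<lambda>n. r n x) \<longlonglongrightarrow> 0" for x
  proof -
    have "((\<lambda>h. x + h *\<^sub>R \<zeta> x) has_vector_derivative \<zeta> x) (at 0)"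
      by (auto intro!: derivative_eq_intros simp: has_vector_derivative_def)
    then have "((\<lambda>h. \<zeta> (x + h *\<^sub>R \<zeta> x)) has_vector_derivative a x) (at 0)"
      using vector_derivative_diff_chain_within[of "\<lambda>h. x + h *\<^sub>R \<zeta> x" "\<zeta> x" 0 UNIV \<zeta> "frechet_derivative \<zeta> (at x)"] hd[of x]
      by (simp add: a_def o_def has_derivative_at_withinI)
    then have "((\<lambda>h. norm (\<zeta> (x + h *\<^sub>R \<zeta> x) - \<zeta> x - h *\<^sub>R a x) / norm h) \<longlongrightarrow> 0) (at 0)"
      by (simp add: has_vector_derivative_def has_derivative_at)
    then have "(\<lambda>n. norm (\<zeta> (x + \<tau> n *\<^sub>R \<zeta> x) - \<zeta> x - \<tau> n *\<^sub>R a x) / norm (\<tau> n)) \<longlonglongrightarrow> 0"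
      by (rule filterlim_compose) (use \<tau>lim \<tau>0 in \<open>auto simp: filterlim_at less_imp_neq[symmetric]\<close>)
    moreover have "norm (\<zeta> (x + \<tau> n *\<^sub>R \<zeta> x) - \<zeta> x - \<tau> n *\<^sub>R a x) / norm (\<tau> n) = norm (r n x)" for n
    proof -
      have "r n x = (\<zeta> (x + \<tau> n *\<^sub>R \<zeta> x) - \<zeta> x - \<tau> n *\<^sub>R a x) /\<^sub>R \<tau> n"
        using \<tau>0[of n] by (simp add: r_def T_def scaleR_diff_right)
      then show ?thesis by (simp add: divide_inverse_commute)
    qed
    ultimately have "(\<lambda>n. norm (r n x)) \<longlonglongrightarrow> 0" by simp
    then show ?thesis by (rule tendsto_norm_zero_cancel)
  qed
  have r0: "(\<lambda>n. rms \<mu> (r n)) \<longlonglongrightarrow> 0"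
  proof -
    have "(\<lambda>n. LINT x|\<mu>. (norm (r n x))\<^sup>2) \<longlonglongrightarrow> (LINT x|\<mu>. 0)"
    proof (rule integral_dominated_convergence[where w="\<lambda>_. (L * B + A)\<^sup>2"])
      show "AE x in \<mu>. (\<lambda>n. (norm (r n x))\<^sup>2) \<longlonglongrightarrow> 0"
        using tendsto_power[OF tendsto_norm[OF rlim], where n=2] by simp
      show "AE x in \<mu>. norm ((norm (r n x))\<^sup>2) \<le> (L * B + A)\<^sup>2" for n
        using rB by (auto intro!: power_mono)
    qed auto
    from tendsto_real_sqrt[OF this] show ?thesis by (simp add: rms_def)
  qed
  have round_trip: "distr (m n) borel (\<lambda>x. x + (- \<tau> n) *\<^sub>R \<zeta> x) = distr \<mu> borel (\<lambda>x. x + (- (\<tau> n)\<^sup>2) *\<^sub>R (a x + r n x))" for n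
  proof -
    have "distr (m n) borel (\<lambda>x. x + (- \<tau> n) *\<^sub>R \<zeta> x) = distr \<mu> borel (\<lambda>x. T n x + (- \<tau> n) *\<^sub>R \<zeta> (T n x))"
      unfolding m_def by (subst distr_distr) (auto simp: o_def)
    also have "(\<lambda>x. T n x + (- \<tau> n) *\<^sub>R \<zeta> (T n x)) = (\<lambda>x. x + (- (\<tau> n)\<^sup>2) *\<^sub>R (a x + r n x))"
    proof
      fix x
      have "(\<tau> n)\<^sup>2 *\<^sub>R (a x + r n x) = \<tau> n *\<^sub>R (\<zeta> (T n x) - \<zeta> x)"
        using \<tau>0[of n] by (simp add: r_def power2_eq_square)
      then show "T n x + (- \<tau> n) *\<^sub>R \<zeta> (T n x) = x + (- (\<tau> n)\<^sup>2) *\<^sub>R (a x + r n x)"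
        by (simp add: T_def algebra_simps)
    qed
    finally show ?thesis .
  qed
  have lim1: "(\<lambda>n. (F (distr \<mu> borel (\<lambda>x. x + (- (\<tau> n)\<^sup>2) *\<^sub>R (a x + r n x))) - F \<mu>) / (- (\<tau> n)\<^sup>2)) \<longlonglongrightarrow> dir_deriv a F \<mu>"
    unfolding dir_deriv_def
  proof (rule derivative_along_perturbation[OF \<mu> wgrad_in_wsubdiff[OF \<mu> d[OF \<mu>]] aD _ _ rs r0])
    show "(\<lambda>n. - (\<tau> n)\<^sup>2) \<longlonglongrightarrow> 0" using tendsto_minus[OF tendsto_power[OF \<tau>lim, of 2]] by simp
    show "\<forall>\<^sub>F n in sequentially. - (\<tau> n)\<^sup>2 \<noteq> 0" using \<tau>0 by (auto simp: less_imp_neq[symmetric])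
  qed
  have lim2: "(\<lambda>n. (g (m n) - g \<mu>) / \<tau> n) \<longlonglongrightarrow> dir_deriv \<zeta> g \<mu>"
  proof -
    have "(\<lambda>n. (g (distr \<mu> borel (\<lambda>x. x + \<tau> n *\<^sub>R (\<zeta> x + 0))) - g \<mu>) / \<tau> n) \<longlonglongrightarrow> dir_deriv \<zeta> g \<mu>"
      unfolding dir_deriv_def
      by (rule derivative_along_perturbation[OF \<mu> wgrad_in_wsubdiff[OF \<mu> gd] \<zeta> \<tau>lim])
         (use \<tau>0 in \<open>auto simp: less_imp_neq[symmetric] sqint_def rms_def\<close>)
    then show ?thesis by (simp add: m_def T_def[abs_def])
  qed
  have lim3: "(\<lambda>n. (rms (m n) \<zeta>)\<^sup>2) \<longlonglongrightarrow> (rms \<mu> \<zeta>)\<^sup>2"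
  proof -
    have e: "(rms (m n) \<zeta>)\<^sup>2 = (LINT x|\<mu>. (norm (\<zeta> (T n x)))\<^sup>2)" for n
      unfolding rms_power2 m_def by (subst integral_distr) auto
    show ?thesis unfolding e rms_power2[of \<mu>]
    proof (rule integral_dominated_convergence[where w="\<lambda>_. B\<^sup>2"])
      have "(\<lambda>n. T n x) \<longlonglongrightarrow> x" for x
        unfolding T_def using tendsto_add[OF tendsto_const[of x] tendsto_scaleR[OF \<tau>lim tendsto_const[of "\<zeta> x"]]] by simp
      then have "(\<lambda>n. \<zeta> (T n x)) \<longlonglongrightarrow> \<zeta> x" for x
        by (intro continuous_on_tendsto_compose[OF \<zeta>c]) auto
      then show "AE x in \<mu>. (\<lambda>n. (norm (\<zeta> (T n x)))\<^sup>2) \<longlonglongrightarrow> (norm (\<zeta> x))\<^sup>2"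
        by (auto intro!: tendsto_intros)
      show "AE x in \<mu>. norm ((norm (\<zeta> (T n x)))\<^sup>2) \<le> B\<^sup>2" for n using \<zeta>B by (auto intro!: power_mono)
    qed auto
  qed
  have "\<forall>\<^sub>F n in sequentially. \<tau> n < s0" using \<tau>lim s0 by (rule order_tendstoD)
  then have ev: "\<forall>\<^sub>F n in sequentially.
      (F (distr \<mu> borel (\<lambda>x. x + (- (\<tau> n)\<^sup>2) *\<^sub>R (a x + r n x))) - F \<mu>) / (- (\<tau> n)\<^sup>2)
        + l / 2 * ((rms (m n) \<zeta>)\<^sup>2 + (rms \<mu> \<zeta>)\<^sup>2) \<le> (g (m n) - g \<mu>) / \<tau> n"
  proof eventually_elim
    fix n assume n: "\<tau> n < s0"
    define p where "p = F (distr \<mu> borel (\<lambda>x. x + (- (\<tau> n)\<^sup>2) *\<^sub>R (a x + r n x)))"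
    have 1: "F \<mu> + \<tau> n * g \<mu> + l / 2 * (\<tau> n)\<^sup>2 * (rms \<mu> \<zeta>)\<^sup>2 \<le> F (m n)"
      using first[of "\<tau> n" \<mu>] n \<tau>0[of n] \<mu> by (simp add: m_def T_def[abs_def] g_def)
    have 2: "F (m n) - \<tau> n * g (m n) + l / 2 * (\<tau> n)\<^sup>2 * (rms (m n) \<zeta>)\<^sup>2 \<le> p"
      using first[of "- \<tau> n" "m n"] n \<tau>0[of n] mP[of n] unfolding round_trip by (simp add: p_def g_def)
    have "F \<mu> - p + l / 2 * (\<tau> n)\<^sup>2 * ((rms (m n) \<zeta>)\<^sup>2 + (rms \<mu> \<zeta>)\<^sup>2) \<le> \<tau> n * (g (m n) - g \<mu>)"
      using 1 2 by (simp add: algebra_simps)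
    then have "(F \<mu> - p + l / 2 * (\<tau> n)\<^sup>2 * ((rms (m n) \<zeta>)\<^sup>2 + (rms \<mu> \<zeta>)\<^sup>2)) / (\<tau> n)\<^sup>2 \<le> \<tau> n * (g (m n) - g \<mu>) / (\<tau> n)\<^sup>2"
      by (rule divide_right_mono) simp
    then show "(p - F \<mu>) / (- (\<tau> n)\<^sup>2) + l / 2 * ((rms (m n) \<zeta>)\<^sup>2 + (rms \<mu> \<zeta>)\<^sup>2) \<le> (g (m n) - g \<mu>) / \<tau> n"
      using \<tau>0[of n] by (simp add: add_divide_distrib diff_divide_distrib power2_eq_square)
  qed
  have "dir_deriv a F \<mu> + l / 2 * ((rms \<mu> \<zeta>)\<^sup>2 + (rms \<mu> \<zeta>)\<^sup>2) \<le> dir_deriv \<zeta> g \<mu>"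
    by (rule tendsto_le[OF sequentially_bot lim2 _ ev]) (intro tendsto_intros lim1 lim3)
  then show ?thesis
    by (simp add: pre_hess_def g_def[abs_def] a_def[abs_def])
qed

section \<open>Finitely supported optimal couplings\<close>

lemma finite_support_integral:
  fixes f :: "'b \<Rightarrow> real"
  assumes "prob_space M" and S: "finite S" and sing: "\<And>z. z \<in> S \<Longrightarrow> {z} \<in> sets M"
    and ae: "AE z in M. z \<in> S" and f: "f \<in> borel_measurable M"
  shows "(LINT z|M. f z) = (\<Sum>z\<in>S. f z * measure M {z})"
proof -
  interpret prob_space M by fact
  have "(LINT z|M. f z) = (LINT z|M. (\<Sum>s\<in>S. f s * indicator {s} z))"
  proof (rule integral_cong_AE)
    show "(\<lambda>z. \<Sum>s\<in>S. f s * indicator {s} z) \<in> borel_measurable M"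
      using sing by (intro borel_measurable_sum borel_measurable_times borel_measurable_indicator) auto
    show "AE z in M. f z = (\<Sum>s\<in>S. f s * indicator {s} z)"
      using ae
    proof eventually_elim
      fix z assume "z \<in> S"
      then show "f z = (\<Sum>s\<in>S. f s * indicator {s} z)"
        using S by (simp add: indicator_def sum.delta' if_distrib[of "\<lambda>x. _ * x"] cong: if_cong)
    qed
  qed fact
  also have "\<dots> = (\<Sum>s\<in>S. f s * measure M {s})"
  proof (subst Bochner_Integration.integral_sum)
    show "integrable M (\<lambda>z. f s * indicator {s} z)" if "s \<in> S" for s
      using sing[OF that] by (intro integrable_mult_right integrable_real_indicator) (auto simp: emeasure_eq_measure)
    show "(\<Sum>s\<in>S. LINT z|M. f s * indicator {s} z) = (\<Sum>s\<in>S. f s * measure M {s})"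
      using sing sets.sets_into_space[OF sing] by (intro sum.cong) (auto simp: Int_absorb2)
  qed
  finally show ?thesis .
qed

text \<open>Monotonicity of the support: exchanging the targets of a little mass at two atoms does not
  change the marginals, so it must not lower the cost.\<close>

lemma optimal_atoms_monotone:
  fixes \<gamma> :: "('a::euclidean_space \<times> 'a) measure"
  assumes opt: "\<gamma> \<in> optimal_couplings \<mu> \<nu>" and S: "finite S" and ae: "AE z in \<gamma>. z \<in> S"
    and z0: "measure \<gamma> {z0} > 0" and z1: "measure \<gamma> {z1} > 0"
  shows "0 \<le> (fst z0 - fst z1) \<bullet> (snd z0 - snd z1)"
proof (cases "z0 = z1")
  case ne: False
  have g: "\<gamma> \<in> couplings \<mu> \<nu>" using optimal_couplingD(1)[OF opt] .
  have P: "\<gamma> \<in> P2" using couplingsD(1)[OF g] .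
  interpret prob_space \<gamma> using P2D[OF P] by auto
  have [measurable_cong]: "sets \<gamma> = sets borel" using P2D[OF P] by auto
  define y0 where "y0 = (fst z0, snd z1)"
  define y1 where "y1 = (fst z1, snd z0)"
  define S' where "S' = S \<union> {z0, z1, y0, y1}"
  have S': "finite S'" using S by (simp add: S'_def)
  have mem: "z0 \<in> S'" "z1 \<in> S'" "y0 \<in> S'" "y1 \<in> S'" by (auto simp: S'_def)
  have ae': "AE z in \<gamma>. z \<in> S'" using ae by eventually_elim (simp add: S'_def)
  define w where "w z = measure \<gamma> {z}" for z
  define e where "e = min (w z0) (w z1)"
  have e: "e > 0" using z0 z1 by (simp add: e_def w_def)
  define \<delta> where "\<delta> a z = (if z = a then 1 else 0::real)" for a z :: "'a \<times> 'a"
  define p where "p z = w z + e * (\<delta> y0 z + \<delta> y1 z - \<delta> z0 z - \<delta> z1 z)" for z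
  have w0: "w z = 0" if "z \<notin> S'" for z
  proof -
    have "AE x in \<gamma>. x \<notin> {z}" using ae' by eventually_elim (use that in auto)
    then have "emeasure \<gamma> {z} = 0" using AE_iff_measurable[of "{z}" \<gamma> "\<lambda>x. x \<notin> {z}"] P2D[OF P] by auto
    then show ?thesis by (simp add: w_def measure_def)
  qed
  have p0: "0 \<le> p z" for z
  proof -
    have "w z \<ge> e * (\<delta> z0 z + \<delta> z1 z)" using ne by (auto simp: e_def w_def \<delta>_def)
    moreover have "0 \<le> e * (\<delta> y0 z + \<delta> y1 z)" using e by (auto simp: \<delta>_def)
    ultimately show ?thesis by (simp add: p_def algebra_simps)
  qed
  have pS: "p z = 0" if "z \<notin> S'" for z
    using that w0[OF that] by (auto simp: p_def \<delta>_def S'_def)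
  have delta: "(\<Sum>z\<in>S'. h z * \<delta> a z) = h a" if "a \<in> S'" for h a
    using S' that by (simp add: \<delta>_def if_distrib[of "\<lambda>x. _ * x"] cong: if_cong)
  have psum: "(\<Sum>z\<in>S'. h z * p z) = (LINT z|\<gamma>. h z) + e * (h y0 + h y1 - h z0 - h z1)"
    if "h \<in> borel_measurable borel" for h :: "'a \<times> 'a \<Rightarrow> real"
  proof -
    have "(\<Sum>z\<in>S'. h z * p z) = (\<Sum>z\<in>S'. h z * w z) + e * ((\<Sum>z\<in>S'. h z * \<delta> y0 z) + (\<Sum>z\<in>S'. h z * \<delta> y1 z)
        - (\<Sum>z\<in>S'. h z * \<delta> z0 z) - (\<Sum>z\<in>S'. h z * \<delta> z1 z))"
      by (simp add: p_def sum.distrib sum_subtractf sum_distrib_left algebra_simps)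
    also have "(\<Sum>z\<in>S'. h z * w z) = (LINT z|\<gamma>. h z)"
      unfolding w_def using finite_support_integral[OF _ S' _ ae', of h] that P2D[OF P] P2_measurable_iff[OF P] by simp
    finally show ?thesis using delta mem by simp
  qed
  have "(\<integral>\<^sup>+z. ennreal (p z) \<partial>count_space UNIV) = (\<Sum>z\<in>S'. ennreal (p z))"
    using S' pS by (intro nn_integral_count_space') auto
  also have "\<dots> = 1" using psum[of "\<lambda>_. 1"] p0 by (simp add: sum_ennreal prob_space)
  finally have p1: "(\<integral>\<^sup>+z. ennreal (p z) \<partial>count_space UNIV) = 1" .
  define q where "q = embed_pmf p"
  have q: "pmf q z = p z" for z unfolding q_def using p0 p1 by (rule pmf_embed_pmf)
  have qS: "set_pmf q \<subseteq> S'" using pS by (auto simp: set_pmf_eq q)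
  have qint: "(LINT z|measure_pmf q. h z) = (LINT z|\<gamma>. h z) + e * (h y0 + h y1 - h z0 - h z1)"
    if "h \<in> borel_measurable borel" for h :: "'a \<times> 'a \<Rightarrow> real"
    using integral_measure_pmf_real[OF S', of q h] qS psum[OF that] by (auto simp: q)
  have qi: "integrable (measure_pmf q) h" for h :: "'a \<times> 'a \<Rightarrow> real"
    using finite_subset[OF qS S'] by (rule integrable_measure_pmf_finite)
  have sq: "fst \<in> sqint (measure_pmf q)" "snd \<in> sqint (measure_pmf q)" by (auto simp: sqint_def qi)
  \<comment> \<open>The exchange is invisible to both projections.\<close>
  have marg: "distr (measure_pmf q) borel k = distr \<gamma> borel k"
    if k[measurable]: "k \<in> borel_measurable borel"
      and sw: "\<And>h :: 'a \<Rightarrow> real. h (k y0) + h (k y1) - h (k z0) - h (k z1) = 0" for k :: "'a \<times> 'a \<Rightarrow> 'a"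
  proof (rule measure_eqI)
    fix E assume "E \<in> sets (distr (measure_pmf q) borel k)"
    then have [measurable]: "E \<in> sets borel" by simp
    have i: "indicator (k -` E) z = (indicator E (k z) :: real)" for z by (simp add: indicator_def)
    have "measure (measure_pmf q) (k -` E) = (LINT z|measure_pmf q. indicator (k -` E) z)" by simp
    also have "\<dots> = (LINT z|measure_pmf q. indicator E (k z))" unfolding i ..
    also have "\<dots> = (LINT z|\<gamma>. indicator E (k z)) + e * (indicator E (k y0) + indicator E (k y1) - indicator E (k z0) - indicator E (k z1))"
      by (rule qint) measurable
    also have "\<dots> = (LINT z|\<gamma>. indicator E (k z))" using sw[of "indicator E"] by simp
    also have "\<dots> = measure \<gamma> (k -` E)"
    proof -
      have "k -` E \<in> sets \<gamma>" using measurable_sets[of k borel borel E] P2D[OF P] by auto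
      then have "(LINT z|\<gamma>. indicator (k -` E) z) = measure \<gamma> (k -` E)" using P2D[OF P] by simp
      then show ?thesis unfolding i .
    qed
    finally have "measure (measure_pmf q) (k -` E) = measure \<gamma> (k -` E)" .
    then show "emeasure (distr (measure_pmf q) borel k) E = emeasure (distr \<gamma> borel k) E"
      using P2D[OF P] by (simp add: emeasure_distr emeasure_eq_measure measure_pmf.emeasure_eq_measure)
  qed simp
  have m1: "distr (measure_pmf q) borel fst = \<mu>"
    using marg[of fst] couplingsD(2)[OF g] by (simp add: y0_def y1_def)
  have m2: "distr (measure_pmf q) borel snd = \<nu>"
    using marg[of snd] couplingsD(3)[OF g] by (simp add: y0_def y1_def)
  note c = coupling_of_random_variables[OF measure_pmf.prob_space_axioms sq]
  have "transport_cost \<gamma> \<le> (rms (measure_pmf q) (\<lambda>z. fst z - snd z))\<^sup>2"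
    using optimal_coupling_cost_le[OF opt, of "distr (measure_pmf q) borel (\<lambda>z. (fst z, snd z))"] c m1 m2 by simp
  also have "\<dots> = transport_cost \<gamma> + e * ((norm (fst y0 - snd y0))\<^sup>2 + (norm (fst y1 - snd y1))\<^sup>2
      - (norm (fst z0 - snd z0))\<^sup>2 - (norm (fst z1 - snd z1))\<^sup>2)"
    unfolding rms_power2 transport_cost_def by (rule qint) measurable
  also have "(norm (fst y0 - snd y0))\<^sup>2 + (norm (fst y1 - snd y1))\<^sup>2
      - (norm (fst z0 - snd z0))\<^sup>2 - (norm (fst z1 - snd z1))\<^sup>2 = 2 * ((fst z0 - fst z1) \<bullet> (snd z0 - snd z1))"
    unfolding power2_norm_eq_inner y0_def y1_def by (simp add: inner_simps inner_commute)
  finally show ?thesis using e by (simp add: zero_le_mult_iff)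
qed simp

lemma no_interior_crossing:
  fixes x x' y y' :: "'a::euclidean_space"
  assumes mono: "0 \<le> (x - x') \<bullet> (y - y')" and t: "0 < t" "t < 1"
    and eq: "(1 - t) *\<^sub>R x + t *\<^sub>R y = (1 - t) *\<^sub>R x' + t *\<^sub>R y'"
  shows "x = x'" "y = y'"
proof -
  have z: "(1 - t) *\<^sub>R (x - x') + t *\<^sub>R (y - y') = 0" using eq by (simp add: algebra_simps)
  have "0 = ((1 - t) *\<^sub>R (x - x') + t *\<^sub>R (y - y')) \<bullet> (x - x')" unfolding z by simp
  then have "0 = (1 - t) * ((x - x') \<bullet> (x - x')) + t * ((x - x') \<bullet> (y - y'))"
    unfolding inner_add_left inner_scaleR_left by (simp only: inner_commute[of "y - y'"])
  moreover have "0 \<le> t * ((x - x') \<bullet> (y - y'))" using t mono by simp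
  moreover have "0 \<le> (1 - t) * ((x - x') \<bullet> (x - x'))" using t by simp
  ultimately have "(1 - t) * ((x - x') \<bullet> (x - x')) = 0" by linarith
  then show "x = x'" using t by simp
  then show "y = y'" using z t by simp
qed

section \<open>Convexity along finitely supported geodesics\<close>

definition interpolate :: "real \<Rightarrow> 'a::euclidean_space \<times> 'a \<Rightarrow> 'a" where
  "interpolate t z = (1 - t) *\<^sub>R fst z + t *\<^sub>R snd z"

lemma interpolate_measurable [measurable]: "interpolate t \<in> borel_measurable borel"
  unfolding interpolate_def by measurable

lemma interpolate_shift: "interpolate (t + s) z = interpolate t z + s *\<^sub>R (snd z - fst z)"
  by (simp add: interpolate_def algebra_simps)

lemma interpolate_sqint:
  assumes "\<gamma> \<in> couplings \<mu> \<nu>"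
  shows "interpolate t \<in> sqint \<gamma>"
  unfolding interpolate_def[abs_def] using couplingsD(4,5)[OF assms] by (intro sqint_add sqint_scale)

lemma interpolant_in_P2:
  assumes "\<gamma> \<in> couplings \<mu> \<nu>"
  shows "distr \<gamma> borel (interpolate t) \<in> P2"
  using distr_in_P2[OF P2D(1)[OF couplingsD(1)[OF assms]] interpolate_sqint[OF assms]] .

text \<open>At the end points only continuity is available; there convexity is obtained as a limit from the
  interior.\<close>

lemma convex_from_second_derivative:
  fixes f :: "real \<Rightarrow> real"
  assumes cont: "\<And>t. t \<in> {0..1} \<Longrightarrow> isCont f t"
    and d1: "\<And>t. t \<in> {0<..<1} \<Longrightarrow> (f has_real_derivative f' t) (at t)"
    and d2: "\<And>t. t \<in> {0<..<1} \<Longrightarrow> (f' has_real_derivative f'' t) (at t)"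
    and ge: "\<And>t. t \<in> {0<..<1} \<Longrightarrow> K \<le> f'' t" and t: "t \<in> {0..1}"
  shows "f t \<le> (1 - t) * f 0 + t * f 1 - K / 2 * t * (1 - t)"
proof -
  define k where "k s = f s - K / 2 * s\<^sup>2" for s
  have "convex_on {0<..<1} k"
  proof (rule f''_ge0_imp_convex)
    show "(k has_real_derivative f' s - K * s) (at s)" if "s \<in> {0<..<1}" for s
      unfolding k_def by (auto intro!: derivative_eq_intros d1 that)
    show "((\<lambda>s. f' s - K * s) has_real_derivative f'' s - K) (at s)" if "s \<in> {0<..<1}" for s
      by (auto intro!: derivative_eq_intros d2 that)
  qed (use ge in auto)
  then have conv: "k ((1 - t) * a + t * b) \<le> (1 - t) * k a + t * k b" if "a \<in> {0<..<1}" "b \<in> {0<..<1}" for a b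
    using convex_onD[of "{0<..<1}" k t a b] t that by simp
  have kc: "isCont k s" if "s \<in> {0..1}" for s
    unfolding k_def by (intro continuous_intros cont that)
  define a where "a n = 1 / real (Suc (Suc n))" for n
  have a: "a n \<in> {0<..<1}" "1 - a n \<in> {0<..<1}" for n by (auto simp: a_def field_simps)
  have alim: "a \<longlonglongrightarrow> 0"
    using LIMSEQ_ignore_initial_segment[OF LIMSEQ_inverse_real_of_nat, of 1]
    by (simp add: a_def[abs_def] inverse_eq_divide)
  have blim: "(\<lambda>n. 1 - a n) \<longlonglongrightarrow> 1" using tendsto_diff[OF tendsto_const[of 1] alim] by simp
  have "(\<lambda>n. (1 - t) * a n + t * (1 - a n)) \<longlonglongrightarrow> (1 - t) * 0 + t * 1" by (intro tendsto_intros alim blim)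
  then have clim: "(\<lambda>n. (1 - t) * a n + t * (1 - a n)) \<longlonglongrightarrow> t" by simp
  have "k t \<le> (1 - t) * k 0 + t * k 1"
  proof (rule LIMSEQ_le)
    show "(\<lambda>n. k ((1 - t) * a n + t * (1 - a n))) \<longlonglongrightarrow> k t"
      by (rule isCont_tendsto_compose[OF kc[OF t] clim])
    show "(\<lambda>n. (1 - t) * k (a n) + t * k (1 - a n)) \<longlonglongrightarrow> (1 - t) * k 0 + t * k 1"
      by (intro tendsto_intros isCont_tendsto_compose[OF kc] alim blim) auto
  qed (use conv a in auto)
  then have "f t - K / 2 * t\<^sup>2 \<le> (1 - t) * f 0 + t * (f 1 - K / 2)" by (simp add: k_def)
  moreover have "c * t * (1 - t) = c * t - c * t\<^sup>2" for c :: real by (simp add: power2_eq_square algebra_simps)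
  moreover have "t * (f 1 - K / 2) = t * f 1 - K / 2 * t" by (simp add: algebra_simps)
  ultimately show ?thesis by (smt (verit))
qed

text \<open>Between finitely supported measures a geodesic moves finitely many atoms with constant velocities,
  and the atoms stay distinct at interior times.  Near such a time their velocities are the values
  of a single test gradient \<open>\<zeta>\<close> that is constant near each atom.  Hence \<open>F\<close> has along the geodesic the first
  derivative \<open>\<zeta> \<cdot> F\<close> and the second derivative \<open>\<zeta> \<cdot> (\<zeta> \<cdot> F)\<close>, which is the Hessian because \<open>\<nabla>\<zeta> \<zeta>\<close> vanishes
  at the atoms.\<close>

theorem convex_along_finite_geodesic:
  fixes F :: "'a::euclidean_space measure \<Rightarrow> real"
  assumes tw: "\<And>\<mu>. \<mu> \<in> P2 \<Longrightarrow> twice_wdifferentiable F \<mu>"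
    and hess: "\<And>\<mu> \<zeta>. \<mu> \<in> P2 \<Longrightarrow> \<zeta> \<in> test_gradients \<Longrightarrow> l * (rms \<mu> \<zeta>)\<^sup>2 \<le> pre_hess F \<mu> \<zeta> \<zeta>"
    and opt: "\<gamma> \<in> optimal_couplings \<mu> \<nu>" and S: "finite S" "AE z in \<gamma>. z \<in> S" and t: "t \<in> {0..1}"
  shows "F (distr \<gamma> borel (interpolate t)) \<le> (1 - t) * F \<mu> + t * F \<nu> - l / 2 * t * (1 - t) * (W2 \<mu> \<nu>)\<^sup>2"
proof -
  have g: "\<gamma> \<in> couplings \<mu> \<nu>" using optimal_couplingD(1)[OF opt] .
  have gP: "\<gamma> \<in> P2" using couplingsD(1)[OF g] .
  interpret prob_space \<gamma> using P2D[OF gP] by auto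
  have [measurable_cong]: "sets \<gamma> = sets borel" using P2D[OF gP] by auto
  define m where "m t = distr \<gamma> borel (interpolate t)" for t
  define f where "f t = F (m t)" for t
  have mP: "m t \<in> P2" for t unfolding m_def by (rule interpolant_in_P2[OF g])
  have d: "wdifferentiable F \<nu>" if "\<nu> \<in> P2" for \<nu> using twice_wdifferentiableD(1)[OF that tw[OF that]] .
  have cont: "isCont f t" for t
  proof -
    have "((\<lambda>s. W2 (m t) (m s)) \<longlongrightarrow> 0) (at t)"
    proof (rule Lim_null_comparison)
      have "((\<lambda>s. \<bar>s - t\<bar> * W2 \<mu> \<nu>) \<longlongrightarrow> \<bar>t - t\<bar> * W2 \<mu> \<nu>) (at t)" by (intro tendsto_intros)
      then show "((\<lambda>s. \<bar>s - t\<bar> * W2 \<mu> \<nu>) \<longlongrightarrow> 0) (at t)" by simp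
      have "W2 (m t) (m s) \<le> \<bar>s - t\<bar> * W2 \<mu> \<nu>" for s
      proof -
        have "W2 (m t) (m s) \<le> rms \<gamma> (\<lambda>z. interpolate t z - interpolate s z)"
          unfolding m_def by (rule W2_le_rms[OF P2D(1)[OF gP] interpolate_sqint[OF g] interpolate_sqint[OF g] refl refl])
        also have "(\<lambda>z. interpolate t z - interpolate s z) = (\<lambda>z. (t - s) *\<^sub>R (snd z - fst z))"
          by (simp add: fun_eq_iff interpolate_def algebra_simps)
        also have "rms \<gamma> \<dots> = \<bar>s - t\<bar> * W2 \<mu> \<nu>" using optimal_couplingD(3)[OF opt] by (simp add: rms_scale abs_minus_commute)
        finally show ?thesis .
      qed
      then show "\<forall>\<^sub>F s in at t. norm (W2 (m t) (m s)) \<le> \<bar>s - t\<bar> * W2 \<mu> \<nu>"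
        using W2_nonneg[OF mP mP] by auto
    qed
    from wdifferentiable_continuous[OF mP d[OF mP] mP this] show ?thesis
      by (simp add: isCont_def f_def[abs_def])
  qed
  define S0 where "S0 = {z \<in> S. measure \<gamma> {z} > 0}"
  have S0: "finite S0" using S(1) by (simp add: S0_def)
  have ae0: "AE z in \<gamma>. z \<in> S0"
  proof -
    have "AE z in \<gamma>. z \<noteq> s" if "s \<in> S - S0" for s
    proof -
      have "measure \<gamma> {s} = 0" using that measure_nonneg[of \<gamma> "{s}"] by (auto simp: S0_def simp del: measure_nonneg)
      then have "emeasure \<gamma> {s} = 0" by (simp add: emeasure_eq_measure)
      then show ?thesis using P2D[OF gP] by (intro AE_I[of _ _ "{s}"]) auto
    qed
    then have "AE z in \<gamma>. \<forall>s\<in>S - S0. z \<noteq> s" using S(1) by (intro AE_finite_allI) auto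
    with S(2) show ?thesis by eventually_elim auto
  qed
  have mono: "0 \<le> (fst z - fst z') \<bullet> (snd z - snd z')" if "z \<in> S0" "z' \<in> S0" for z z'
    using optimal_atoms_monotone[OF opt S] that by (auto simp: S0_def)
  \<comment> \<open>Near an interior time \<open>t0\<close> the geodesic moves along one test gradient, constant near each
    atom; hence it has no acceleration there.\<close>
  have moves: "\<exists>\<zeta>\<in>test_gradients. \<exists>\<rho>>0.
      (\<forall>t s. \<bar>t - t0\<bar> < \<rho> \<longrightarrow> m (t + s) = distr (m t) borel (\<lambda>x. x + s *\<^sub>R \<zeta> x)) \<and>
      (rms (m t0) \<zeta>)\<^sup>2 = (W2 \<mu> \<nu>)\<^sup>2 \<and> (AE x in m t0. frechet_derivative \<zeta> (at x) (\<zeta> x) = 0)"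
    if t0: "t0 \<in> {0<..<1}" for t0
  proof -
    have inj: "inj_on (interpolate t0) S0"
    proof (rule inj_onI)
      fix z z' assume z: "z \<in> S0" "z' \<in> S0" "interpolate t0 z = interpolate t0 z'"
      show "z = z'"
        using no_interior_crossing[OF mono[OF z(1,2)], of t0] t0 z(3)
        by (intro prod_eqI) (auto simp: interpolate_def)
    qed
    define v where "v x = (let z = inv_into S0 (interpolate t0) x in snd z - fst z)" for x
    have v: "v (interpolate t0 z) = snd z - fst z" if "z \<in> S0" for z
      using inv_into_f_f[OF inj that] by (simp add: v_def)
    have fin: "finite (interpolate t0 ` S0)" using S0 by simp
    obtain \<zeta> r where \<zeta>: "\<zeta> \<in> test_gradients" and r: "r > 0"
      and near: "\<And>p x. p \<in> interpolate t0 ` S0 \<Longrightarrow> norm (x - p) < r \<Longrightarrow> \<zeta> x = v p"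
      by (rule locally_constant_test_gradient[OF fin, of v]) (rule that, assumption+)
    have [measurable]: "\<zeta> \<in> borel_measurable borel" using test_gradient_sqint(2)[OF \<zeta> mP] .
    obtain N where N: "N > 0" "\<And>z. z \<in> S0 \<Longrightarrow> norm (snd z - fst z) \<le> N"
    proof -
      have "bounded ((\<lambda>z. snd z - fst z) ` S0)" using S0 by (intro finite_imp_bounded finite_imageI)
      then show ?thesis using that by (auto simp: bounded_pos)
    qed
    define \<rho> where "\<rho> = r / N"
    have \<rho>: "\<rho> > 0" using r N by (simp add: \<rho>_def)
    have \<zeta>v: "\<zeta> (interpolate t z) = snd z - fst z" if z: "z \<in> S0" and t: "\<bar>t - t0\<bar> < \<rho>" for t z
    proof -
      have "interpolate t z - interpolate t0 z = (t - t0) *\<^sub>R (snd z - fst z)"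
        by (simp add: interpolate_def algebra_simps)
      then have "norm (interpolate t z - interpolate t0 z) = \<bar>t - t0\<bar> * norm (snd z - fst z)" by simp
      also have "\<dots> \<le> \<bar>t - t0\<bar> * N" using N(2)[OF z] by (intro mult_left_mono) auto
      also have "\<dots> < r" using t N(1) by (simp add: \<rho>_def field_simps)
      finally have "norm (interpolate t z - interpolate t0 z) < r" .
      from near[OF _ this] show ?thesis using z v[OF z] by auto
    qed
    have shift: "m (t + s) = distr (m t) borel (\<lambda>x. x + s *\<^sub>R \<zeta> x)" if t: "\<bar>t - t0\<bar> < \<rho>" for t s
    proof -
      have "distr (m t) borel (\<lambda>x. x + s *\<^sub>R \<zeta> x) = distr \<gamma> borel (\<lambda>z. interpolate t z + s *\<^sub>R \<zeta> (interpolate t z))"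
        unfolding m_def by (subst distr_distr) (auto simp: o_def)
      also have "\<dots> = distr \<gamma> borel (interpolate (t + s))"
      proof (rule distr_cong_AE)
        show "AE z in \<gamma>. interpolate t z + s *\<^sub>R \<zeta> (interpolate t z) = interpolate (t + s) z"
          using ae0 by eventually_elim (simp add: \<zeta>v[OF _ t] interpolate_shift)
      qed auto
      finally show ?thesis by (simp add: m_def)
    qed
    have "(rms (m t0) \<zeta>)\<^sup>2 = (LINT z|\<gamma>. (norm (\<zeta> (interpolate t0 z)))\<^sup>2)"
      unfolding rms_power2 m_def by (subst integral_distr) auto
    also have "\<dots> = (LINT z|\<gamma>. (norm (snd z - fst z))\<^sup>2)"
      by (rule integral_cong_AE) (use ae0 \<rho> in \<open>auto simp: \<zeta>v elim!: eventually_mono\<close>)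
    also have "\<dots> = (W2 \<mu> \<nu>)\<^sup>2" using optimal_couplingD(3)[OF opt] by (simp flip: rms_power2)
    finally have norm: "(rms (m t0) \<zeta>)\<^sup>2 = (W2 \<mu> \<nu>)\<^sup>2" .
    have flat: "frechet_derivative \<zeta> (at x) = (\<lambda>_. 0)" if x: "x \<in> interpolate t0 ` S0" for x
    proof -
      have "((\<lambda>_. v x) has_derivative (\<lambda>_. 0)) (at x)" by simp
      then have "(\<zeta> has_derivative (\<lambda>_. 0)) (at x)"
        by (rule has_derivative_transform_within_open[where s="{y. norm (y - x) < r}"])
           (use r near[OF x] in \<open>auto intro!: open_Collect_less continuous_intros\<close>)
      then show ?thesis by (metis frechet_derivative_at)
    qed
    have "AE z in \<gamma>. interpolate t0 z \<in> interpolate t0 ` S0" using ae0 by eventually_elim auto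
    moreover have [measurable]: "interpolate t0 ` S0 \<in> sets borel" using finite_imp_closed[OF fin] by (rule borel_closed)
    ultimately have "AE x in m t0. x \<in> interpolate t0 ` S0"
      unfolding m_def by (subst AE_distr_iff) auto
    then have "AE x in m t0. frechet_derivative \<zeta> (at x) (\<zeta> x) = 0" by eventually_elim (simp add: flat)
    with \<zeta> \<rho> shift norm show ?thesis by blast
  qed
  have DERIV_shift0: "(h has_real_derivative D) (at t)" if "((\<lambda>s. h (t + s)) has_real_derivative D) (at 0)" for h :: "real \<Rightarrow> real" and D t
    using DERIV_shift[of h D 0 t] that by (simp add: add.commute)
  have second: "\<exists>D. (deriv f has_real_derivative D) (at t0) \<and> (f has_real_derivative deriv f t0) (at t0) \<and> l * (W2 \<mu> \<nu>)\<^sup>2 \<le> D"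
    if t0: "t0 \<in> {0<..<1}" for t0
  proof -
    obtain \<zeta> \<rho> where \<zeta>: "\<zeta> \<in> test_gradients" and \<rho>: "\<rho> > 0"
      and shift: "\<And>t s. \<bar>t - t0\<bar> < \<rho> \<Longrightarrow> m (t + s) = distr (m t) borel (\<lambda>x. x + s *\<^sub>R \<zeta> x)"
      and norm: "(rms (m t0) \<zeta>)\<^sup>2 = (W2 \<mu> \<nu>)\<^sup>2"
      and flat: "AE x in m t0. frechet_derivative \<zeta> (at x) (\<zeta> x) = 0"
      using moves[OF t0] by blast
    define G where "G \<nu> = dir_deriv \<zeta> F \<nu>" for \<nu>
    have f': "(f has_real_derivative G (m t)) (at t)" if "\<bar>t - t0\<bar> < \<rho>" for t
    proof (rule DERIV_shift0)
      have "((\<lambda>s. F (distr (m t) borel (\<lambda>x. x + s *\<^sub>R \<zeta> x))) has_real_derivative L2_inner (m t) \<zeta> (wgrad F (m t))) (at 0)"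
        by (rule derivative_along_test_gradient[OF mP wgrad_in_wsubdiff[OF mP d[OF mP]] \<zeta>])
      then show "((\<lambda>s. f (t + s)) has_real_derivative G (m t)) (at 0)"
        by (simp add: f_def shift[OF that] G_def dir_deriv_def)
    qed
    have Gd: "wdifferentiable G (m t0)"
      unfolding G_def[abs_def] by (rule twice_wdifferentiableD(2)[OF mP tw[OF mP] \<zeta>])
    have G': "((\<lambda>t. G (m t)) has_real_derivative dir_deriv \<zeta> G (m t0)) (at t0)"
    proof (rule DERIV_shift0)
      have "((\<lambda>s. G (distr (m t0) borel (\<lambda>x. x + s *\<^sub>R \<zeta> x))) has_real_derivative L2_inner (m t0) \<zeta> (wgrad G (m t0))) (at 0)"
        by (rule derivative_along_test_gradient[OF mP wgrad_in_wsubdiff[OF mP Gd] \<zeta>])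
      then show "((\<lambda>s. G (m (t0 + s))) has_real_derivative dir_deriv \<zeta> G (m t0)) (at 0)"
        using \<rho> by (simp add: shift dir_deriv_def)
    qed
    have df: "deriv f t = G (m t)" if "\<bar>t - t0\<bar> < \<rho>" for t using f'[OF that] by (rule DERIV_imp_deriv)
    have "(deriv f has_real_derivative dir_deriv \<zeta> G (m t0)) (at t0)"
      by (rule has_field_derivative_transform_within_open[OF G', of "{t. \<bar>t - t0\<bar> < \<rho>}"])
         (use \<rho> df in \<open>auto intro!: open_Collect_less continuous_intros\<close>)
    moreover have "(f has_real_derivative deriv f t0) (at t0)" using f'[of t0] df[of t0] \<rho> by simp
    moreover have "l * (W2 \<mu> \<nu>)\<^sup>2 \<le> dir_deriv \<zeta> G (m t0)"
    proof -
      have "dir_deriv (\<lambda>x. frechet_derivative \<zeta> (at x) (\<zeta> x)) F (m t0) = 0"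
        unfolding dir_deriv_def L2_inner_def
        by (rule integral_eq_zero_AE) (use flat in \<open>auto elim!: eventually_mono\<close>)
      then have "pre_hess F (m t0) \<zeta> \<zeta> = dir_deriv \<zeta> G (m t0)" by (simp add: pre_hess_def G_def[abs_def])
      then show ?thesis using hess[OF mP \<zeta>, of t0] norm by simp
    qed
    ultimately show ?thesis by blast
  qed
  then obtain D where D: "\<And>t. t \<in> {0<..<1} \<Longrightarrow> (deriv f has_real_derivative D t) (at t)"
    "\<And>t. t \<in> {0<..<1} \<Longrightarrow> (f has_real_derivative deriv f t) (at t)"
    "\<And>t. t \<in> {0<..<1} \<Longrightarrow> l * (W2 \<mu> \<nu>)\<^sup>2 \<le> D t" by metis
  have "f t \<le> (1 - t) * f 0 + t * f 1 - l * (W2 \<mu> \<nu>)\<^sup>2 / 2 * t * (1 - t)"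
    by (rule convex_from_second_derivative[OF cont D(2) D(1) D(3) t])
  moreover have "f 0 = F \<mu>" "f 1 = F \<nu>"
    using couplingsD(2,3)[OF g] by (simp_all add: f_def m_def interpolate_def[abs_def])
  ultimately show ?thesis by (simp add: f_def m_def algebra_simps)
qed

section \<open>Approximation by finitely supported measures\<close>

text \<open>Simple functions \<open>T\<^sub>n\<close> that converge to the identity map \<open>\<mu>\<close> and \<open>\<nu>\<close> to finitely supported measures.
  Optimal couplings of these have a limit, which is an optimal coupling of \<open>\<mu>\<close> and \<open>\<nu>\<close>; as \<open>F\<close> is
  continuous, the convexity inequality passes to the limit.\<close>

theorem pre_hess_ge_imp_convex:
  fixes F :: "'a::euclidean_space measure \<Rightarrow> real"
  assumes tw: "\<And>\<mu>. \<mu> \<in> P2 \<Longrightarrow> twice_wdifferentiable F \<mu>"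
    and hess: "\<And>\<mu> \<zeta>. \<mu> \<in> P2 \<Longrightarrow> \<zeta> \<in> test_gradients \<Longrightarrow> l * (rms \<mu> \<zeta>)\<^sup>2 \<le> pre_hess F \<mu> \<zeta> \<zeta>"
  shows "geodesically_convex l F"
  unfolding geodesically_convex_def
proof (intro ballI)
  fix \<mu> \<nu> :: "'a measure" assume \<mu>: "\<mu> \<in> P2" and \<nu>: "\<nu> \<in> P2"
  have d: "wdifferentiable F \<nu>" if "\<nu> \<in> P2" for \<nu> using twice_wdifferentiableD(1)[OF that tw[OF that]] .
  obtain T :: "nat \<Rightarrow> 'a \<Rightarrow> 'a" where Ts: "\<And>n. simple_function borel (T n)"
    and Tlim: "\<And>x. (\<lambda>n. T n x) \<longlonglongrightarrow> x" and Tb: "\<And>n x. norm (T n x) \<le> 2 * norm x"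
  proof -
    have "\<exists>T. (\<forall>i. simple_function borel (T i)) \<and> (\<forall>x\<in>space (borel :: 'a measure). (\<lambda>i. T i x) \<longlonglongrightarrow> x) \<and>
        (\<forall>i. \<forall>x\<in>space (borel :: 'a measure). dist (T i x) 0 \<le> 2 * dist x 0)"
      by (rule borel_measurable_implies_sequence_metric) simp
    then show ?thesis using that by auto
  qed
  have [measurable]: "T n \<in> borel_measurable borel" for n using borel_measurable_simple_function[OF Ts] .
  have Tsq: "T n \<in> sqint \<kappa>" if "\<kappa> \<in> P2" for \<kappa> n
  proof (rule sqint_bound)
    show "integrable \<kappa> (\<lambda>x. 4 * (norm x)\<^sup>2)" using P2D(4)[OF that] by simp
    have "(norm (T n x))\<^sup>2 \<le> 4 * (norm x)\<^sup>2" for x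
      using power_mono[OF Tb[of n x], of 2] by (simp add: power_mult_distrib)
    then show "AE x in \<kappa>. (norm (T n x))\<^sup>2 \<le> 4 * (norm x)\<^sup>2" by simp
  qed (simp add: P2_measurable_iff[OF that])
  have TP: "distr \<kappa> borel (T n) \<in> P2" if "\<kappa> \<in> P2" for \<kappa> n
    using distr_in_P2[OF P2D(1)[OF that] Tsq[OF that]] .
  have Tconv: "W2_converges (\<lambda>n. distr \<kappa> borel (T n)) \<kappa>" if \<kappa>: "\<kappa> \<in> P2" for \<kappa>
    unfolding W2_converges_def
  proof (intro conjI allI impI)
    interpret prob_space \<kappa> using P2D[OF \<kappa>] by auto
    have [measurable_cong]: "sets \<kappa> = sets borel" using P2D[OF \<kappa>] by auto
    fix h :: "'a \<Rightarrow> real" assume h: "continuous_on UNIV h" "\<forall>x. 0 \<le> h x \<and> h x \<le> 1"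
    have [measurable]: "h \<in> borel_measurable borel" using h(1) by (rule borel_measurable_continuous_onI)
    have "(\<lambda>n. LINT x|\<kappa>. h (T n x)) \<longlonglongrightarrow> (LINT x|\<kappa>. h x)"
      by (rule integral_dominated_convergence[where w="\<lambda>_. 1"])
         (use h continuous_on_tendsto_compose[OF h(1) Tlim] in auto)
    then show "(\<lambda>n. LINT x|distr \<kappa> borel (T n). h x) \<longlonglongrightarrow> (LINT x|\<kappa>. h x)" by (simp add: integral_distr)
  next
    have [measurable_cong]: "sets \<kappa> = sets borel" using P2D[OF \<kappa>] by auto
    have "(\<lambda>n. LINT x|\<kappa>. (norm (T n x))\<^sup>2) \<longlonglongrightarrow> (LINT x|\<kappa>. (norm x)\<^sup>2)"
    proof (rule integral_dominated_convergence[where w="\<lambda>x. 4 * (norm x)\<^sup>2"])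
      show "AE x in \<kappa>. (\<lambda>n. (norm (T n x))\<^sup>2) \<longlonglongrightarrow> (norm x)\<^sup>2" by (intro always_eventually allI tendsto_intros Tlim)
      have "(norm (T n x))\<^sup>2 \<le> 4 * (norm x)\<^sup>2" for n x
        using power_mono[OF Tb[of n x], of 2] by (simp add: power_mult_distrib)
      then show "AE x in \<kappa>. norm ((norm (T n x))\<^sup>2) \<le> 4 * (norm x)\<^sup>2" for n by simp
    qed (use P2D(4)[OF \<kappa>] in auto)
    then show "(\<lambda>n. LINT x|distr \<kappa> borel (T n). (norm x)\<^sup>2) \<longlonglongrightarrow> (LINT x|\<kappa>. (norm x)\<^sup>2)" by (simp add: integral_distr)
  qed
  define \<mu>s where "\<mu>s n = distr \<mu> borel (T n)" for n
  define \<nu>s where "\<nu>s n = distr \<nu> borel (T n)" for n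
  have sP: "\<mu>s n \<in> P2" "\<nu>s n \<in> P2" for n using TP \<mu> \<nu> by (auto simp: \<mu>s_def \<nu>s_def)
  have "\<forall>n. \<exists>\<gamma>. \<gamma> \<in> optimal_couplings (\<mu>s n) (\<nu>s n)" using optimal_coupling_exists[OF sP] by blast
  then obtain \<gamma> where opt: "\<And>n. \<gamma> n \<in> optimal_couplings (\<mu>s n) (\<nu>s n)" by metis
  have g: "\<gamma> n \<in> couplings (\<mu>s n) (\<nu>s n)" for n using optimal_couplingD(1)[OF opt] .
  have cv: "W2_converges \<mu>s \<mu>" "W2_converges \<nu>s \<nu>"
    unfolding \<mu>s_def \<nu>s_def using Tconv \<mu> \<nu> by auto
  obtain r :: "nat \<Rightarrow> nat" and \<Omega> :: "real measure" and A B A' B' where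
    r: "strict_mono r" and \<Omega>: "prob_space \<Omega>" and A: "\<And>n. A n \<in> sqint \<Omega>" and B: "\<And>n. B n \<in> sqint \<Omega>"
    and A': "A' \<in> sqint \<Omega>" and B': "B' \<in> sqint \<Omega>"
    and dAB: "\<And>n. distr \<Omega> borel (\<lambda>\<omega>. (A n \<omega>, B n \<omega>)) = \<gamma> (r n)"
    and d': "distr \<Omega> borel A' = \<mu>" "distr \<Omega> borel B' = \<nu>"
    and lA: "(\<lambda>n. rms \<Omega> (\<lambda>\<omega>. A n \<omega> - A' \<omega>)) \<longlonglongrightarrow> 0" and lB: "(\<lambda>n. rms \<Omega> (\<lambda>\<omega>. B n \<omega> - B' \<omega>)) \<longlonglongrightarrow> 0"
    by (rule couplings_compact[of \<mu> \<nu> \<gamma> \<mu>s \<nu>s, OF \<mu> \<nu> g cv]) (rule that, assumption+)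
  define X where "X n t \<omega> = interpolate t (A n \<omega>, B n \<omega>)" for n t \<omega>
  define X' where "X' t \<omega> = interpolate t (A' \<omega>, B' \<omega>)" for t \<omega>
  have Xs: "X n t \<in> sqint \<Omega>" "X' t \<in> sqint \<Omega>" for n t
    unfolding X_def[abs_def] X'_def[abs_def] interpolate_def using A B A' B' by (auto intro!: sqint_add sqint_scale)
  have [measurable]: "A n \<in> borel_measurable \<Omega>" "B n \<in> borel_measurable \<Omega>" "A' \<in> borel_measurable \<Omega>"
    "B' \<in> borel_measurable \<Omega>" for n using A B A' B' by auto
  have [measurable]: "(\<lambda>\<omega>. (A n \<omega>, B n \<omega>)) \<in> borel_measurable \<Omega>" "(\<lambda>\<omega>. (A' \<omega>, B' \<omega>)) \<in> borel_measurable \<Omega>" for n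
    by (rule borel_measurable_Pair; measurable)+
  have lX: "(\<lambda>n. rms \<Omega> (\<lambda>\<omega>. X' t \<omega> - X n t \<omega>)) \<longlonglongrightarrow> 0" for t
  proof (rule Lim_null_comparison)
    have "(\<lambda>n. \<bar>1 - t\<bar> * rms \<Omega> (\<lambda>\<omega>. A n \<omega> - A' \<omega>) + \<bar>t\<bar> * rms \<Omega> (\<lambda>\<omega>. B n \<omega> - B' \<omega>)) \<longlonglongrightarrow> \<bar>1 - t\<bar> * 0 + \<bar>t\<bar> * 0"
      by (intro tendsto_intros lA lB)
    then show "(\<lambda>n. \<bar>1 - t\<bar> * rms \<Omega> (\<lambda>\<omega>. A n \<omega> - A' \<omega>) + \<bar>t\<bar> * rms \<Omega> (\<lambda>\<omega>. B n \<omega> - B' \<omega>)) \<longlonglongrightarrow> 0" by simp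
    have "rms \<Omega> (\<lambda>\<omega>. X' t \<omega> - X n t \<omega>) \<le> \<bar>1 - t\<bar> * rms \<Omega> (\<lambda>\<omega>. A n \<omega> - A' \<omega>) + \<bar>t\<bar> * rms \<Omega> (\<lambda>\<omega>. B n \<omega> - B' \<omega>)" for n
    proof -
      have "X n t \<omega> - X' t \<omega> = (1 - t) *\<^sub>R (A n \<omega> - A' \<omega>) + t *\<^sub>R (B n \<omega> - B' \<omega>)" for \<omega>
        by (simp add: X_def X'_def interpolate_def algebra_simps)
      then show ?thesis
        using rms_add_le[OF sqint_scale[OF sqint_diff[OF A[of n] A'], of "1 - t"] sqint_scale[OF sqint_diff[OF B[of n] B'], of t]]
        by (simp add: rms_scale rms_minus_commute[of \<Omega> "X' t"])
    qed
    then show "\<forall>\<^sub>F n in sequentially. norm (rms \<Omega> (\<lambda>\<omega>. X' t \<omega> - X n t \<omega>))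
        \<le> \<bar>1 - t\<bar> * rms \<Omega> (\<lambda>\<omega>. A n \<omega> - A' \<omega>) + \<bar>t\<bar> * rms \<Omega> (\<lambda>\<omega>. B n \<omega> - B' \<omega>)" by simp
  qed
  have lF: "(\<lambda>n. F (distr \<Omega> borel (X n t))) \<longlonglongrightarrow> F (distr \<Omega> borel (X' t))" for t
  proof (rule wdifferentiable_continuous)
    show P: "distr \<Omega> borel (X' t) \<in> P2" "distr \<Omega> borel (X n t) \<in> P2" for n using distr_in_P2[OF \<Omega>] Xs by auto
    show "wdifferentiable F (distr \<Omega> borel (X' t))" by (rule d[OF P(1)])
    show "(\<lambda>n. W2 (distr \<Omega> borel (X' t)) (distr \<Omega> borel (X n t))) \<longlonglongrightarrow> 0"
      by (rule Lim_null_comparison[OF always_eventually lX[of t]])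
         (use W2_le_rms[OF \<Omega> Xs(2) Xs(1) refl refl] W2_nonneg[OF P] in auto)
  qed
  have lD: "(\<lambda>n. rms \<Omega> (\<lambda>\<omega>. A n \<omega> - B n \<omega>)) \<longlonglongrightarrow> rms \<Omega> (\<lambda>\<omega>. A' \<omega> - B' \<omega>)"
  proof (rule rms_tendsto)
    show "(\<lambda>n. rms \<Omega> (\<lambda>\<omega>. (A n \<omega> - B n \<omega>) - (A' \<omega> - B' \<omega>))) \<longlonglongrightarrow> 0"
    proof (rule Lim_null_comparison)
      show "(\<lambda>n. rms \<Omega> (\<lambda>\<omega>. A n \<omega> - A' \<omega>) + rms \<Omega> (\<lambda>\<omega>. B n \<omega> - B' \<omega>)) \<longlonglongrightarrow> 0" using tendsto_add[OF lA lB] by simp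
      have "rms \<Omega> (\<lambda>\<omega>. (A n \<omega> - B n \<omega>) - (A' \<omega> - B' \<omega>)) \<le> rms \<Omega> (\<lambda>\<omega>. A n \<omega> - A' \<omega>) + rms \<Omega> (\<lambda>\<omega>. B n \<omega> - B' \<omega>)" for n
        using rms_add_le[OF sqint_diff[OF A[of n] A'] sqint_scale[OF sqint_diff[OF B[of n] B'], of "-1"]]
          rms_scale[of \<Omega> "-1" "\<lambda>\<omega>. B n \<omega> - B' \<omega>"] by (simp add: algebra_simps)
      then show "\<forall>\<^sub>F n in sequentially. norm (rms \<Omega> (\<lambda>\<omega>. (A n \<omega> - B n \<omega>) - (A' \<omega> - B' \<omega>)))
        \<le> rms \<Omega> (\<lambda>\<omega>. A n \<omega> - A' \<omega>) + rms \<Omega> (\<lambda>\<omega>. B n \<omega> - B' \<omega>)" by simp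
    qed
  qed (use A B A' B' in \<open>auto intro: sqint_diff\<close>)
  have cost: "(W2 (\<mu>s (r n)) (\<nu>s (r n)))\<^sup>2 = (rms \<Omega> (\<lambda>\<omega>. A n \<omega> - B n \<omega>))\<^sup>2" for n
    using optimal_couplingD(2)[OF opt[of "r n"]] coupling_of_random_variables(2)[OF \<Omega> A B, of n n] by (simp add: dAB)
  define \<eta> where "\<eta> = distr \<Omega> borel (\<lambda>\<omega>. (A' \<omega>, B' \<omega>))"
  have \<eta>c: "\<eta> \<in> couplings \<mu> \<nu>" "transport_cost \<eta> = (rms \<Omega> (\<lambda>\<omega>. A' \<omega> - B' \<omega>))\<^sup>2"
    using coupling_of_random_variables[OF \<Omega> A' B'] d' by (auto simp: \<eta>_def)
  \<comment> \<open>The limit coupling is optimal: \<open>T\<^sub>n \<times> T\<^sub>n\<close> maps an optimal coupling of \<open>\<mu>\<close> and \<open>\<nu>\<close> to a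
    competitor of \<open>\<gamma> n\<close> whose cost converges to \<open>W2 \<mu> \<nu>\<close> squared.\<close>
  have \<eta>opt: "\<eta> \<in> optimal_couplings \<mu> \<nu>"
  proof -
    obtain \<kappa> where \<kappa>: "\<kappa> \<in> optimal_couplings \<mu> \<nu>" using optimal_coupling_exists[OF \<mu> \<nu>] by blast
    have k: "\<kappa> \<in> couplings \<mu> \<nu>" using optimal_couplingD(1)[OF \<kappa>] .
    have kP: "\<kappa> \<in> P2" using couplingsD(1)[OF k] .
    have [measurable_cong]: "sets \<kappa> = sets borel" using P2D[OF kP] by auto
    have T12: "(\<lambda>z. T n (fst z)) \<in> sqint \<kappa>" "(\<lambda>z. T n (snd z)) \<in> sqint \<kappa>" for n
    proof -
      show "(\<lambda>z. T n (fst z)) \<in> sqint \<kappa>" using coupling_sqint_fst(1)[OF k Tsq[OF \<mu>]] .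
      have "integrable \<kappa> (\<lambda>z. (norm (T n (snd z)))\<^sup>2)"
        using coupling_marginals(4)[OF k, of "\<lambda>x. (norm (T n x))\<^sup>2"] Tsq[OF \<nu>, of n] by auto
      then show "(\<lambda>z. T n (snd z)) \<in> sqint \<kappa>" by (simp add: sqint_def)
    qed
    have le: "W2 (\<mu>s n) (\<nu>s n) \<le> rms \<kappa> (\<lambda>z. T n (fst z) - T n (snd z))" for n
    proof (rule W2_le_rms[OF P2D(1)[OF kP] T12])
      show "distr \<kappa> borel (\<lambda>z. T n (fst z)) = \<mu>s n" "distr \<kappa> borel (\<lambda>z. T n (snd z)) = \<nu>s n"
        unfolding \<mu>s_def \<nu>s_def couplingsD(2,3)[OF k, symmetric] by (subst distr_distr; auto simp: o_def)+
    qed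
    have "(\<lambda>n. LINT z|\<kappa>. (norm (T n (fst z) - T n (snd z)))\<^sup>2) \<longlonglongrightarrow> (LINT z|\<kappa>. (norm (fst z - snd z))\<^sup>2)"
    proof (rule integral_dominated_convergence[where w="\<lambda>z. 8 * (norm (fst z))\<^sup>2 + 8 * (norm (snd z))\<^sup>2"])
      show "integrable \<kappa> (\<lambda>z. 8 * (norm (fst z))\<^sup>2 + 8 * (norm (snd z))\<^sup>2)" using sqintD(2)[OF couplingsD(4)[OF k]] sqintD(2)[OF couplingsD(5)[OF k]] by simp
      show "AE z in \<kappa>. (\<lambda>n. (norm (T n (fst z) - T n (snd z)))\<^sup>2) \<longlonglongrightarrow> (norm (fst z - snd z))\<^sup>2"
        by (intro always_eventually allI tendsto_intros Tlim)
      have "(norm (T n x - T n y))\<^sup>2 \<le> 8 * (norm x)\<^sup>2 + 8 * (norm y)\<^sup>2" for n x y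
        using norm_add_power2_le[of "T n x" "- T n y"] power_mono[OF Tb[of n x], of 2] power_mono[OF Tb[of n y], of 2]
        by (simp add: power_mult_distrib)
      then show "AE z in \<kappa>. norm ((norm (T n (fst z) - T n (snd z)))\<^sup>2) \<le> 8 * (norm (fst z))\<^sup>2 + 8 * (norm (snd z))\<^sup>2" for n
        by simp
    qed auto
    from tendsto_real_sqrt[OF this] have "(\<lambda>n. rms \<kappa> (\<lambda>z. T n (fst z) - T n (snd z))) \<longlonglongrightarrow> rms \<kappa> (\<lambda>z. fst z - snd z)"
      by (simp add: rms_def)
    moreover have "rms \<kappa> (\<lambda>z. fst z - snd z) = W2 \<mu> \<nu>"
      using optimal_couplingD(3)[OF \<kappa>] by (subst rms_minus_commute)
    ultimately have lim: "(\<lambda>n. rms \<kappa> (\<lambda>z. T (r n) (fst z) - T (r n) (snd z))) \<longlonglongrightarrow> W2 \<mu> \<nu>"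
      using LIMSEQ_subseq_LIMSEQ[OF _ r] by (fastforce simp: o_def)
    have "rms \<Omega> (\<lambda>\<omega>. A n \<omega> - B n \<omega>) \<le> rms \<kappa> (\<lambda>z. T (r n) (fst z) - T (r n) (snd z))" for n
    proof -
      have "rms \<Omega> (\<lambda>\<omega>. A n \<omega> - B n \<omega>) = W2 (\<mu>s (r n)) (\<nu>s (r n))"
        using cost[of n] W2_nonneg[OF sP, of "r n" "r n"] by (simp add: power2_eq_iff_nonneg)
      then show ?thesis using le by simp
    qed
    then have "rms \<Omega> (\<lambda>\<omega>. A' \<omega> - B' \<omega>) \<le> W2 \<mu> \<nu>" by (intro LIMSEQ_le[OF lD lim]) auto
    then show ?thesis using \<eta>c by (intro optimal_couplingI) (auto intro: power_mono)
  qed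
  have dX: "distr (\<gamma> (r n)) borel (interpolate t) = distr \<Omega> borel (X n t)" for n t
    unfolding dAB[symmetric] X_def[abs_def] by (subst distr_distr) (auto simp: o_def)
  have dX': "distr \<eta> borel (interpolate t) = distr \<Omega> borel (X' t)" for t
    unfolding \<eta>_def X'_def[abs_def] by (subst distr_distr) (auto simp: o_def)
  have ineq: "F (distr \<Omega> borel (X n t)) \<le> (1 - t) * F (distr \<Omega> borel (X n 0)) + t * F (distr \<Omega> borel (X n 1))
      - l / 2 * t * (1 - t) * (rms \<Omega> (\<lambda>\<omega>. A n \<omega> - B n \<omega>))\<^sup>2" if t: "t \<in> {0..1}" for n t
  proof -
    have fin: "finite (range (T (r n)))" using Ts[of "r n"] by (simp add: simple_function_def)
    then have [measurable]: "range (T (r n)) \<in> sets borel" by (intro borel_closed finite_imp_closed)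
    have aeT: "AE x in distr \<kappa> borel (T (r n)). x \<in> range (T (r n))" if "\<kappa> \<in> P2" for \<kappa>
      by (subst AE_distr_iff) (auto simp: P2_measurable_iff[OF that])
    have ae1: "AE z in \<gamma> (r n). fst z \<in> range (T (r n))"
      using aeT[OF \<mu>] unfolding \<mu>s_def[symmetric] couplingsD(2)[OF g, symmetric]
      by (subst (asm) AE_distr_iff) (auto simp: P2_measurable_iff[OF couplingsD(1)[OF g]])
    have ae2: "AE z in \<gamma> (r n). snd z \<in> range (T (r n))"
      using aeT[OF \<nu>] unfolding \<nu>s_def[symmetric] couplingsD(3)[OF g, symmetric]
      by (subst (asm) AE_distr_iff) (auto simp: P2_measurable_iff[OF couplingsD(1)[OF g]])
    from ae1 ae2 have "AE z in \<gamma> (r n). z \<in> range (T (r n)) \<times> range (T (r n))"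
      by eventually_elim (auto simp: mem_Times_iff)
    from convex_along_finite_geodesic[OF tw hess opt _ this t] fin
    have "F (distr (\<gamma> (r n)) borel (interpolate t)) \<le> (1 - t) * F (\<mu>s (r n)) + t * F (\<nu>s (r n))
        - l / 2 * t * (1 - t) * (W2 (\<mu>s (r n)) (\<nu>s (r n)))\<^sup>2" by simp
    moreover have "\<mu>s (r n) = distr \<Omega> borel (X n 0)" "\<nu>s (r n) = distr \<Omega> borel (X n 1)"
      using dX[of n 0] dX[of n 1] couplingsD(2,3)[OF g[of "r n"]] by (simp_all add: interpolate_def[abs_def])
    ultimately show ?thesis unfolding dX cost by simp
  qed
  show "\<exists>m. is_geodesic \<mu> \<nu> m \<and> (\<forall>t\<in>{0..1}. F (m t) \<le> (1 - t) * F \<mu> + t * F \<nu> - l / 2 * t * (1 - t) * (W2 \<mu> \<nu>)\<^sup>2)"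
  proof (intro exI[of _ "\<lambda>t. distr \<eta> borel (interpolate t)"] conjI ballI)
    show "is_geodesic \<mu> \<nu> (\<lambda>t. distr \<eta> borel (interpolate t))"
      unfolding is_geodesic_def using \<eta>opt by (auto simp: interpolate_def[abs_def])
    fix t :: real assume t: "t \<in> {0..1}"
    have "F (distr \<Omega> borel (X' t)) \<le> (1 - t) * F (distr \<Omega> borel (X' 0)) + t * F (distr \<Omega> borel (X' 1))
      - l / 2 * t * (1 - t) * (rms \<Omega> (\<lambda>\<omega>. A' \<omega> - B' \<omega>))\<^sup>2"
    proof (rule LIMSEQ_le[OF lF])
      show "(\<lambda>n. (1 - t) * F (distr \<Omega> borel (X n 0)) + t * F (distr \<Omega> borel (X n 1))
        - l / 2 * t * (1 - t) * (rms \<Omega> (\<lambda>\<omega>. A n \<omega> - B n \<omega>))\<^sup>2) \<longlonglongrightarrow> (1 - t) * F (distr \<Omega> borel (X' 0)) + t * F (distr \<Omega> borel (X' 1))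
        - l / 2 * t * (1 - t) * (rms \<Omega> (\<lambda>\<omega>. A' \<omega> - B' \<omega>))\<^sup>2"
        by (intro tendsto_intros lF lD)
    qed (use ineq[OF t] in auto)
    moreover have "distr \<Omega> borel (X' 0) = \<mu>" "distr \<Omega> borel (X' 1) = \<nu>"
      using d' by (simp_all add: X'_def[abs_def] interpolate_def)
    ultimately show "F (distr \<eta> borel (interpolate t)) \<le> (1 - t) * F \<mu> + t * F \<nu> - l / 2 * t * (1 - t) * (W2 \<mu> \<nu>)\<^sup>2"
      using optimal_couplingD(2)[OF \<eta>opt] \<eta>c(2) by (simp add: dX')
  qed
qed

theorem theorem1p3:
  fixes F :: "(real ^ 'd) measure \<Rightarrow> real" and l :: real
  assumes "\<And>\<mu>. \<mu> \<in> P2 \<Longrightarrow> twice_wdifferentiable F \<mu>"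
  shows "geodesically_convex l F \<longleftrightarrow>
    (\<forall>\<mu>\<in>P2. \<forall>\<zeta>\<in>tangent_space \<mu>. Hess F \<mu> \<zeta> \<zeta> \<ge> l * (L2_norm \<mu> \<zeta>)\<^sup>2)"
proof
  assume c: "geodesically_convex l F"
  show "\<forall>\<mu>\<in>P2. \<forall>\<zeta>\<in>tangent_space \<mu>. Hess F \<mu> \<zeta> \<zeta> \<ge> l * (L2_norm \<mu> \<zeta>)\<^sup>2"
  proof (intro ballI)
    fix \<mu> :: "(real ^ 'd) measure" and \<zeta> assume \<mu>: "\<mu> \<in> P2" and \<zeta>: "\<zeta> \<in> tangent_space \<mu>"
    have "l * (rms \<mu> \<zeta>)\<^sup>2 \<le> Hess F \<mu> \<zeta> \<zeta>"
    proof (rule quadratic_bound_extends[OF \<mu> Hess_extends_pre_hess(1)[OF assms \<mu>] _ \<zeta>])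
      fix \<zeta> :: "real ^ 'd \<Rightarrow> real ^ 'd" assume z: "\<zeta> \<in> test_gradients"
      show "l * (rms \<mu> \<zeta>)\<^sup>2 \<le> Hess F \<mu> \<zeta> \<zeta>"
        using convex_imp_pre_hess_ge[OF c assms \<mu> z] Hess_extends_pre_hess(2)[OF assms \<mu> z z] by simp
    qed
    then show "Hess F \<mu> \<zeta> \<zeta> \<ge> l * (L2_norm \<mu> \<zeta>)\<^sup>2" by (simp add: L2_norm_eq_rms)
  qed
next
  assume h: "\<forall>\<mu>\<in>P2. \<forall>\<zeta>\<in>tangent_space \<mu>. Hess F \<mu> \<zeta> \<zeta> \<ge> l * (L2_norm \<mu> \<zeta>)\<^sup>2"
  show "geodesically_convex l F"
  proof (rule pre_hess_ge_imp_convex[OF assms])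
    fix \<mu> :: "(real ^ 'd) measure" and \<zeta> :: "real ^ 'd \<Rightarrow> real ^ 'd" assume \<mu>: "\<mu> \<in> P2" and z: "\<zeta> \<in> test_gradients"
    show "l * (rms \<mu> \<zeta>)\<^sup>2 \<le> pre_hess F \<mu> \<zeta> \<zeta>"
      using bspec[OF bspec[OF h \<mu>] test_gradients_tangent[OF z \<mu>]] Hess_extends_pre_hess(2)[OF assms \<mu> z z]
      by (simp add: L2_norm_eq_rms)
  qed
qed

end
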